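(* Let $\lambda = (\lambda_1,\ldots,\lambda_n)$ be a partition. Then the Ferrers ideal $I_\lambda$ is sequentially Cohen-Macaulay if and only if $\lambda$ is saturated.
   Context: Let $\mathrm{k}$ be a field. A partition is a sequence of positive integers $\lambda=(\lambda_1\ge\lambda_2\ge\cdots\ge\lambda_n\ge 1)$; by convention $\lambda_j=0$ for $j>n$. Put $m=\lambda_1$ and $S=\mathrm{k}[x_1,\ldots,x_n,y_1,\ldots,y_m]$. The Ferrers ideal of $\lambda$ is $I_\lambda=(x_iy_j\mid 1\le i\le n,\ 1\le j\le\lambda_i)\subset S$. A partition $\lambda$ is saturated if either $\lambda$ is strictly decreasing ($\lambda_1>\lambda_2>\cdots>\lambda_n$), or $\{\lambda_i,\lambda_i-1,\ldots,1\}\subseteq\{\lambda_1,\ldots,\lambda_n\}$, where $i$ is the smallest index such that $\lambda_i=\lambda_{i+1}$. A graded $S$-module $M$ is sequentially Cohen-Macaulay if there is a filtration $0=M_0\subset M_1\subset\cdots\subset M_r=M$ by graded $S$-submodules such that every $M_i/M_{i-1}$ is Cohen-Macaulay and $\dim(M_i/M_{i-1})<\dim(M_{i+1}/M_i)$ for all $i$. An ideal $J$ is sequentially Cohen-Macaulay if $S/J$ is. *)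

theory Defs
  imports "HOL-Algebra.QuotRing" "HOL-Algebra.Module" "HOL-Library.Poly_Mapping" "HOL-Library.Extended_Nat"
begin

section \<open>Modules over a commutative ring\<close>

definition annihilator :: "('a, 'r) ring_scheme \<Rightarrow> ('a, 'b, 'm) module_scheme \<Rightarrow> 'a set" where
  "annihilator R M = {a \<in> carrier R. \<forall>u\<in>carrier M. a \<odot>\<^bsub>M\<^esub> u = \<zero>\<^bsub>M\<^esub>}"

definition span_submodule ::
    "('a, 'r) ring_scheme \<Rightarrow> ('a, 'b, 'm) module_scheme \<Rightarrow> 'b set \<Rightarrow> 'b set" where
  "span_submodule R M U = (\<lambda>N. submodule N R M) hull U"

text \<open>
  A module record extends a ring record; the fields \<open>mult\<close> and \<open>one\<close> play no role in the locale
  \<^locale>\<open>Module.module\<close>. They are filled in here as for \<^const>\<open>FactRing\<close>, of which this is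
  the analogue for modules.
\<close>

definition quot_module :: "('a, 'b, 'm) module_scheme \<Rightarrow> 'b set \<Rightarrow> ('a, 'b set) module" where
  "quot_module M N =
     \<lparr>carrier = a_rcosets\<^bsub>M\<^esub> N, mult = rcoset_mult M N, one = N +>\<^bsub>M\<^esub> \<one>\<^bsub>M\<^esub>, zero = N,
      add = set_add M, smult = (\<lambda>a U. \<Union>u\<in>U. N +>\<^bsub>M\<^esub> (a \<odot>\<^bsub>M\<^esub> u))\<rparr>"

definition ring_module :: "('a, 'r) ring_scheme \<Rightarrow> ('a, 'a) module" where
  "ring_module R =
     \<lparr>carrier = carrier R, mult = mult R, one = one R, zero = zero R, add = add R,
      smult = mult R\<rparr>"


section \<open>Dimension, depth and Cohen-Macaulay modules\<close>

text \<open>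
  The zero ring has no prime ideals and gets dimension \<open>0\<close>, being the supremum of the empty set in
  \<^typ>\<open>enat\<close>. In a filtration as below all quotients are nonzero, so this value is never used there.
\<close>

definition krull_dim :: "('a, 'r) ring_scheme \<Rightarrow> enat" where
  "krull_dim R =
     Sup {enat k | k P. (\<forall>i\<le>k. primeideal (P i) R) \<and> (\<forall>i<k. P i \<subset> P (Suc i))}"

definition module_dim :: "('a, 'r) ring_scheme \<Rightarrow> ('a, 'b, 'm) module_scheme \<Rightarrow> enat" where
  "module_dim R M = krull_dim (R Quot annihilator R M)"

definition nonzerodivisor_on :: "('a, 'b, 'm) module_scheme \<Rightarrow> 'a \<Rightarrow> bool" where
  "nonzerodivisor_on M a \<longleftrightarrow> (\<forall>u\<in>carrier M. a \<odot>\<^bsub>M\<^esub> u = \<zero>\<^bsub>M\<^esub> \<longrightarrow> u = \<zero>\<^bsub>M\<^esub>)"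

definition mult_submodule ::
    "('a, 'r) ring_scheme \<Rightarrow> 'a set \<Rightarrow> ('a, 'b, 'm) module_scheme \<Rightarrow> 'b set" where
  "mult_submodule R F M = span_submodule R M {a \<odot>\<^bsub>M\<^esub> u | a u. a \<in> F \<and> u \<in> carrier M}"

definition regular_sequence ::
    "('a, 'r) ring_scheme \<Rightarrow> ('a, 'b, 'm) module_scheme \<Rightarrow> 'a list \<Rightarrow> bool" where
  "regular_sequence R M fs \<longleftrightarrow>
     set fs \<subseteq> carrier R \<and>
     (\<forall>i<length fs.
        nonzerodivisor_on (quot_module M (mult_submodule R (set (take i fs)) M)) (fs ! i)) \<and>
     mult_submodule R (set fs) M \<noteq> carrier M"

definition depth ::
    "('a, 'r) ring_scheme \<Rightarrow> 'a set \<Rightarrow> ('a, 'b, 'm) module_scheme \<Rightarrow> enat" where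
  "depth R I M = Sup {enat (length fs) | fs. set fs \<subseteq> I \<and> regular_sequence R M fs}"

text \<open>
  A grading of a ring or module is given by its family of homogeneous components. If the component
  of degree \<open>0\<close> of \<open>R\<close> is a field, then the following is the unique maximal homogeneous ideal.
\<close>

definition irrelevant_ideal :: "('a, 'r) ring_scheme \<Rightarrow> (nat \<Rightarrow> 'a set) \<Rightarrow> 'a set" where
  "irrelevant_ideal R A = Idl\<^bsub>R\<^esub> (\<Union>d\<in>{1..}. A d)"

text \<open>
  For a finitely generated graded module over a standard graded algebra over a field, the depth is
  that with respect to the maximal homogeneous ideal.
\<close>

definition cohen_macaulay ::
    "('a, 'r) ring_scheme \<Rightarrow> (nat \<Rightarrow> 'a set) \<Rightarrow> ('a, 'b, 'm) module_scheme \<Rightarrow> bool" where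
  "cohen_macaulay R A M \<longleftrightarrow> depth R (irrelevant_ideal R A) M = module_dim R M"

text \<open>A submodule is graded iff it is generated by its homogeneous elements.\<close>

definition graded_submodule ::
    "'b set \<Rightarrow> ('a, 'r) ring_scheme \<Rightarrow> ('a, 'b, 'm) module_scheme \<Rightarrow> (nat \<Rightarrow> 'b set) \<Rightarrow> bool" where
  "graded_submodule N R M B \<longleftrightarrow>
     submodule N R M \<and> N = span_submodule R M (N \<inter> (\<Union>d. B d))"

definition seq_cohen_macaulay ::
    "('a, 'r) ring_scheme \<Rightarrow> (nat \<Rightarrow> 'a set) \<Rightarrow> ('a, 'b, 'm) module_scheme \<Rightarrow> (nat \<Rightarrow> 'b set) \<Rightarrow> bool"
  where
  "seq_cohen_macaulay R A M B \<longleftrightarrow>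
     (\<exists>r N. let Q = (\<lambda>i. quot_module (M\<lparr>carrier := N (Suc i)\<rparr>) (N i)) in
        N 0 = {\<zero>\<^bsub>M\<^esub>} \<and> N r = carrier M \<and>
        (\<forall>i\<le>r. graded_submodule (N i) R M B) \<and>
        (\<forall>i<r. N i \<subset> N (Suc i)) \<and>
        (\<forall>i<r. cohen_macaulay R A (Q i)) \<and>
        (\<forall>i. Suc i < r \<longrightarrow> module_dim R (Q i) < module_dim R (Q (Suc i))))"


section \<open>Polynomial rings\<close>

type_synonym ('v, 'k) mpoly = "('v \<Rightarrow>\<^sub>0 nat) \<Rightarrow>\<^sub>0 'k"

definition vars :: "('v, 'k::zero) mpoly \<Rightarrow> 'v set" where
  "vars p = (\<Union>t\<in>Poly_Mapping.keys p. Poly_Mapping.keys t)"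

definition mvar :: "'v \<Rightarrow> ('v, 'k::zero_neq_one) mpoly" where
  "mvar v = Poly_Mapping.single (Poly_Mapping.single v 1) 1"

definition poly_ring :: "'v set \<Rightarrow> ('v, 'k::field) mpoly ring" where
  "poly_ring V = \<lparr>carrier = {p. vars p \<subseteq> V}, mult = (*), one = 1, zero = 0, add = (+)\<rparr>"

definition monom_deg :: "('v \<Rightarrow>\<^sub>0 nat) \<Rightarrow> nat" where
  "monom_deg t = (\<Sum>v\<in>Poly_Mapping.keys t. Poly_Mapping.lookup t v)"

definition poly_grading :: "'v set \<Rightarrow> nat \<Rightarrow> ('v, 'k::field) mpoly set" where
  "poly_grading V d = {p \<in> carrier (poly_ring V). \<forall>t\<in>Poly_Mapping.keys p. monom_deg t = d}"

text \<open>
  The components of the quotient by \<open>J\<close> are the images of those of the polynomial ring; they form a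
  grading when \<open>J\<close> is homogeneous.
\<close>

definition seq_cohen_macaulay_ideal :: "'v set \<Rightarrow> ('v, 'k::field) mpoly set \<Rightarrow> bool" where
  "seq_cohen_macaulay_ideal V J \<longleftrightarrow>
     seq_cohen_macaulay (poly_ring V) (poly_grading V)
       (quot_module (ring_module (poly_ring V)) J)
       (\<lambda>d. (\<lambda>p. J +>\<^bsub>poly_ring V\<^esub> p) ` poly_grading V d)"


section \<open>Partitions and Ferrers ideals\<close>

definition is_partition :: "nat list \<Rightarrow> bool" where
  "is_partition lam \<longleftrightarrow> sorted_wrt (\<ge>) lam \<and> (\<forall>a\<in>set lam. 1 \<le> a)"

text \<open>Parts are indexed from \<open>1\<close>, and are \<open>0\<close> beyond the length.\<close>

definition part :: "nat list \<Rightarrow> nat \<Rightarrow> nat" where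
  "part lam i = (if 1 \<le> i \<and> i \<le> length lam then lam ! (i - 1) else 0)"

definition saturated :: "nat list \<Rightarrow> bool" where
  "saturated lam \<longleftrightarrow>
     sorted_wrt (>) lam \<or>
     (let i = (LEAST i. 1 \<le> i \<and> i < length lam \<and> part lam i = part lam (i + 1))
      in {1..part lam i} \<subseteq> set lam)"

datatype ferrers_var = XVar nat | YVar nat

definition ferrers_vars :: "nat list \<Rightarrow> ferrers_var set" where
  "ferrers_vars lam = XVar ` {1..length lam} \<union> YVar ` {1..part lam 1}"

definition ferrers_ideal :: "nat list \<Rightarrow> (ferrers_var, 'k::field) mpoly set" where
  "ferrers_ideal lam =
     Idl\<^bsub>poly_ring (ferrers_vars lam)\<^esub>
       {mvar (XVar i) * mvar (YVar j) | i j. i \<in> {1..length lam} \<and> j \<in> {1..part lam i}}"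

end

(*
  The minimal primes P_v of the Ferrers ideal are indexed by the levels v in {0} and the parts of
  lambda: P_v is generated by the x_i with lambda_i > v and the y_j with j <= v.

  If the ideal is sequentially Cohen-Macaulay, then the filtration must consist of the intersections
  of the P_v of height at most a bound, and Koszul cohomology in degree one of a quotient by such an
  intersection obstructs its depth whenever two primes P, Q are such that each has at least two
  variables outside the other and no further P_v of height at most that of the larger one lies in
  P + Q. A partition that is not saturated has such a pair.

  If lambda is saturated, then the primes can be ordered by height such that each of them contributes
  to the intersection a factor generated by a single variable, and for each height there is one
  sequence of linear forms that is regular modulo all P_v of that height. Hence the factors of the
  filtration are Cohen-Macaulay.
*)

theory Submission
  imports Defs
begin

section \<open>Ideals of a subring and regular sequences on subquotients\<close>

text \<open>All modules in the definition are subquotients A / B of the polynomial ring. They are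
  handled through representatives, so that every argument concerns elements of one ring and
  membership in B; nested cosets are met only in the lemmas on \<open>presents\<close>. A lower
  bound on the depth is exploited only through Koszul cohomology in degrees 0 and 1. A regular
  sequence in the maximal ideal gives vanishing for all variables together, and by a graded Nakayama
  argument each variable left out costs one degree. So depth k controls every set W of variables in
  degrees below k - |V - W|: for W = P, degree 0 excludes associated primes of too small dimension;
  for W = P \<union> Q, degree 1 sees how two components meet.

  Saturation is used in this form: for some s, all numbers up to s are levels and no part above s is
  repeated. Up to s the cover of v + 1 has exactly one y that the cover of v lacks; beyond s the
  cover of the preceding level has exactly one x that the cover of v lacks. These are the single
  variables that generate the factors. A gap below a repeated part instead leaves two covers
  differing by at least two variables on either side.\<close>

locale commutative_subring =
  fixes R :: "'a::comm_ring_1 set"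
  assumes one_mem: "1 \<in> R"
    and diff_mem: "a \<in> R \<Longrightarrow> b \<in> R \<Longrightarrow> a - b \<in> R"
    and mult_mem: "a \<in> R \<Longrightarrow> b \<in> R \<Longrightarrow> a * b \<in> R"
begin

lemma zero_mem: "0 \<in> R"
  using diff_mem[OF one_mem one_mem] by simp

lemma uminus_mem: "a \<in> R \<Longrightarrow> - a \<in> R"
  using diff_mem[OF zero_mem] by simp

lemma add_mem: "a \<in> R \<Longrightarrow> b \<in> R \<Longrightarrow> a + b \<in> R"
  using diff_mem[OF _ uminus_mem] by simp

definition is_ideal :: "'a set \<Rightarrow> bool" where
  "is_ideal A \<longleftrightarrow> A \<subseteq> R \<and> 0 \<in> A \<and> (\<forall>a\<in>A. \<forall>b\<in>A. a + b \<in> A) \<and> (\<forall>r\<in>R. \<forall>a\<in>A. r * a \<in> A)"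

lemma is_idealI:
  assumes "A \<subseteq> R" "0 \<in> A" "\<And>a b. a \<in> A \<Longrightarrow> b \<in> A \<Longrightarrow> a + b \<in> A"
    and "\<And>r a. r \<in> R \<Longrightarrow> a \<in> A \<Longrightarrow> r * a \<in> A"
  shows "is_ideal A"
  using assms by (simp add: is_ideal_def)

lemma ideal_mem: "is_ideal A \<Longrightarrow> a \<in> A \<Longrightarrow> a \<in> R"
  and ideal_0: "is_ideal A \<Longrightarrow> 0 \<in> A"
  and ideal_add: "is_ideal A \<Longrightarrow> a \<in> A \<Longrightarrow> b \<in> A \<Longrightarrow> a + b \<in> A"
  and ideal_mult: "is_ideal A \<Longrightarrow> r \<in> R \<Longrightarrow> a \<in> A \<Longrightarrow> r * a \<in> A"
  by (auto simp: is_ideal_def)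

lemma ideal_uminus: "is_ideal A \<Longrightarrow> a \<in> A \<Longrightarrow> - a \<in> A"
  using ideal_mult[of A "- 1" a] uminus_mem[OF one_mem] by simp

lemma ideal_diff: "is_ideal A \<Longrightarrow> a \<in> A \<Longrightarrow> b \<in> A \<Longrightarrow> a - b \<in> A"
  using ideal_add[of A a "- b"] ideal_uminus by simp

lemma ideal_carrier: "is_ideal R"
  by (simp add: is_ideal_def zero_mem add_mem mult_mem)

end

text \<open>The ideal B + f A: replacing B by it turns A / B into its quotient by the multiples of
  f.\<close>

definition ideal_sum :: "'a::comm_ring_1 set \<Rightarrow> 'a \<Rightarrow> 'a set \<Rightarrow> 'a set" where
  "ideal_sum B f A = {b + f * a | b a. b \<in> B \<and> a \<in> A}"

lemma ideal_sumI: "b \<in> B \<Longrightarrow> a \<in> A \<Longrightarrow> b + f * a \<in> ideal_sum B f A"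
  by (auto simp: ideal_sum_def)

lemma ideal_sumE:
  assumes "x \<in> ideal_sum B f A"
  obtains b a where "b \<in> B" "a \<in> A" "x = b + f * a"
  using assms by (auto simp: ideal_sum_def)

text \<open>\<open>weakly_regular fs A B\<close> refers to the module \<open>A / B\<close>.\<close>

primrec weakly_regular :: "'a::comm_ring_1 list \<Rightarrow> 'a set \<Rightarrow> 'a set \<Rightarrow> bool" where
  "weakly_regular [] A B \<longleftrightarrow> True"
| "weakly_regular (f # fs) A B \<longleftrightarrow>
     (\<forall>a\<in>A. f * a \<in> B \<longrightarrow> a \<in> B) \<and> weakly_regular fs A (ideal_sum B f A)"

context commutative_subring
begin

lemma ideal_ideal_sum:
  assumes A: "is_ideal A" and B: "is_ideal B" and f: "f \<in> R"
  shows "is_ideal (ideal_sum B f A)"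
proof (rule is_idealI)
  show "ideal_sum B f A \<subseteq> R"
    using ideal_mem[OF A] ideal_mem[OF B] f by (auto simp: ideal_sum_def add_mem mult_mem)
  show "0 \<in> ideal_sum B f A"
    using ideal_sumI[OF ideal_0[OF B] ideal_0[OF A], of f] by simp
next
  fix x y assume "x \<in> ideal_sum B f A" "y \<in> ideal_sum B f A"
  then obtain b a b' a' where *: "b \<in> B" "a \<in> A" "x = b + f * a" "b' \<in> B" "a' \<in> A" "y = b' + f * a'"
    by (auto elim!: ideal_sumE)
  then have "x + y = (b + b') + f * (a + a')" by (simp add: algebra_simps)
  then show "x + y \<in> ideal_sum B f A"
    using * ideal_sumI ideal_add A B by metis
next
  fix r x assume r: "r \<in> R" and "x \<in> ideal_sum B f A"
  then obtain b a where *: "b \<in> B" "a \<in> A" "x = b + f * a" by (auto elim!: ideal_sumE)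
  then have "r * x = r * b + f * (r * a)" by (simp add: algebra_simps)
  then show "r * x \<in> ideal_sum B f A"
    using * ideal_sumI ideal_mult A B r by metis
qed

lemma ideal_sum_superset:
  assumes "is_ideal A" "x \<in> B" shows "x \<in> ideal_sum B f A"
  using ideal_sumI[OF assms(2) ideal_0[OF assms(1)], of f] by simp

text \<open>The three hypotheses on products with \<open>w\<close> say that multiplication by
  \<open>w\<close> induces an isomorphism from A / B to A' / B'. They pass to B + f A and B' + f A',
  which drives the induction.\<close>

lemma weakly_regular_transport:
  assumes "is_ideal A" "is_ideal B" "is_ideal A'" "is_ideal B'" "w \<in> R" "set fs \<subseteq> R"
    and "\<And>a. a \<in> A \<Longrightarrow> w * a \<in> A'"
    and "\<And>a'. a' \<in> A' \<Longrightarrow> \<exists>a\<in>A. a' - w * a \<in> B'"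
    and "\<And>a. a \<in> A \<Longrightarrow> w * a \<in> B' \<longleftrightarrow> a \<in> B"
    and "weakly_regular fs A B"
  shows "weakly_regular fs A' B'"
  using assms
proof (induction fs arbitrary: B B')
  case Nil
  then show ?case by simp
next
  case (Cons f fs)
  note A = Cons.prems(1) and B = Cons.prems(2) and A' = Cons.prems(3) and B' = Cons.prems(4)
  note w = Cons.prems(5) and into = Cons.prems(7) and onto = Cons.prems(8) and ker = Cons.prems(9)
  have f: "f \<in> R" and fs: "set fs \<subseteq> R" using Cons.prems(6) by auto
  have nz: "a \<in> B" if "a \<in> A" "f * a \<in> B" for a using Cons.prems(10) that by auto
  have "a' \<in> B'" if a': "a' \<in> A'" "f * a' \<in> B'" for a'
  proof -
    obtain a where a: "a \<in> A" "a' - w * a \<in> B'" using onto a' by blast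
    have "f * a' - f * (a' - w * a) \<in> B'"
      using ideal_diff[OF B' a'(2) ideal_mult[OF B' f a(2)]] .
    then have "w * (f * a) \<in> B'" by (simp add: algebra_simps)
    then have "f * a \<in> B" using ker ideal_mult[OF A f a(1)] by blast
    then have "w * a \<in> B'" using nz a ker by blast
    then have "(a' - w * a) + w * a \<in> B'" using ideal_add[OF B' a(2)] by blast
    then show ?thesis by simp
  qed
  moreover have "weakly_regular fs A' (ideal_sum B' f A')"
  proof (rule Cons.IH[OF A ideal_ideal_sum[OF A B f] A' ideal_ideal_sum[OF A' B' f] w fs into])
    show "\<exists>a\<in>A. a' - w * a \<in> ideal_sum B' f A'" if "a' \<in> A'" for a'
      using onto[OF that] ideal_sum_superset[OF A'] by blast
    show "w * a \<in> ideal_sum B' f A' \<longleftrightarrow> a \<in> ideal_sum B f A" if a: "a \<in> A" for a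
    proof
      assume "w * a \<in> ideal_sum B' f A'"
      then obtain b' a' where b': "b' \<in> B'" "a' \<in> A'" "w * a = b' + f * a'" by (auto elim: ideal_sumE)
      obtain c where c: "c \<in> A" "a' - w * c \<in> B'" using onto b' by blast
      have "w * (a - f * c) = b' + f * (a' - w * c)" using b' by (simp add: algebra_simps)
      moreover have "\<dots> \<in> B'" using ideal_add[OF B' b'(1) ideal_mult[OF B' f c(2)]] .
      ultimately have "a - f * c \<in> B"
        using ker ideal_diff[OF A a ideal_mult[OF A f c(1)]] by metis
      then show "a \<in> ideal_sum B f A" using ideal_sumI[OF _ c(1), of "a - f * c" B f] by simp
    next
      assume "a \<in> ideal_sum B f A"
      then obtain b c where b: "b \<in> B" "c \<in> A" "a = b + f * c" by (auto elim: ideal_sumE)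
      have "b = a - f * c" using b by simp
      then have "b \<in> A" using ideal_diff[OF A a ideal_mult[OF A f b(2)]] by simp
      then have "w * b \<in> B'" using ker b by blast
      moreover have "w * a = w * b + f * (w * c)" using b by (simp add: algebra_simps)
      ultimately show "w * a \<in> ideal_sum B' f A'" using ideal_sumI into b by metis
    qed
  qed (use Cons.prems(10) in auto)
  ultimately show ?case by simp
qed

text \<open>Regularity passes to the middle of the exact sequence 0 -> K / B -> A / B -> A / K -> 0,
  and the sequence stays exact modulo each element.\<close>

lemma weakly_regular_extension:
  assumes "is_ideal A" "is_ideal K" "is_ideal B" "B \<subseteq> K" "K \<subseteq> A" "set fs \<subseteq> R"
    and "weakly_regular fs A K" "weakly_regular fs K B"
  shows "weakly_regular fs A B"
  using assms
proof (induction fs arbitrary: K B)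
  case Nil
  then show ?case by simp
next
  case (Cons f fs)
  note A = Cons.prems(1) and K = Cons.prems(2) and B = Cons.prems(3)
  have f: "f \<in> R" and fs: "set fs \<subseteq> R" using Cons.prems(6) by auto
  have nzA: "a \<in> K" if "a \<in> A" "f * a \<in> K" for a using Cons.prems(7) that by auto
  have nzK: "a \<in> B" if "a \<in> K" "f * a \<in> B" for a using Cons.prems(8) that by auto
  have "weakly_regular fs A (ideal_sum B f A)"
  proof (rule Cons.IH[OF A ideal_ideal_sum[OF A K f] ideal_ideal_sum[OF A B f]])
    show "ideal_sum B f A \<subseteq> ideal_sum K f A" using \<open>B \<subseteq> K\<close> by (auto simp: ideal_sum_def)
    show "ideal_sum K f A \<subseteq> A"
      using \<open>K \<subseteq> A\<close> ideal_add[OF A] ideal_mult[OF A f] by (auto simp: ideal_sum_def)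
    show "weakly_regular fs A (ideal_sum K f A)" using Cons.prems(7) by simp
    \<comment> \<open>Since \<open>f\<close> is a nonzerodivisor on A / K, a multiple f c in K has c
      in K. Hence the inclusion induces an isomorphism from K / (B + f K) to (K + f A) / (B + f
      A).\<close>
    show "weakly_regular fs (ideal_sum K f A) (ideal_sum B f A)"
    proof (rule weakly_regular_transport[where A = K and B = "ideal_sum B f K" and w = 1])
      show "\<exists>a\<in>K. a' - 1 * a \<in> ideal_sum B f A" if a': "a' \<in> ideal_sum K f A" for a'
      proof -
        obtain k a where *: "k \<in> K" "a \<in> A" "a' = k + f * a" using a' by (auto elim: ideal_sumE)
        then have "a' - 1 * k = 0 + f * a" by simp
        then show ?thesis using ideal_sumI[OF ideal_0[OF B]] * by metis
      qed
      show "1 * a \<in> ideal_sum B f A \<longleftrightarrow> a \<in> ideal_sum B f K" if a: "a \<in> K" for a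
      proof
        assume "1 * a \<in> ideal_sum B f A"
        then obtain b c where b: "b \<in> B" "c \<in> A" "a = b + f * c" by (auto elim: ideal_sumE)
        then have "f * c = a - b" by simp
        moreover have "a - b \<in> K" using ideal_diff[OF K a] b \<open>B \<subseteq> K\<close> by blast
        ultimately have "c \<in> K" using nzA b by metis
        then show "a \<in> ideal_sum B f K" using ideal_sumI b by metis
      qed (use \<open>K \<subseteq> A\<close> in \<open>auto simp: ideal_sum_def\<close>)
    qed (use A K B f fs Cons.prems(8) ideal_ideal_sum ideal_sum_superset one_mem in auto)
  qed (use fs in auto)
  then show ?case using nzA nzK \<open>B \<subseteq> K\<close> by auto
qed

end


section \<open>Koszul cohomology\<close>

text \<open>
  A cochain assigns to a bit list the coefficient of the corresponding wedge product of basis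
  vectors, bit \<open>k\<close> telling whether the \<open>k\<close>-th basis vector occurs.
\<close>

fun koszul_d :: "'a::comm_ring_1 list \<Rightarrow> (bool list \<Rightarrow> 'a) \<Rightarrow> bool list \<Rightarrow> 'a" where
  "koszul_d (x # xs) c (False # t) = koszul_d xs (\<lambda>u. c (False # u)) t"
| "koszul_d (x # xs) c (True # t) = x * c (False # t) - koszul_d xs (\<lambda>u. c (True # u)) t"
| "koszul_d _ _ _ = 0"

text \<open>The homotopy between \<open>0\<close> and multiplication by \<open>\<Sum> x\<^sub>k r\<^sub>k\<close>, given by the pairs \<open>(x\<^sub>k, r\<^sub>k)\<close>.\<close>

fun koszul_h :: "('a::comm_ring_1 \<times> 'a) list \<Rightarrow> (bool list \<Rightarrow> 'a) \<Rightarrow> bool list \<Rightarrow> 'a" where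
  "koszul_h (p # ps) c (False # t) = snd p * c (True # t) + koszul_h ps (\<lambda>u. c (False # u)) t"
| "koszul_h (p # ps) c (True # t) = - koszul_h ps (\<lambda>u. c (True # u)) t"
| "koszul_h _ _ _ = 0"

lemma koszul_d_add: "koszul_d xs (\<lambda>s. c s + c' s) s = koszul_d xs c s + koszul_d xs c' s"
  by (induction xs c s arbitrary: c' rule: koszul_d.induct) (simp_all add: ring_distribs)

lemma koszul_d_scale: "koszul_d xs (\<lambda>s. r * c s) s = r * koszul_d xs c s"
  by (induction xs c s rule: koszul_d.induct) (simp_all add: algebra_simps)

lemma koszul_d_uminus: "koszul_d xs (\<lambda>s. - c s) s = - koszul_d xs c s"
  using koszul_d_scale[of xs "- 1" c s] by simp

lemma koszul_d_diff: "koszul_d xs (\<lambda>s. c s - c' s) s = koszul_d xs c s - koszul_d xs c' s"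
  using koszul_d_add[of xs c "\<lambda>s. - c' s" s] by (simp add: koszul_d_uminus)

lemma koszul_d_zero: "koszul_d xs (\<lambda>s. 0) s = 0"
  using koszul_d_scale[of xs 0 "\<lambda>s. 0" s] by simp

lemma koszul_h_add: "koszul_h ps (\<lambda>s. c s + c' s) s = koszul_h ps c s + koszul_h ps c' s"
  by (induction ps c s arbitrary: c' rule: koszul_h.induct) (simp_all add: ring_distribs)

lemma koszul_h_scale: "koszul_h ps (\<lambda>s. r * c s) s = r * koszul_h ps c s"
  by (induction ps c s rule: koszul_h.induct) (simp_all add: algebra_simps)

lemma koszul_h_diff: "koszul_h ps (\<lambda>s. c s - c' s) s = koszul_h ps c s - koszul_h ps c' s"
  using koszul_h_add[of ps c "\<lambda>s. (- 1) * c' s" s] by (simp only: koszul_h_scale) simp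

lemma koszul_d_d: "koszul_d xs (koszul_d xs c) s = 0"
  by (induction xs c s rule: koszul_d.induct)
    (simp_all add: koszul_d_diff koszul_d_scale koszul_d_zero)

text \<open>Contraction with the functional r is a homotopy between 0 and its value on x. The mixed
  terms of head and tail cancel because both operators on the tail change sign when they pass the
  head basis vector.\<close>

lemma koszul_homotopy:
  assumes "length s = length ps"
  shows "koszul_d (map fst ps) (koszul_h ps c) s + koszul_h ps (koszul_d (map fst ps) c) s =
           (\<Sum>p\<leftarrow>ps. fst p * snd p) * c s"
  using assms
proof (induction ps arbitrary: c s)
  case Nil
  then show ?case by simp
next
  case (Cons p ps)
  then obtain e t where s: "s = e # t" "length t = length ps" by (cases s) auto
  note IH = Cons.IH[OF s(2)]
  let ?c = "\<lambda>u. c (e # u)"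
  show ?case
    using IH[of ?c]
    by (cases e)
      (simp_all add: s koszul_d_add koszul_d_scale koszul_d_uminus koszul_h_diff koszul_h_scale
        algebra_simps)
qed

text \<open>The degree is an integer, so that degree -1 exists and contains only zero; vanishing in
  degree 0 is then no special case.\<close>

definition cochain :: "'b list \<Rightarrow> int \<Rightarrow> 'a::comm_ring_1 set \<Rightarrow> (bool list \<Rightarrow> 'a) \<Rightarrow> bool" where
  "cochain xs i A c \<longleftrightarrow>
     (\<forall>s. c s \<in> A) \<and> (\<forall>s. \<not> (length s = length xs \<and> int (count_list s True) = i) \<longrightarrow> c s = 0)"

lemma cochain_mem: "cochain xs i A c \<Longrightarrow> c s \<in> A"
  by (simp add: cochain_def)

lemma cochain_eq_0:
  "cochain xs i A c \<Longrightarrow> \<not> (length s = length xs \<and> int (count_list s True) = i) \<Longrightarrow> c s = 0"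
  by (simp add: cochain_def)

lemma cochainI:
  assumes "\<And>s. c s \<in> A"
    and "\<And>s. \<not> (length s = length xs \<and> int (count_list s True) = i) \<Longrightarrow> c s = 0"
  shows "cochain xs i A c"
  using assms by (simp add: cochain_def)

lemma cochain_mono: "cochain xs i A c \<Longrightarrow> (\<And>s. c s \<in> A') \<Longrightarrow> cochain xs i A' c"
  by (simp add: cochain_def)

lemma cochain_map: "cochain (map f xs) i A c \<longleftrightarrow> cochain xs i A c"
  by (simp add: cochain_def)

text \<open>The cohomology in degree \<open>i\<close> of the Koszul complex of \<open>xs\<close> with coefficients in \<open>A / B\<close> vanishes.\<close>

definition koszul_vanish :: "'a::comm_ring_1 list \<Rightarrow> int \<Rightarrow> 'a set \<Rightarrow> 'a set \<Rightarrow> bool" where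
  "koszul_vanish xs i A B \<longleftrightarrow>
     (\<forall>c. cochain xs i A c \<longrightarrow> (\<forall>s. koszul_d xs c s \<in> B) \<longrightarrow>
        (\<exists>b. cochain xs (i - 1) A b \<and> (\<forall>s. c s - koszul_d xs b s \<in> B)))"

lemma koszul_d_support:
  assumes "\<And>s. \<not> (length s = length xs \<and> int (count_list s True) = i) \<Longrightarrow> c s = 0"
    and "\<not> (length s = length xs \<and> int (count_list s True) = i + 1)"
  shows "koszul_d xs c s = 0"
  using assms
proof (induction xs c s arbitrary: i rule: koszul_d.induct)
  case (1 x xs c t)
  show ?case
    using "1.IH"[of i] "1.prems"(1)[of "False # _"] "1.prems"(2) by auto
next
  case (2 x xs c t)
  have *: "c (True # u) = 0" if "\<not> (length u = length xs \<and> int (count_list u True) = i - 1)" for u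
    using "2.prems"(1)[of "True # u"] that by auto
  show ?case
    using "2.IH"[of "i - 1", OF *] "2.prems"(1)[of "False # t"] "2.prems"(2) by auto
qed auto

lemma koszul_h_support:
  assumes "\<And>s. \<not> (length s = length ps \<and> int (count_list s True) = i) \<Longrightarrow> c s = 0"
    and "\<not> (length s = length ps \<and> int (count_list s True) = i - 1)"
  shows "koszul_h ps c s = 0"
  using assms
proof (induction ps c s arbitrary: i rule: koszul_h.induct)
  case (1 p ps c t)
  show ?case
    using "1.IH"[of i] "1.prems"(1)[of "False # _"] "1.prems"(1)[of "True # t"] "1.prems"(2) by auto
next
  case (2 p ps c t)
  have *: "c (True # u) = 0" if "\<not> (length u = length ps \<and> int (count_list u True) = i - 1)" for u
    using "2.prems"(1)[of "True # u"] that by auto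
  show ?case using "2.IH"[of "i - 1", OF *] "2.prems"(2) by auto
qed auto

context commutative_subring
begin

lemma koszul_d_mem:
  assumes "is_ideal A" "set xs \<subseteq> R" "\<And>s. c s \<in> A"
  shows "koszul_d xs c s \<in> A"
  using assms(2,3)
  by (induction xs c s rule: koszul_d.induct)
    (simp_all add: ideal_diff[OF assms(1)] ideal_mult[OF assms(1)] ideal_0[OF assms(1)])

lemma koszul_h_mem:
  assumes "is_ideal A" "snd ` set ps \<subseteq> R" "\<And>s. c s \<in> A"
  shows "koszul_h ps c s \<in> A"
  using assms(2,3)
  by (induction ps c s rule: koszul_h.induct)
    (simp_all add: ideal_add[OF assms(1)] ideal_uminus[OF assms(1)] ideal_mult[OF assms(1)]
      ideal_0[OF assms(1)])

lemma cochain_koszul_d: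
  assumes "is_ideal A" "set xs \<subseteq> R" "cochain xs i A c"
  shows "cochain xs (i + 1) A (koszul_d xs c)"
  using koszul_d_mem[of A xs c, OF assms(1,2) cochain_mem[OF assms(3)]]
    koszul_d_support[of xs i c, OF cochain_eq_0[OF assms(3)]] by (rule cochainI)

lemma cochain_koszul_h:
  assumes "is_ideal A" "snd ` set ps \<subseteq> R" "cochain ps i A c"
  shows "cochain ps (i - 1) A (koszul_h ps c)"
  using koszul_h_mem[of A ps c, OF assms(1,2) cochain_mem[OF assms(3)]]
    koszul_h_support[of ps i c, OF cochain_eq_0[OF assms(3)]] by (rule cochainI)

lemma cochain_add:
  assumes "is_ideal A" "cochain xs i A c" "cochain xs i A c'"
  shows "cochain xs i A (\<lambda>s. c s + c' s)"
  using assms by (simp add: cochain_def ideal_add)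

lemma cochain_scale:
  assumes "is_ideal A" "r \<in> R" "cochain xs i A c"
  shows "cochain xs i A (\<lambda>s. r * c s)"
  using assms by (simp add: cochain_def ideal_mult)

lemma cochain_uminus:
  assumes "is_ideal A" "cochain xs i A c"
  shows "cochain xs i A (\<lambda>s. - c s)"
  using assms by (simp add: cochain_def ideal_uminus)

lemma cochain_diff:
  assumes "is_ideal A" "cochain xs i A c" "cochain xs i A c'"
  shows "cochain xs i A (\<lambda>s. c s - c' s)"
  using assms by (simp add: cochain_def ideal_diff)

lemma cochain_zero: "is_ideal A \<Longrightarrow> cochain xs i A (\<lambda>s. 0)"
  by (simp add: cochain_def ideal_0)

lemma koszul_vanish_neg:
  assumes "is_ideal A" "is_ideal B" "i < 0"
  shows "koszul_vanish xs i A B"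
  unfolding koszul_vanish_def
proof (intro allI impI)
  fix c :: "bool list \<Rightarrow> 'a"
  assume c: "cochain xs i A c"
  have "c s = 0" for s using cochain_eq_0[OF c] \<open>i < 0\<close> by auto
  then show "\<exists>b. cochain xs (i - 1) A b \<and> (\<forall>s. c s - koszul_d xs b s \<in> B)"
    using ideal_0[OF assms(2)] cochain_zero[OF assms(1)]
    by (intro exI[of _ "\<lambda>s. 0"]) (simp add: koszul_d_zero)
qed

text \<open>Multiplication by \<open>f\<close> is homotopic to zero, and vanishing for A / (B + f A)
  in degree i - 1 makes it injective on the cohomology of A / B in degree i. On cochains: a cocycle
  z has f z = d (h z) modulo B, so h z is a cocycle modulo f, hence h z = d b + f a, and cancelling
  f gives z = d a.\<close>

lemma koszul_vanish_nonzerodivisor: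
  assumes A: "is_ideal A" and B: "is_ideal B" "B \<subseteq> A"
    and ps: "fst ` set ps \<subseteq> R" "snd ` set ps \<subseteq> R"
    and f: "f = (\<Sum>p\<leftarrow>ps. fst p * snd p)" "f \<in> R"
    and nz: "\<And>a. a \<in> A \<Longrightarrow> f * a \<in> B \<Longrightarrow> a \<in> B"
    and v: "koszul_vanish (map fst ps) (i - 1) A (ideal_sum B f A)"
  shows "koszul_vanish (map fst ps) i A B"
  unfolding koszul_vanish_def
proof (intro allI impI)
  let ?xs = "map fst ps" and ?h = "koszul_h ps"
  let ?d = "koszul_d ?xs"
  have xs: "set ?xs \<subseteq> R" using ps by simp
  fix z :: "bool list \<Rightarrow> 'a"
  assume z: "cochain ?xs i A z" and dz: "\<forall>s. ?d z s \<in> B"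
  have zA: "z s \<in> A" for s using cochain_mem[OF z] .
  have hz: "cochain ?xs (i - 1) A (?h z)"
    using cochain_koszul_h[OF A ps(2), of i z] z by (simp add: cochain_map)
  have hdz: "?h (?d z) s \<in> B" for s using koszul_h_mem[OF B(1) ps(2)] dz by blast
  have fz: "f * z s - ?d (?h z) s \<in> B" for s
  proof (cases "length s = length ps")
    case True
    then have "f * z s - ?d (?h z) s = ?h (?d z) s"
      using koszul_homotopy[OF True, of z] f by (simp add: algebra_simps)
    then show ?thesis using hdz by simp
  next
    case False
    then have "z s = 0" "?d (?h z) s = 0"
      using cochain_eq_0[OF z] cochain_eq_0[OF cochain_koszul_d[OF A xs hz]] by simp_all
    then show ?thesis using ideal_0 B by simp
  qed
  have "?d (?h z) s \<in> ideal_sum B f A" for s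
  proof -
    have "?d (?h z) s = - (f * z s - ?d (?h z) s) + f * z s" by simp
    then show ?thesis using ideal_sumI[OF ideal_uminus[OF B(1) fz] zA] by metis
  qed
  then obtain b where b: "cochain ?xs (i - 1 - 1) A b" "\<And>s. ?h z s - ?d b s \<in> ideal_sum B f A"
    using v hz unfolding koszul_vanish_def by blast
  \<comment> \<open>The factor of f is required to be 0 outside the support of degree i - 1, so that
    the chosen values form a cochain.\<close>
  define P where "P = (\<lambda>s a. a \<in> A \<and> ?h z s - ?d b s - f * a \<in> B \<and>
    (\<not> (length s = length ps \<and> int (count_list s True) = i - 1) \<longrightarrow> a = 0))"
  have "\<exists>a. P s a" for s
  proof (cases "length s = length ps \<and> int (count_list s True) = i - 1")
    case True
    obtain b' a where "b' \<in> B" "a \<in> A" "?h z s - ?d b s = b' + f * a"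
      using b(2)[of s] by (auto elim: ideal_sumE)
    then have "P s a" using True by (simp add: P_def)
    then show ?thesis ..
  next
    case False
    then have "?h z s = 0" "?d b s = 0"
      using cochain_eq_0[OF hz] cochain_eq_0[OF cochain_koszul_d[OF A xs b(1)]] by auto
    then have "P s 0" using ideal_0 A B by (simp add: P_def)
    then show ?thesis ..
  qed
  then obtain a where a: "\<And>s. P s (a s)" by metis
  have ca: "cochain ?xs (i - 1) A a" using a by (simp add: P_def cochain_def)
  have "z s - ?d a s \<in> B" for s
  proof (rule nz)
    show "z s - ?d a s \<in> A" using ideal_diff[OF A zA koszul_d_mem[OF A xs]] a by (simp add: P_def)
    have "?d (\<lambda>s. ?h z s - ?d b s - f * a s) s \<in> B"
      using koszul_d_mem[OF B(1) xs] a by (simp add: P_def)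
    then have "?d (?h z) s - f * ?d a s \<in> B"
      by (simp add: koszul_d_diff koszul_d_scale koszul_d_d)
    then have "(f * z s - ?d (?h z) s) + (?d (?h z) s - f * ?d a s) \<in> B"
      using fz ideal_add[OF B(1)] by blast
    then show "f * (z s - ?d a s) \<in> B" by (simp add: algebra_simps)
  qed
  then show "\<exists>b. cochain ?xs (i - 1) A b \<and> (\<forall>s. z s - ?d b s \<in> B)" using ca by blast
qed

definition combination :: "'a list \<Rightarrow> 'a \<Rightarrow> bool" where
  "combination xs f \<longleftrightarrow>
     (\<exists>ps. map fst ps = xs \<and> snd ` set ps \<subseteq> R \<and> f = (\<Sum>p\<leftarrow>ps. fst p * snd p))"

lemma combination_mem:
  assumes "combination xs f" "set xs \<subseteq> R" shows "f \<in> R"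
proof -
  have "fst ` set ps \<subseteq> R \<Longrightarrow> snd ` set ps \<subseteq> R \<Longrightarrow> (\<Sum>p\<leftarrow>ps. fst p * snd p) \<in> R" for ps
    by (induction ps) (auto simp: zero_mem intro!: add_mem mult_mem)
  then show ?thesis using assms unfolding combination_def by (metis list.set_map)
qed

text \<open>Each element of the sequence trades one degree for a quotient, until the degree is
  negative and nothing is left to show.\<close>

lemma koszul_vanish_weakly_regular:
  assumes A: "is_ideal A" and xs: "set xs \<subseteq> R"
  shows "is_ideal B \<Longrightarrow> B \<subseteq> A \<Longrightarrow> \<forall>f\<in>set fs. combination xs f \<Longrightarrow> weakly_regular fs A B \<Longrightarrow>
    i < int (length fs) \<Longrightarrow> koszul_vanish xs i A B"
proof (induction fs arbitrary: i B)
  case Nil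
  then show ?case using koszul_vanish_neg[OF A] by simp
next
  case (Cons f fs)
  have f: "combination xs f" "f \<in> R" using Cons.prems combination_mem xs by auto
  then obtain ps where ps: "map fst ps = xs" "snd ` set ps \<subseteq> R" "f = (\<Sum>p\<leftarrow>ps. fst p * snd p)"
    by (auto simp: combination_def)
  have sub: "ideal_sum B f A \<subseteq> A"
    using Cons.prems(2) ideal_add[OF A] ideal_mult[OF A f(2)] by (auto simp: ideal_sum_def)
  have "koszul_vanish xs (i - 1) A (ideal_sum B f A)"
    using Cons.IH[OF ideal_ideal_sum[OF A Cons.prems(1) f(2)] sub, of "i - 1"] Cons.prems by auto
  then show ?case
    using koszul_vanish_nonzerodivisor[OF A Cons.prems(1,2) _ ps(2,3) f(2)] Cons.prems ps(1) xs
    by (metis list.set_map weakly_regular.simps(2))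
qed

text \<open>Exactness in the middle of the long cohomology sequence of 0 -> K / B -> A / B -> A / K
  -> 0.\<close>

lemma koszul_vanish_extension:
  assumes A: "is_ideal A" and K: "is_ideal K" and B: "is_ideal B" and sub: "B \<subseteq> K" "K \<subseteq> A"
    and xs: "set xs \<subseteq> R" and v: "koszul_vanish xs i A K" "koszul_vanish xs i K B"
  shows "koszul_vanish xs i A B"
  unfolding koszul_vanish_def
proof (intro allI impI)
  fix c :: "bool list \<Rightarrow> 'a"
  assume c: "cochain xs i A c" and dc: "\<forall>s. koszul_d xs c s \<in> B"
  obtain b where b: "cochain xs (i - 1) A b" "\<And>s. c s - koszul_d xs b s \<in> K"
    using v(1) c dc sub unfolding koszul_vanish_def by blast
  have "cochain xs i A (\<lambda>s. c s - koszul_d xs b s)"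
    using cochain_diff[OF A c] cochain_koszul_d[OF A xs b(1)] by simp
  then have "cochain xs i K (\<lambda>s. c s - koszul_d xs b s)"
    using b(2) by (rule cochain_mono)
  moreover have "\<forall>s. koszul_d xs (\<lambda>s. c s - koszul_d xs b s) s \<in> B"
    using dc by (simp add: koszul_d_diff koszul_d_d)
  ultimately obtain b' where b': "cochain xs (i - 1) K b'"
    "\<And>s. c s - koszul_d xs b s - koszul_d xs b' s \<in> B"
    using v(2) unfolding koszul_vanish_def by blast
  have "cochain xs (i - 1) A b'" using cochain_mono[OF b'(1)] cochain_mem[OF b'(1)] sub by blast
  then have "cochain xs (i - 1) A (\<lambda>s. b s + b' s)" by (rule cochain_add[OF A b(1)])
  moreover have "c s - koszul_d xs (\<lambda>s. b s + b' s) s \<in> B" for s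
    using b'(2)[of s] by (simp add: koszul_d_add diff_diff_eq)
  ultimately show "\<exists>b. cochain xs (i - 1) A b \<and> (\<forall>s. c s - koszul_d xs b s \<in> B)" by blast
qed

section \<open>Explicit cochains of degrees 0 and 1\<close>

definition cochain0 :: "'a list \<Rightarrow> 'a \<Rightarrow> bool list \<Rightarrow> 'a" where
  "cochain0 xs a s = (if s = replicate (length xs) False then a else 0)"

text \<open>The coefficient of a basis vector is a function of the ring element attached to it, not
  of its position in the list.\<close>

fun cochain1 :: "'a list \<Rightarrow> ('a \<Rightarrow> 'a) \<Rightarrow> bool list \<Rightarrow> 'a" where
  "cochain1 (x # xs) m (True # t) = cochain0 xs (m x) t"
| "cochain1 (x # xs) m (False # t) = cochain1 xs m t"
| "cochain1 _ _ _ = 0"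

lemma cochain0_simps [simp]:
  "cochain0 (x # xs) a (True # t) = 0"
  "cochain0 (x # xs) a (False # t) = cochain0 xs a t"
  by (simp_all add: cochain0_def)

lemma count_list_replicate_False: "count_list (replicate n False) True = 0"
  by (induction n) auto

lemma cochain_cochain0: "is_ideal A \<Longrightarrow> a \<in> A \<Longrightarrow> cochain xs 0 A (cochain0 xs a)"
  by (auto simp: cochain_def cochain0_def count_list_replicate_False ideal_0)

lemma cochain_cochain1:
  assumes "is_ideal A" "\<And>x. x \<in> set xs \<Longrightarrow> m x \<in> A"
  shows "cochain xs 1 A (cochain1 xs m)"
proof -
  have "cochain1 xs m s \<in> A \<and>
    (\<not> (length s = length xs \<and> int (count_list s True) = 1) \<longrightarrow> cochain1 xs m s = 0)" for s
    using assms
    by (induction xs m s rule: cochain1.induct)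
      (auto simp: cochain0_def ideal_0 count_list_replicate_False)
  then show ?thesis by (auto simp: cochain_def)
qed

lemma cochain_0_eq:
  assumes "cochain xs 0 A b"
  shows "b = cochain0 xs (b (replicate (length xs) False))"
proof
  fix s
  have "length s = n \<Longrightarrow> count_list s True = 0 \<Longrightarrow> s = replicate n False" for n
    by (induction s arbitrary: n) (auto split: if_splits)
  then show "b s = cochain0 xs (b (replicate (length xs) False)) s"
    using cochain_eq_0[OF assms, of s] unfolding cochain0_def
    by (cases "length s = length xs \<and> count_list s True = 0") auto
qed

text \<open>One computation with two uses: for y the head of a list and a = m y it is the cocycle
  condition in degree 1; for y = 0 it describes the differential of a cochain of degree 0.\<close>

lemma koszul_d_cochain0_mem:
  assumes "is_ideal B" "\<And>x. x \<in> set xs \<Longrightarrow> y * m x - x * a \<in> B"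
  shows "y * cochain1 xs m t - koszul_d xs (cochain0 xs a) t \<in> B"
  using assms
proof (induction xs m t rule: cochain1.induct)
  case (1 x xs m t)
  have "y * m x - x * a \<in> B" using 1 by simp
  then show ?case using ideal_0[OF "1.prems"(1)] by (auto simp: cochain0_def koszul_d_zero)
next
  case (2 x xs m t)
  then show ?case by simp
qed (auto simp: ideal_0)

text \<open>The cohomology in degree 0 is the submodule of A / B killed by all of
  \<open>xs\<close>.\<close>

lemma koszul_vanish_0D:
  assumes A: "is_ideal A" and B: "is_ideal B" and v: "koszul_vanish xs 0 A B"
    and a: "a \<in> A" "\<And>x. x \<in> set xs \<Longrightarrow> x * a \<in> B"
  shows "a \<in> B"
proof -
  have "koszul_d xs (cochain0 xs a) s \<in> B" for s
    using koszul_d_cochain0_mem[OF B, of xs 0 "\<lambda>x. 0" a s] ideal_uminus[OF B] a(2) by fastforce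
  then obtain b where b: "cochain xs (- 1) A b" "\<And>s. cochain0 xs a s - koszul_d xs b s \<in> B"
    using v[unfolded koszul_vanish_def, rule_format, OF cochain_cochain0[OF A a(1)]] by auto
  have "b s = 0" for s using cochain_eq_0[OF b(1)] by simp
  then have "b = (\<lambda>s. 0)" by auto
  then show ?thesis
    using b(2)[of "replicate (length xs) False"] by (simp add: cochain0_def koszul_d_zero)
qed

text \<open>The compatibility condition makes m a cocycle of degree 1, and the coboundaries in
  degree 1 are the families x \<mapsto> x a.\<close>

lemma koszul_vanish_1D:
  assumes A: "is_ideal A" and B: "is_ideal B" and v: "koszul_vanish xs 1 A B"
    and m: "\<And>x. x \<in> set xs \<Longrightarrow> m x \<in> A"
    and compat: "\<And>x y. x \<in> set xs \<Longrightarrow> y \<in> set xs \<Longrightarrow> y * m x - x * m y \<in> B"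
  obtains a where "a \<in> A" "\<And>x. x \<in> set xs \<Longrightarrow> m x - x * a \<in> B"
proof -
  have "koszul_d xs (cochain1 xs m) s \<in> B" for s
    using compat
  proof (induction xs m s rule: cochain1.induct)
    case (1 x xs m t)
    then show ?case by (auto intro: koszul_d_cochain0_mem[OF B])
  qed (auto simp: ideal_0[OF B])
  then obtain b where b: "cochain xs 0 A b" "\<And>s. cochain1 xs m s - koszul_d xs b s \<in> B"
    using v cochain_cochain1[OF A m] unfolding koszul_vanish_def by force
  define a where "a = b (replicate (length xs) False)"
  have "b = cochain0 xs a" using cochain_0_eq[OF b(1)] by (simp add: a_def)
  then have *: "\<forall>s. cochain1 xs m s - koszul_d xs (cochain0 xs a) s \<in> B" using b(2) by simp
  have "\<forall>x\<in>set xs. m x - x * a \<in> B"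
    using *
  proof (induction xs)
    case Nil
    then show ?case by simp
  next
    case (Cons x xs)
    have "m x - x * a \<in> B"
      using Cons.prems[rule_format, of "True # replicate (length xs) False"]
      by (simp add: cochain0_def koszul_d_zero)
    moreover have "\<forall>s. cochain1 xs m s - koszul_d xs (cochain0 xs a) s \<in> B"
      using Cons.prems[rule_format, of "False # _"] by simp
    ultimately show ?case using Cons.IH by simp
  qed
  moreover have "a \<in> A" using cochain_mem[OF b(1)] by (simp add: a_def)
  ultimately show thesis using that by blast
qed

end

text \<open>\<open>T N a\<close> is the part of \<open>a\<close> in degrees less than \<open>N\<close>, for a grading in which \<open>X\<close> has degree one.\<close>

locale truncated_subring = commutative_subring R for R :: "'a::comm_ring_1 set" +
  fixes T :: "nat \<Rightarrow> 'a \<Rightarrow> 'a" and X :: "'a set"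
  assumes T_add: "T N (a + b) = T N a + T N b"
    and T_0: "T 0 a = 0"
    and T_Suc: "x \<in> X \<Longrightarrow> T (Suc N) (x * a) = x * T N a"
    and T_eventually: "\<exists>N. \<forall>n\<ge>N. T n a = a"
    and X_subset: "X \<subseteq> R"
begin

lemma T_zero: "T N 0 = 0"
  using T_add[of N 0 0] by simp

lemma T_uminus: "T N (- a) = - T N a"
  using T_add[of N a "- a"] by (simp add: T_zero eq_neg_iff_add_eq_0 add.commute)

lemma T_diff: "T N (a - b) = T N a - T N b"
  using T_add[of N a "- b"] by (simp add: T_uminus)

lemma T_power: "x \<in> X \<Longrightarrow> T N (x ^ N * a) = 0"
proof (induction N arbitrary: a)
  case (Suc N)
  then show ?case using T_Suc[of x N "x ^ N * a"] by (simp add: mult.assoc)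
qed (simp add: T_0)

lemma koszul_d_T:
  "set xs \<subseteq> X \<Longrightarrow> koszul_d xs (\<lambda>s. T N (c s)) s = T (Suc N) (koszul_d xs c s)"
  by (induction xs c s rule: koszul_d.induct) (auto simp: T_diff T_Suc T_zero)

lemma T_cochain:
  assumes "\<And>a. a \<in> A \<Longrightarrow> T N a \<in> A" "cochain xs i A c"
  shows "cochain xs i A (\<lambda>s. T N (c s))"
  using assms by (simp add: cochain_def T_zero)

lemma cochain_T_eventually:
  assumes "cochain xs i A c"
  obtains N where "\<And>s. T (Suc N) (c s) = c s"
proof -
  obtain M where M: "\<And>a n. n \<ge> M a \<Longrightarrow> T n a = a" using T_eventually by metis
  let ?S = "{s :: bool list. set s \<subseteq> UNIV \<and> length s = length xs}"
  have fin: "finite (insert 0 ((\<lambda>s. M (c s)) ` ?S))"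
    by (intro finite.insertI finite_imageI finite_lists_length_eq) simp
  define N where "N = Max (insert 0 ((\<lambda>s. M (c s)) ` ?S))"
  have "T (Suc N) (c s) = c s" for s
  proof (cases "length s = length xs")
    case True
    then have "M (c s) \<le> N" unfolding N_def by (intro Max_ge fin) auto
    then show ?thesis using M by simp
  next
    case False
    then have "c s = 0" using cochain_eq_0[OF assms] by simp
    then show ?thesis by (simp add: T_zero)
  qed
  then show thesis using that by blast
qed

text \<open>
  If the cohomology of \<open>x # xs\<close> vanishes in degree \<open>i + 1\<close>, then \<open>x\<close> acts surjectively on the
  cohomology of \<open>xs\<close> in degree \<open>i\<close>, which is therefore zero by the graded Nakayama lemma.
\<close>

lemma koszul_vanish_Cons:
  assumes A: "is_ideal A" and B: "is_ideal B" "B \<subseteq> A"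
    and TA: "\<And>N a. a \<in> A \<Longrightarrow> T N a \<in> A" and TB: "\<And>N a. a \<in> B \<Longrightarrow> T N a \<in> B"
    and x: "x \<in> X" and xs: "set xs \<subseteq> X" and v: "koszul_vanish (x # xs) (i + 1) A B"
  shows "koszul_vanish xs i A B"
proof -
  let ?d = "koszul_d xs"
  have R: "x \<in> R" "set xs \<subseteq> R" using x xs X_subset by auto
  have step: "\<exists>b b'. cochain xs i A b \<and> (\<forall>s. ?d b s \<in> B) \<and> cochain xs (i - 1) A b' \<and>
      (\<forall>s. z s - (x * b s - ?d b' s) \<in> B)"
    if z: "cochain xs i A z" "\<And>s. ?d z s \<in> B" for z
  proof -
    \<comment> \<open>The product of the basis vector of x with z; it is a cocycle for x # xs modulo
      B because z is one for xs.\<close>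
    define c where "c s = (case s of True # t \<Rightarrow> z t | _ \<Rightarrow> 0)" for s
    have "cochain (x # xs) (i + 1) A c"
      using z ideal_0[OF A] by (auto simp: cochain_def c_def split: list.splits bool.splits)
    moreover have "koszul_d (x # xs) c s \<in> B" for s
    proof (cases s)
      case (Cons e t)
      then show ?thesis
        using z(2) ideal_uminus[OF B(1)] ideal_0[OF B(1)]
        by (cases e) (auto simp: c_def koszul_d_zero)
    qed (simp add: ideal_0[OF B(1)])
    ultimately obtain g where g: "cochain (x # xs) i A g" "\<And>s. c s - koszul_d (x # xs) g s \<in> B"
      using v unfolding koszul_vanish_def by fastforce
    let ?b = "\<lambda>u. g (False # u)" and ?b' = "\<lambda>u. g (True # u)"
    have "cochain xs i A ?b" "cochain xs (i - 1) A ?b'"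
      by (rule cochainI; use cochain_mem[OF g(1)] cochain_eq_0[OF g(1)] in force)+
    moreover have "?d ?b s \<in> B" for s
      using g(2)[of "False # s"] ideal_uminus[OF B(1)] by (fastforce simp: c_def)
    moreover have "z s - (x * ?b s - ?d ?b' s) \<in> B" for s
      using g(2)[of "True # s"] by (simp add: c_def)
    ultimately show ?thesis by blast
  qed
  \<comment> \<open>Up to coboundaries, every cocycle is a multiple of an arbitrarily high power of
    x.\<close>
  have iter: "\<exists>b b'. cochain xs i A b \<and> (\<forall>s. ?d b s \<in> B) \<and> cochain xs (i - 1) A b' \<and>
      (\<forall>s. z s - (x ^ N * b s - ?d b' s) \<in> B)"
    if z: "cochain xs i A z" "\<And>s. ?d z s \<in> B" for z N
  proof (induction N)
    case 0
    show ?case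
      using z ideal_0 A B
      by (intro exI[of _ z] exI[of _ "\<lambda>s. 0"]) (simp add: koszul_d_zero cochain_zero)
  next
    case (Suc N)
    then obtain b b' where b: "cochain xs i A b" "\<And>s. ?d b s \<in> B" "cochain xs (i - 1) A b'"
      "\<And>s. z s - (x ^ N * b s - ?d b' s) \<in> B" by blast
    obtain g g' where g: "cochain xs i A g" "\<And>s. ?d g s \<in> B" "cochain xs (i - 1) A g'"
      "\<And>s. b s - (x * g s - ?d g' s) \<in> B" using step[OF b(1,2)] by blast
    have xN: "x ^ N \<in> R" by (induction N) (auto simp: one_mem intro: mult_mem R(1))
    let ?g = "\<lambda>s. b' s + x ^ N * g' s"
    have "cochain xs (i - 1) A ?g" using cochain_add[OF A b(3) cochain_scale[OF A xN g(3)]] .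
    moreover have "z s - (x ^ Suc N * g s - ?d ?g s) \<in> B" for s
    proof -
      have "z s - (x ^ Suc N * g s - ?d ?g s) =
        (z s - (x ^ N * b s - ?d b' s)) + x ^ N * (b s - (x * g s - ?d g' s))"
        by (simp only: koszul_d_add koszul_d_scale power_Suc) (simp add: algebra_simps)
      then show ?thesis using ideal_add[OF B(1) b(4) ideal_mult[OF B(1) xN g(4)]] by metis
    qed
    ultimately show ?case using g by blast
  qed
  show ?thesis
    unfolding koszul_vanish_def
  proof (intro allI impI)
    fix z :: "bool list \<Rightarrow> 'a"
    assume z: "cochain xs i A z" and dz: "\<forall>s. ?d z s \<in> B"
    \<comment> \<open>Truncation beyond all degrees occurring in z keeps z and kills the multiple of
      x^(N+1), so only a coboundary remains. The differential raises degrees by one, so truncation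
      at N + 1 outside becomes truncation at N inside.\<close>
    obtain N where N: "\<And>s. T (Suc N) (z s) = z s" using cochain_T_eventually[OF z] by blast
    obtain b b' where b: "cochain xs (i - 1) A b'" "\<And>s. z s - (x ^ Suc N * b s - ?d b' s) \<in> B"
      using iter[OF z, of "Suc N"] dz by blast
    let ?g = "\<lambda>s. - T N (b' s)"
    have "cochain xs (i - 1) A ?g" using cochain_uminus[OF A T_cochain[OF TA b(1)]] .
    moreover have "z s - ?d ?g s \<in> B" for s
    proof -
      have "T (Suc N) (z s - (x ^ Suc N * b s - ?d b' s)) \<in> B" using TB b(2) by blast
      then show ?thesis
        using T_power[OF x, of "Suc N"]
        by (simp add: T_diff N koszul_d_uminus koszul_d_T[OF xs] del: power_Suc)
    qed
    ultimately show "\<exists>b. cochain xs (i - 1) A b \<and> (\<forall>s. z s - ?d b s \<in> B)" by blast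
  qed
qed

lemma koszul_vanish_append:
  assumes "is_ideal A" "is_ideal B" "B \<subseteq> A"
    and "\<And>N a. a \<in> A \<Longrightarrow> T N a \<in> A" "\<And>N a. a \<in> B \<Longrightarrow> T N a \<in> B"
    and "set ys \<subseteq> X" "set xs \<subseteq> X" "koszul_vanish (ys @ xs) (i + int (length ys)) A B"
  shows "koszul_vanish xs i A B"
  using assms(6,8)
proof (induction ys arbitrary: i)
  case (Cons y ys)
  have "koszul_vanish (ys @ xs) (i + int (length ys)) A B"
    using koszul_vanish_Cons[OF assms(1-5), of y "ys @ xs"] Cons.prems assms(7)
    by (simp add: algebra_simps)
  then show ?case using Cons by simp
qed simp

end


section \<open>Modules presented as subquotients of a ring\<close>

definition set_ring :: "'a::comm_ring_1 set \<Rightarrow> 'a ring" where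
  "set_ring R = \<lparr>carrier = R, mult = (*), one = 1, zero = 0, add = (+)\<rparr>"

lemma set_ring_simps [simp]:
  "carrier (set_ring R) = R" "mult (set_ring R) = (*)" "one (set_ring R) = 1"
  "zero (set_ring R) = 0" "add (set_ring R) = (+)"
  by (simp_all add: set_ring_def)

lemma a_r_coset_eq: "N +>\<^bsub>M\<^esub> x = (\<lambda>h. h \<oplus>\<^bsub>M\<^esub> x) ` N"
  by (auto simp: a_r_coset_def r_coset_def)

lemma a_rcosets_eq: "a_rcosets\<^bsub>M\<^esub> N = (\<lambda>x. N +>\<^bsub>M\<^esub> x) ` carrier M"
  by (auto simp: A_RCOSETS_def RCOSETS_def a_r_coset_def)

context commutative_subring
begin

lemma cring_set_ring: "cring (set_ring R)"
proof (rule cringI)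
  show "abelian_group (set_ring R)"
  proof (rule abelian_groupI)
    show "\<exists>y\<in>carrier (set_ring R). y \<oplus>\<^bsub>set_ring R\<^esub> x = \<zero>\<^bsub>set_ring R\<^esub>"
      if "x \<in> carrier (set_ring R)" for x
      using that uminus_mem by (intro bexI[of _ "- x"]) auto
  qed (auto simp: add_mem zero_mem algebra_simps)
  show "comm_monoid (set_ring R)"
    by unfold_locales (auto simp: mult_mem one_mem algebra_simps)
qed (auto simp: algebra_simps)

text \<open>The composite A -> A / B -> M for an isomorphism of A / B with M. Elements of iterated
  quotients are sets of sets; along this map their submodules become ideals between B and A.\<close>

definition presents :: "('a, 'b, 'm) module_scheme \<Rightarrow> 'a set \<Rightarrow> 'a set \<Rightarrow> ('a \<Rightarrow> 'b) \<Rightarrow> bool" where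
  "presents M A B \<sigma> \<longleftrightarrow>
     is_ideal A \<and> is_ideal B \<and> B \<subseteq> A \<and> \<sigma> ` A = carrier M \<and> \<sigma> 0 = \<zero>\<^bsub>M\<^esub> \<and>
     (\<forall>a\<in>A. \<forall>b\<in>A. \<sigma> a = \<sigma> b \<longleftrightarrow> a - b \<in> B) \<and>
     (\<forall>a\<in>A. \<forall>b\<in>A. \<sigma> a \<oplus>\<^bsub>M\<^esub> \<sigma> b = \<sigma> (a + b)) \<and>
     (\<forall>r\<in>R. \<forall>a\<in>A. r \<odot>\<^bsub>M\<^esub> \<sigma> a = \<sigma> (r * a))"

lemma presentsD:
  assumes "presents M A B \<sigma>"
  shows "is_ideal A" "is_ideal B" "B \<subseteq> A" "carrier M = \<sigma> ` A" "\<zero>\<^bsub>M\<^esub> = \<sigma> 0"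
    and "a \<in> A \<Longrightarrow> b \<in> A \<Longrightarrow> \<sigma> a = \<sigma> b \<longleftrightarrow> a - b \<in> B"
    and "a \<in> A \<Longrightarrow> b \<in> A \<Longrightarrow> \<sigma> a \<oplus>\<^bsub>M\<^esub> \<sigma> b = \<sigma> (a + b)"
    and "r \<in> R \<Longrightarrow> a \<in> A \<Longrightarrow> r \<odot>\<^bsub>M\<^esub> \<sigma> a = \<sigma> (r * a)"
  using assms by (auto simp: presents_def)

lemma presents_eq_zero:
  assumes "presents M A B \<sigma>" "a \<in> A"
  shows "\<sigma> a = \<zero>\<^bsub>M\<^esub> \<longleftrightarrow> a \<in> B"
  using presentsD(5)[OF assms(1)] presentsD(6)[OF assms, of 0] presentsD(1)[OF assms(1)] ideal_0
  by simp

lemma presents_image_mem: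
  assumes "presents M A B \<sigma>" "is_ideal C" "B \<subseteq> C" "C \<subseteq> A" "a \<in> A"
  shows "\<sigma> a \<in> \<sigma> ` C \<longleftrightarrow> a \<in> C"
proof
  assume "\<sigma> a \<in> \<sigma> ` C"
  then obtain c where "c \<in> C" "\<sigma> a = \<sigma> c" by blast
  then have "a - c \<in> C" using presentsD(6)[OF assms(1,5)] assms(3,4) by blast
  then have "(a - c) + c \<in> C" using ideal_add[OF assms(2)] \<open>c \<in> C\<close> by blast
  then show "a \<in> C" by simp
qed blast

lemma presents_module:
  assumes "presents M A B \<sigma>"
  shows "Module.module (set_ring R) M"
proof -
  note P = presentsD[OF assms]
  note A = P(1)
  have sub: "A \<subseteq> R" using ideal_mem[OF A] by blast
  show ?thesis
  proof (rule moduleI[OF cring_set_ring])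
    show "abelian_group M"
    proof (rule abelian_groupI)
      fix x y z assume x: "x \<in> carrier M" and y: "y \<in> carrier M" and z: "z \<in> carrier M"
      obtain a b c where *: "a \<in> A" "b \<in> A" "c \<in> A" "x = \<sigma> a" "y = \<sigma> b" "z = \<sigma> c"
        using x y z P(4) by blast
      show "x \<oplus>\<^bsub>M\<^esub> y \<in> carrier M" using * P ideal_add[OF A] by simp
      show "x \<oplus>\<^bsub>M\<^esub> y \<oplus>\<^bsub>M\<^esub> z = x \<oplus>\<^bsub>M\<^esub> (y \<oplus>\<^bsub>M\<^esub> z)"
        using * P(7) ideal_add[OF A] by (simp add: algebra_simps)
      show "x \<oplus>\<^bsub>M\<^esub> y = y \<oplus>\<^bsub>M\<^esub> x" using * P(7) by (simp add: algebra_simps)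
    next
      fix x assume x: "x \<in> carrier M"
      obtain a where *: "a \<in> A" "x = \<sigma> a" using x P(4) by blast
      show "\<zero>\<^bsub>M\<^esub> \<oplus>\<^bsub>M\<^esub> x = x" using * P(5,7) ideal_0[OF A] by simp
      have "\<sigma> (- a) \<oplus>\<^bsub>M\<^esub> x = \<zero>\<^bsub>M\<^esub>" using * P(5,7) ideal_uminus[OF A] by simp
      then show "\<exists>y\<in>carrier M. y \<oplus>\<^bsub>M\<^esub> x = \<zero>\<^bsub>M\<^esub>"
        using * P(4) ideal_uminus[OF A] by blast
    qed (use P ideal_0[OF A] in auto)
    fix a x assume a: "a \<in> carrier (set_ring R)" and x: "x \<in> carrier M"
    obtain c where c: "c \<in> A" "x = \<sigma> c" using x P(4) by blast
    have m: "r \<in> R \<Longrightarrow> u \<in> A \<Longrightarrow> r * u \<in> A" for r u using ideal_mult[OF A] by blast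
    show "a \<odot>\<^bsub>M\<^esub> x \<in> carrier M" using P(4,8) c a m by simp
    fix b assume b: "b \<in> carrier (set_ring R)"
    show "(a \<oplus>\<^bsub>set_ring R\<^esub> b) \<odot>\<^bsub>M\<^esub> x = a \<odot>\<^bsub>M\<^esub> x \<oplus>\<^bsub>M\<^esub> b \<odot>\<^bsub>M\<^esub> x"
      using P(7,8) c a b m add_mem by (simp add: algebra_simps)
    show "(a \<otimes>\<^bsub>set_ring R\<^esub> b) \<odot>\<^bsub>M\<^esub> x = a \<odot>\<^bsub>M\<^esub> (b \<odot>\<^bsub>M\<^esub> x)"
      using P(8) c a b m mult_mem by (simp add: algebra_simps)
  next
    show "\<one>\<^bsub>set_ring R\<^esub> \<odot>\<^bsub>M\<^esub> x = x" if "x \<in> carrier M" for x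
      using that P(4,8) one_mem by auto
  next
    fix a x y assume a: "a \<in> carrier (set_ring R)" and x: "x \<in> carrier M" "y \<in> carrier M"
    obtain c c' where c: "c \<in> A" "x = \<sigma> c" "c' \<in> A" "y = \<sigma> c'" using x P(4) by blast
    have m: "r \<in> R \<Longrightarrow> u \<in> A \<Longrightarrow> r * u \<in> A" for r u using ideal_mult[OF A] by blast
    show "a \<odot>\<^bsub>M\<^esub> (x \<oplus>\<^bsub>M\<^esub> y) = a \<odot>\<^bsub>M\<^esub> x \<oplus>\<^bsub>M\<^esub> a \<odot>\<^bsub>M\<^esub> y"
      using P(7,8) c a m ideal_add[OF A] by (simp add: algebra_simps)
  qed
qed

lemma presents_submodule_image:
  assumes "presents M A B \<sigma>" "is_ideal C" "C \<subseteq> A"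
  shows "submodule (\<sigma> ` C) (set_ring R) M"
proof -
  interpret M: Module.module "set_ring R" M using presents_module[OF assms(1)] .
  note P = presentsD[OF assms(1)]
  have neg: "\<ominus>\<^bsub>M\<^esub> \<sigma> c = \<sigma> (- c)" if "c \<in> C" for c
    using that assms(3) P ideal_uminus[OF P(1)] by (intro M.minus_equality) auto
  show ?thesis
  proof (rule M.submoduleI)
    show "\<sigma> ` C \<subseteq> carrier M" using P(4) assms(3) by blast
    show "\<zero>\<^bsub>M\<^esub> \<in> \<sigma> ` C" using P(5) ideal_0[OF assms(2)] by blast
    show "\<ominus>\<^bsub>M\<^esub> a \<in> \<sigma> ` C" if "a \<in> \<sigma> ` C" for a
      using that neg ideal_uminus[OF assms(2)] by auto
    show "a \<oplus>\<^bsub>M\<^esub> b \<in> \<sigma> ` C" if ab: "a \<in> \<sigma> ` C" "b \<in> \<sigma> ` C" for a b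
    proof -
      obtain c c' where "c \<in> C" "c' \<in> C" "a = \<sigma> c" "b = \<sigma> c'" using ab by blast
      then show ?thesis using P(7)[of c c'] assms(3) ideal_add[OF assms(2)] by auto
    qed
    show "a \<odot>\<^bsub>M\<^esub> x \<in> \<sigma> ` C" if "a \<in> carrier (set_ring R)" "x \<in> \<sigma> ` C" for a x
      using that P(8) assms(3) ideal_mult[OF assms(2)] by auto
  qed
qed

lemma presents_submodule_vimage:
  assumes "presents M A B \<sigma>" "submodule N (set_ring R) M"
  defines "C \<equiv> {a \<in> A. \<sigma> a \<in> N}"
  shows "is_ideal C" "B \<subseteq> C" "C \<subseteq> A" "N = \<sigma> ` C"
proof -
  interpret M: Module.module "set_ring R" M using presents_module[OF assms(1)] .
  note P = presentsD[OF assms(1)]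
  note N = M.submoduleE[OF assms(2)]
  have z: "\<zero>\<^bsub>M\<^esub> \<in> N" using subgroup.one_closed[OF submodule.axioms(1)[OF assms(2)]] by simp
  show "is_ideal C"
  proof (rule is_idealI)
    show "C \<subseteq> R" using ideal_mem[OF P(1)] by (auto simp: C_def)
    show "0 \<in> C" using ideal_0[OF P(1)] z P(5) by (simp add: C_def)
    show "a + b \<in> C" if "a \<in> C" "b \<in> C" for a b
      using that N(5)[of "\<sigma> a" "\<sigma> b"] P(7)[of a b] ideal_add[OF P(1)] by (simp add: C_def)
    show "r * a \<in> C" if "r \<in> R" "a \<in> C" for r a
      using that N(4)[of r "\<sigma> a"] P(8)[of r a] ideal_mult[OF P(1)] by (simp add: C_def)
  qed
  show "B \<subseteq> C" using presents_eq_zero[OF assms(1)] z P(3) unfolding C_def by (metis (mono_tags, lifting) mem_Collect_eq subset_iff)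
  show "C \<subseteq> A" by (auto simp: C_def)
  show "N = \<sigma> ` C" using N(1) P(4) by (auto simp: C_def)
qed

text \<open>Submodules of M correspond to ideals between B and A, so a span is the image of the
  least such ideal whose image contains the generators.\<close>

lemma presents_span:
  assumes "presents M A B \<sigma>" "is_ideal C" "B \<subseteq> C" "C \<subseteq> A" "U \<subseteq> \<sigma> ` C"
    and "\<And>C'. is_ideal C' \<Longrightarrow> B \<subseteq> C' \<Longrightarrow> C' \<subseteq> A \<Longrightarrow> U \<subseteq> \<sigma> ` C' \<Longrightarrow> C \<subseteq> C'"
  shows "span_submodule (set_ring R) M U = \<sigma> ` C"
  unfolding span_submodule_def
proof (rule hull_unique)
  show "U \<subseteq> \<sigma> ` C" by fact
  show "submodule (\<sigma> ` C) (set_ring R) M" using presents_submodule_image assms by blast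
  fix N assume N: "U \<subseteq> N" "submodule N (set_ring R) M"
  note V = presents_submodule_vimage[OF assms(1) N(2)]
  show "\<sigma> ` C \<subseteq> N" using assms(6)[OF V(1-3)] V(4) N(1) by blast
qed

lemma presents_carrier:
  assumes "presents M A B \<sigma>" "is_ideal C" "B \<subseteq> C" "C \<subseteq> A"
  shows "presents (M\<lparr>carrier := \<sigma> ` C\<rparr>) C B \<sigma>"
  using assms unfolding presents_def by (simp add: subset_iff)

lemma presents_coset:
  assumes "presents M A B \<sigma>" "is_ideal C" "C \<subseteq> A" "a \<in> A"
  shows "\<sigma> ` C +>\<^bsub>M\<^esub> \<sigma> a = \<sigma> ` {x \<in> A. x - a \<in> C}"
proof -
  note P = presentsD[OF assms(1)]
  have "\<sigma> ` C +>\<^bsub>M\<^esub> \<sigma> a = (\<lambda>c. \<sigma> (c + a)) ` C"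
    unfolding a_r_coset_eq image_image using P(7) assms by (intro image_cong) auto
  also have "\<dots> = \<sigma> ` ((\<lambda>c. c + a) ` C)" by (simp add: image_image)
  also have "(\<lambda>c. c + a) ` C = {x \<in> A. x - a \<in> C}"
  proof (intro equalityI subsetI)
    fix x assume "x \<in> {x \<in> A. x - a \<in> C}"
    then show "x \<in> (\<lambda>c. c + a) ` C" by (intro image_eqI[of _ _ "x - a"]) auto
  qed (use assms ideal_add[OF P(1)] in auto)
  finally show ?thesis .
qed

text \<open>The isomorphism (A / B) / (C / B) = A / C; it keeps every factor of a filtration in the
  form of a subquotient of the ring.\<close>

lemma presents_quot_module:
  assumes "presents M A B \<sigma>" "is_ideal C" "B \<subseteq> C" "C \<subseteq> A"
  shows "presents (quot_module M (\<sigma> ` C)) A C (\<lambda>a. \<sigma> ` C +>\<^bsub>M\<^esub> \<sigma> a)"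
proof -
  note P = presentsD[OF assms(1)]
  note A = P(1) and C = assms(2)
  let ?S = "\<lambda>a. {x \<in> A. x - a \<in> C}"
  let ?\<tau> = "\<lambda>a. \<sigma> ` C +>\<^bsub>M\<^esub> \<sigma> a"
  note coset = presents_coset[OF assms(1,2,4)]
  have Seq: "?S a = ?S b" if "a - b \<in> C" for a b
  proof -
    have "x - a \<in> C \<longleftrightarrow> x - b \<in> C" for x
      using ideal_add[OF C _ that, of "x - a"] ideal_diff[OF C _ that, of "x - b"] by auto
    then show ?thesis by simp
  qed
  have eq: "?\<tau> a = ?\<tau> b \<longleftrightarrow> a - b \<in> C" if ab: "a \<in> A" "b \<in> A" for a b
  proof
    assume "?\<tau> a = ?\<tau> b"
    then have "\<sigma> ` ?S a = \<sigma> ` ?S b" using coset ab by simp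
    moreover have "\<sigma> a \<in> \<sigma> ` ?S a" using ab ideal_0[OF C] by simp
    ultimately obtain s where s: "s \<in> A" "s - b \<in> C" "\<sigma> a = \<sigma> s" by auto
    then have "a - s \<in> C" using P(6)[OF ab(1) s(1)] assms(3) by blast
    then have "(a - s) + (s - b) \<in> C" using ideal_add[OF C] s(2) by blast
    then show "a - b \<in> C" by simp
  qed (use coset ab Seq in simp)
  have add: "?\<tau> a <+>\<^bsub>M\<^esub> ?\<tau> b = ?\<tau> (a + b)" if ab: "a \<in> A" "b \<in> A" for a b
  proof -
    have "?\<tau> a <+>\<^bsub>M\<^esub> ?\<tau> b = {u \<oplus>\<^bsub>M\<^esub> v | u v. u \<in> \<sigma> ` ?S a \<and> v \<in> \<sigma> ` ?S b}"
      using coset ab by (auto simp: set_add_def set_mult_def)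
    also have "\<dots> = \<sigma> ` ?S (a + b)"
    proof (intro equalityI subsetI)
      fix u assume "u \<in> {u \<oplus>\<^bsub>M\<^esub> v | u v. u \<in> \<sigma> ` ?S a \<and> v \<in> \<sigma> ` ?S b}"
      then obtain s t where st: "s \<in> A" "t \<in> A" "s - a \<in> C" "t - b \<in> C" "u = \<sigma> (s + t)"
        using P(7) by auto
      have "(s - a) + (t - b) \<in> C" using ideal_add[OF C] st by blast
      then have "s + t \<in> ?S (a + b)" using ideal_add[OF A] st by (simp add: algebra_simps)
      then show "u \<in> \<sigma> ` ?S (a + b)" using st(5) by blast
    next
      fix u assume "u \<in> \<sigma> ` ?S (a + b)"
      then obtain s where s: "s \<in> A" "s - (a + b) \<in> C" "u = \<sigma> s" by auto
      have "u = \<sigma> (s - b) \<oplus>\<^bsub>M\<^esub> \<sigma> b" using P(7) ideal_diff[OF A] s ab by simp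
      moreover have "s - b \<in> ?S a" using s ab ideal_diff[OF A] by (simp add: algebra_simps)
      moreover have "b \<in> ?S b" using ab ideal_0[OF C] by simp
      ultimately show "u \<in> {u \<oplus>\<^bsub>M\<^esub> v | u v. u \<in> \<sigma> ` ?S a \<and> v \<in> \<sigma> ` ?S b}" by blast
    qed
    finally show ?thesis using coset[OF ideal_add[OF A ab]] by simp
  qed
  have smult: "(\<Union>u\<in>?\<tau> a. \<sigma> ` C +>\<^bsub>M\<^esub> (r \<odot>\<^bsub>M\<^esub> u)) = ?\<tau> (r * a)" if r: "r \<in> R" and a: "a \<in> A" for r a
  proof -
    have *: "\<sigma> ` C +>\<^bsub>M\<^esub> (r \<odot>\<^bsub>M\<^esub> \<sigma> s) = ?\<tau> (r * a)" if s: "s \<in> ?S a" for s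
    proof -
      have "r * (s - a) \<in> C" using ideal_mult[OF C r] s by blast
      then have "r * s - r * a \<in> C" by (simp add: right_diff_distrib)
      then have "?\<tau> (r * s) = ?\<tau> (r * a)"
        using eq[of "r * s" "r * a"] ideal_mult[OF A r a] ideal_mult[OF A r, of s] s by blast
      then show ?thesis using P(8)[OF r, of s] s by simp
    qed
    have ne: "a \<in> ?S a" using a ideal_0[OF C] by simp
    have "(\<Union>u\<in>\<sigma> ` ?S a. \<sigma> ` C +>\<^bsub>M\<^esub> (r \<odot>\<^bsub>M\<^esub> u)) = (\<Union>s\<in>?S a. ?\<tau> (r * a))"
      unfolding image_image using * by (intro arg_cong[where f = Union] image_cong) simp_all
    also have "\<dots> = ?\<tau> (r * a)" using ne by blast
    finally show ?thesis using coset[OF a] by simp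
  qed
  have "\<sigma> ` C = ?\<tau> 0" using coset[OF ideal_0[OF A]] assms(4) by (simp add: Collect_conj_eq Int_absorb1)
  then show ?thesis
    unfolding presents_def quot_module_def
    using A C assms(4) eq add smult P(4) by (auto simp: a_rcosets_eq image_image)
qed

lemma presents_nonzerodivisor:
  assumes "presents M A B \<sigma>" "f \<in> R"
  shows "nonzerodivisor_on M f \<longleftrightarrow> (\<forall>a\<in>A. f * a \<in> B \<longrightarrow> a \<in> B)"
proof -
  note P = presentsD[OF assms(1)]
  have "nonzerodivisor_on M f \<longleftrightarrow> (\<forall>a\<in>A. \<sigma> (f * a) = \<zero>\<^bsub>M\<^esub> \<longrightarrow> \<sigma> a = \<zero>\<^bsub>M\<^esub>)"
    unfolding nonzerodivisor_on_def P(4) using P(8)[OF assms(2)] by auto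
  then show ?thesis using presents_eq_zero[OF assms(1)] ideal_mult[OF P(1) assms(2)] by auto
qed

lemma presents_annihilator:
  assumes "presents M A B \<sigma>"
  shows "annihilator (set_ring R) M = {r \<in> R. \<forall>a\<in>A. r * a \<in> B}"
proof -
  note P = presentsD[OF assms]
  have "annihilator (set_ring R) M = {r \<in> R. \<forall>a\<in>A. \<sigma> (r * a) = \<zero>\<^bsub>M\<^esub>}"
    unfolding annihilator_def P(4) using P(8) by auto
  then show ?thesis using presents_eq_zero[OF assms] ideal_mult[OF P(1)] by auto
qed

lemma presents_ring_module: "presents (ring_module (set_ring R)) R {0} id"
  unfolding presents_def ring_module_def
  using ideal_carrier zero_mem by (auto intro: is_idealI)

lemma presents_quotient_ring:
  assumes "is_ideal J"
  shows "presents (quot_module (ring_module (set_ring R)) J) R J (\<lambda>p. J +>\<^bsub>set_ring R\<^esub> p)"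
proof -
  have "J +>\<^bsub>ring_module (set_ring R)\<^esub> p = J +>\<^bsub>set_ring R\<^esub> p" for p
    by (simp add: a_r_coset_eq ring_module_def)
  then show ?thesis
    using presents_quot_module[OF presents_ring_module assms] ideal_0[OF assms] ideal_mem[OF assms]
    by (auto simp: subset_iff)
qed

abbreviation fold_sum :: "'a set \<Rightarrow> 'a set \<Rightarrow> 'a list \<Rightarrow> 'a set" where
  "fold_sum A B fs \<equiv> foldl (\<lambda>B f. ideal_sum B f A) B fs"

text \<open>The last clause, minimality, identifies B + f_1 A + ... + f_k A with the submodule
  generated by products in \<open>mult_submodule\<close>.\<close>

lemma fold_sum_ideal:
  assumes A: "is_ideal A"
  shows "is_ideal B \<Longrightarrow> B \<subseteq> A \<Longrightarrow> set fs \<subseteq> R \<Longrightarrow>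
    is_ideal (fold_sum A B fs) \<and> B \<subseteq> fold_sum A B fs \<and> fold_sum A B fs \<subseteq> A \<and>
    (\<forall>f\<in>set fs. \<forall>a\<in>A. f * a \<in> fold_sum A B fs) \<and>
    (\<forall>C. is_ideal C \<longrightarrow> B \<subseteq> C \<longrightarrow> (\<forall>f\<in>set fs. \<forall>a\<in>A. f * a \<in> C) \<longrightarrow> fold_sum A B fs \<subseteq> C)"
proof (induction fs arbitrary: B)
  case (Cons f fs)
  note B = Cons.prems(1,2)
  have f: "f \<in> R" using Cons.prems by simp
  let ?B = "ideal_sum B f A"
  have 1: "is_ideal ?B" "B \<subseteq> ?B" "?B \<subseteq> A"
    using ideal_ideal_sum[OF A B(1) f] ideal_sum_superset[OF A] B(2)
      ideal_add[OF A] ideal_mult[OF A f] by (auto simp: ideal_sum_def)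
  have 2: "f * a \<in> ?B" if "a \<in> A" for a using ideal_sumI[OF ideal_0[OF B(1)] that, of f] by simp
  have 3: "?B \<subseteq> C" if C: "is_ideal C" "B \<subseteq> C" "\<forall>a\<in>A. f * a \<in> C" for C
  proof
    fix x assume "x \<in> ?B"
    then obtain b a where "b \<in> B" "a \<in> A" "x = b + f * a" by (auto elim: ideal_sumE)
    then show "x \<in> C" using ideal_add[OF C(1)] C(2,3) by blast
  qed
  have fs: "set fs \<subseteq> R" using Cons.prems by simp
  note IH = Cons.IH[OF 1(1,3) fs]
  have 4: "f' * a \<in> fold_sum A ?B fs" if "f' \<in> set (f # fs)" "a \<in> A" for f' a
    using that IH 2[OF that(2)] by auto
  have 5: "fold_sum A ?B fs \<subseteq> C"
    if "is_ideal C" "B \<subseteq> C" "\<forall>f'\<in>set (f # fs). \<forall>a\<in>A. f' * a \<in> C" for C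
    using IH that 3[of C] by simp
  have 6: "is_ideal (fold_sum A ?B fs)" "B \<subseteq> fold_sum A ?B fs" "fold_sum A ?B fs \<subseteq> A"
    using IH 1(2) by blast+
  show ?case unfolding foldl.simps
    using 4 5 6 by (intro conjI ballI allI impI) assumption+
next
  case Nil
  then show ?case by simp
qed

lemma presents_mult_submodule:
  assumes "presents M A B \<sigma>" "set fs \<subseteq> R"
  shows "mult_submodule (set_ring R) (set fs) M = \<sigma> ` fold_sum A B fs"
  unfolding mult_submodule_def
proof (rule presents_span[OF assms(1)])
  note P = presentsD[OF assms(1)]
  note F = fold_sum_ideal[OF P(1,2,3) assms(2)]
  have U: "{a \<odot>\<^bsub>M\<^esub> u | a u. a \<in> set fs \<and> u \<in> carrier M} = {\<sigma> (f * a) | f a. f \<in> set fs \<and> a \<in> A}"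
  proof (intro equalityI subsetI)
    fix x assume "x \<in> {a \<odot>\<^bsub>M\<^esub> u | a u. a \<in> set fs \<and> u \<in> carrier M}"
    then obtain f a where "f \<in> set fs" "a \<in> A" "x = f \<odot>\<^bsub>M\<^esub> \<sigma> a" using P(4) by auto
    then show "x \<in> {\<sigma> (f * a) | f a. f \<in> set fs \<and> a \<in> A}" using P(8) assms(2) by blast
  next
    fix x assume "x \<in> {\<sigma> (f * a) | f a. f \<in> set fs \<and> a \<in> A}"
    then obtain f a where "f \<in> set fs" "a \<in> A" "x = \<sigma> (f * a)" by blast
    moreover from this have "x = f \<odot>\<^bsub>M\<^esub> \<sigma> a" using P(8) assms(2) by (metis subsetD)
    ultimately show "x \<in> {a \<odot>\<^bsub>M\<^esub> u | a u. a \<in> set fs \<and> u \<in> carrier M}" using P(4) by blast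
  qed
  show "is_ideal (fold_sum A B fs)" "B \<subseteq> fold_sum A B fs" "fold_sum A B fs \<subseteq> A" using F by auto
  show "{a \<odot>\<^bsub>M\<^esub> u | a u. a \<in> set fs \<and> u \<in> carrier M} \<subseteq> \<sigma> ` fold_sum A B fs"
    unfolding U using F by blast
  fix C' assume C': "is_ideal C'" "B \<subseteq> C'" "C' \<subseteq> A"
    "{a \<odot>\<^bsub>M\<^esub> u | a u. a \<in> set fs \<and> u \<in> carrier M} \<subseteq> \<sigma> ` C'"
  have "f * a \<in> C'" if "f \<in> set fs" "a \<in> A" for f a
  proof -
    have "\<sigma> (f * a) \<in> \<sigma> ` C'" using C'(4) that unfolding U by blast
    then show ?thesis
      using presents_image_mem[OF assms(1) C'(1-3)] ideal_mult[OF P(1)] that assms(2) by blast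
  qed
  then show "fold_sum A B fs \<subseteq> C'" using F C' by blast
qed

text \<open>The recursion accumulates in B exactly the prefix \<open>take i fs\<close> to which the
  definition of a regular sequence refers.\<close>

lemma weakly_regular_iff_nth:
  "weakly_regular fs A B \<longleftrightarrow>
     (\<forall>i<length fs. \<forall>a\<in>A. fs ! i * a \<in> fold_sum A B (take i fs) \<longrightarrow> a \<in> fold_sum A B (take i fs))"
proof (induction fs arbitrary: B)
  case (Cons f fs)
  have split: "(\<forall>i<length (f # fs). Q i) \<longleftrightarrow> Q 0 \<and> (\<forall>i<length fs. Q (Suc i))" for Q
    using All_less_Suc2[of "length fs" Q] by simp
  show ?case unfolding split weakly_regular.simps Cons.IH by simp
qed simp

lemma presents_regular_sequence:
  assumes "presents M A B \<sigma>"
  shows "regular_sequence (set_ring R) M fs \<longleftrightarrow>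
    set fs \<subseteq> R \<and> weakly_regular fs A B \<and> fold_sum A B fs \<noteq> A"
proof (cases "set fs \<subseteq> R")
  case True
  note P = presentsD[OF assms]
  have "nonzerodivisor_on (quot_module M (mult_submodule (set_ring R) (set (take i fs)) M)) (fs ! i) \<longleftrightarrow>
      (\<forall>a\<in>A. fs ! i * a \<in> fold_sum A B (take i fs) \<longrightarrow> a \<in> fold_sum A B (take i fs))"
    if i: "i < length fs" for i
  proof -
    have sub: "set (take i fs) \<subseteq> R" using order_trans[OF set_take_subset True] .
    have F: "is_ideal (fold_sum A B (take i fs))" "B \<subseteq> fold_sum A B (take i fs)"
      "fold_sum A B (take i fs) \<subseteq> A"
      using fold_sum_ideal[OF P(1,2,3) sub] by simp_all
    have "presents (quot_module M (\<sigma> ` fold_sum A B (take i fs))) A (fold_sum A B (take i fs))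
        (\<lambda>a. \<sigma> ` fold_sum A B (take i fs) +>\<^bsub>M\<^esub> \<sigma> a)"
      using F by (rule presents_quot_module[OF assms])
    moreover have "fs ! i \<in> R" using i True by auto
    ultimately show ?thesis
      using presents_nonzerodivisor presents_mult_submodule[OF assms sub] by simp
  qed
  moreover have "mult_submodule (set_ring R) (set fs) M \<noteq> carrier M \<longleftrightarrow> fold_sum A B fs \<noteq> A"
  proof -
    have F: "is_ideal (fold_sum A B fs)" "B \<subseteq> fold_sum A B fs" "fold_sum A B fs \<subseteq> A"
      using fold_sum_ideal[OF P(1,2,3) True] by simp_all
    have "\<sigma> ` fold_sum A B fs = \<sigma> ` A \<longleftrightarrow> fold_sum A B fs = A"
      using presents_image_mem[OF assms F] F(3) by blast
    then show ?thesis using presents_mult_submodule[OF assms True] P(4) by simp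
  qed
  ultimately show ?thesis
    using True unfolding regular_sequence_def weakly_regular_iff_nth by simp
qed (simp add: regular_sequence_def)


section \<open>Chains of primes\<close>

definition is_prime :: "'a set \<Rightarrow> bool" where
  "is_prime P \<longleftrightarrow> is_ideal P \<and> 1 \<notin> P \<and> (\<forall>a\<in>R. \<forall>b\<in>R. a * b \<in> P \<longrightarrow> a \<in> P \<or> b \<in> P)"

lemma is_ideal_iff: "is_ideal I \<longleftrightarrow> ideal I (set_ring R)"
proof
  interpret cring "set_ring R" by (rule cring_set_ring)
  show "ideal I (set_ring R)" if I: "is_ideal I"
  proof (rule idealI)
    fix a x assume "a \<in> I" "x \<in> carrier (set_ring R)"
    then have "x * a \<in> I" using ideal_mult[OF I] by simp
    then show "x \<otimes>\<^bsub>set_ring R\<^esub> a \<in> I" "a \<otimes>\<^bsub>set_ring R\<^esub> x \<in> I"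
      by (simp_all add: mult.commute)
  next
    show "ring (set_ring R)" by unfold_locales
    show "subgroup I (add_monoid (set_ring R))"
    proof
      fix x assume x: "x \<in> I"
      have "\<ominus>\<^bsub>set_ring R\<^esub> x = - x"
        using x ideal_mem[OF I] uminus_mem by (intro minus_equality) auto
      then show "inv\<^bsub>add_monoid (set_ring R)\<^esub> x \<in> I"
        using ideal_uminus[OF I x] by (simp add: a_inv_def)
    qed (use ideal_mem[OF I] ideal_0[OF I] ideal_add[OF I] in auto)
  qed
  show "is_ideal I" if "ideal I (set_ring R)"
  proof -
    interpret I: ideal I "set_ring R" by fact
    show ?thesis
      using I.a_subset I.zero_closed I.a_closed I.I_l_closed by (intro is_idealI) auto
  qed
qed

lemma is_prime_iff: "is_prime P \<longleftrightarrow> primeideal P (set_ring R)"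
proof -
  have "1 \<notin> P \<longleftrightarrow> R \<noteq> P" if P: "is_ideal P"
    using ideal_mult[OF P _, of _ 1] one_mem ideal_mem[OF P] by auto
  then show ?thesis
    unfolding is_prime_def primeideal_def primeideal_axioms_def is_ideal_iff[symmetric]
    using cring_set_ring by auto
qed

lemma krull_dim_quotient_ge:
  assumes I: "is_ideal I" and prime: "\<And>i. i \<le> k \<Longrightarrow> is_prime (P i)"
    and chain: "\<And>i. i < k \<Longrightarrow> P i \<subset> P (Suc i)" and sub: "I \<subseteq> P 0"
  shows "enat k \<le> krull_dim (set_ring R Quot I)"
proof -
  interpret cring "set_ring R" by (rule cring_set_ring)
  interpret I: ideal I "set_ring R" using I is_ideal_iff by simp
  let ?q = "\<lambda>a. I +>\<^bsub>set_ring R\<^esub> a"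
  have IP: "I \<subseteq> P i" if "i \<le> k" for i
    using that
  proof (induction i)
    case (Suc i)
    then show ?case using chain[of i] by auto
  qed (use sub in simp)
  have mem: "?q a \<in> ?q ` P i \<longleftrightarrow> a \<in> P i" if "i \<le> k" "a \<in> R" for a i
  proof
    have P: "is_ideal (P i)" using prime that by (simp add: is_prime_def)
    assume "?q a \<in> ?q ` P i"
    then obtain b where b: "b \<in> P i" "?q a = ?q b" by blast
    have "a \<in> ?q a" using ideal_0[OF I] by (force simp: a_r_coset_eq)
    then obtain c where "c \<in> I" "a = c + b" using b(2) by (auto simp: a_r_coset_eq)
    then show "a \<in> P i" using ideal_add[OF P] IP that(1) b(1) by blast
  qed blast
  have carr: "carrier (set_ring R Quot I) = ?q ` R"
    by (simp add: FactRing_def a_rcosets_eq)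
  have "primeideal (?q ` P i) (set_ring R Quot I)" if i: "i \<le> k" for i
  proof (rule primeidealI)
    have P: "is_prime (P i)" "is_ideal (P i)" using prime i by (simp_all add: is_prime_def)
    show "ideal (?q ` P i) (set_ring R Quot I)"
      using ring_ideal_imp_quot_ideal I.is_ideal P(2) is_ideal_iff by blast
    show "cring (set_ring R Quot I)" using I.quotient_is_cring[OF cring_set_ring] .
    have "?q 1 \<notin> ?q ` P i" using mem[OF i one_mem] P(1) by (simp add: is_prime_def)
    then show "carrier (set_ring R Quot I) \<noteq> ?q ` P i" using carr one_mem by blast
    fix a b assume ab: "a \<in> carrier (set_ring R Quot I)" "b \<in> carrier (set_ring R Quot I)"
      "a \<otimes>\<^bsub>set_ring R Quot I\<^esub> b \<in> ?q ` P i"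
    then obtain c d where c: "c \<in> R" "d \<in> R" "a = ?q c" "b = ?q d" using carr by auto
    then have "?q (c * d) \<in> ?q ` P i" using ab(3) I.rcoset_mult_add by (simp add: FactRing_def)
    then show "a \<in> ?q ` P i \<or> b \<in> ?q ` P i"
      using mem[OF i] c P(1) mult_mem by (auto simp: is_prime_def)
  qed
  moreover have "?q ` P i \<subset> ?q ` P (Suc i)" if i: "i < k" for i
  proof -
    obtain x where x: "x \<in> P (Suc i)" "x \<notin> P i" "P i \<subseteq> P (Suc i)" using chain[OF i] by blast
    have "x \<in> R" using x prime[of "Suc i"] i ideal_mem by (auto simp: is_prime_def)
    then have "?q x \<notin> ?q ` P i" using mem[of i x] i x by simp
    then show ?thesis using x by blast
  qed
  ultimately show ?thesis unfolding krull_dim_def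
    by (intro Sup_upper CollectI exI[of _ k] exI[of _ "\<lambda>i. ?q ` P i"]) simp
qed

text \<open>Chains of primes of the quotient are pulled back along the quotient map; the preimages
  contain I and stay strictly increasing because the map is onto.\<close>

lemma krull_dim_quotient_le:
  assumes I: "is_ideal I"
    and bound: "\<And>k P. (\<And>i. i \<le> k \<Longrightarrow> is_prime (P i)) \<Longrightarrow> (\<And>i. i < k \<Longrightarrow> P i \<subset> P (Suc i)) \<Longrightarrow>
      I \<subseteq> P 0 \<Longrightarrow> k \<le> d"
  shows "krull_dim (set_ring R Quot I) \<le> enat d"
  unfolding krull_dim_def
proof (rule Sup_least)
  interpret cring "set_ring R" by (rule cring_set_ring)
  interpret I: ideal I "set_ring R" using I is_ideal_iff by simp
  let ?Q = "set_ring R Quot I"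
  let ?q = "\<lambda>a. I +>\<^bsub>set_ring R\<^esub> a"
  interpret q: ring_hom_ring "set_ring R" ?Q ?q by (rule I.rcos_ring_hom_ring)
  fix x assume "x \<in> {enat k | k P. (\<forall>i\<le>k. primeideal (P i) ?Q) \<and> (\<forall>i<k. P i \<subset> P (Suc i))}"
  then obtain k P where x: "x = enat k" and P: "\<And>i. i \<le> k \<Longrightarrow> primeideal (P i) ?Q"
    "\<And>i. i < k \<Longrightarrow> P i \<subset> P (Suc i)" by blast
  let ?P = "\<lambda>i. {r \<in> R. ?q r \<in> P i}"
  have carr: "carrier ?Q = ?q ` R" by (simp add: FactRing_def a_rcosets_eq)
  have "k \<le> d"
  proof (rule bound)
    show "is_prime (?P i)" if "i \<le> k" for i
      using q.primeideal_vimage[OF cring_set_ring P(1)[OF that]] is_prime_iff by simp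
    show "?P i \<subset> ?P (Suc i)" if i: "i < k" for i
    proof -
      interpret S: primeideal "P (Suc i)" ?Q using P(1) i by simp
      obtain y where y: "y \<in> P (Suc i)" "y \<notin> P i" using P(2)[OF i] by blast
      then obtain r where "r \<in> R" "y = ?q r" using S.a_subset carr by blast
      then show ?thesis using y P(2)[OF i] by blast
    qed
    show "I \<subseteq> ?P 0"
    proof
      fix c assume c: "c \<in> I"
      interpret Z: primeideal "P 0" ?Q using P(1) by simp
      have "?q c = I" using I.a_rcos_const[OF c] by simp
      moreover have "I \<in> P 0" using Z.zero_closed by (simp add: FactRing_def)
      ultimately show "c \<in> ?P 0" using c ideal_mem[OF I] by simp
    qed
  qed
  then show "x \<le> enat d" using x by simp
qed

end


section \<open>Monomial ideals\<close>

abbreviation "keys \<equiv> Poly_Mapping.keys"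
abbreviation "lookup \<equiv> Poly_Mapping.lookup"
abbreviation "single \<equiv> Poly_Mapping.single"

text \<open>Selects the terms with exponent in S. It serves for truncation by degree as well as for
  splitting off the terms that meet a given set of variables.\<close>

definition restrict_keys :: "'a set \<Rightarrow> ('a \<Rightarrow>\<^sub>0 'b::zero) \<Rightarrow> 'a \<Rightarrow>\<^sub>0 'b" where
  "restrict_keys S p = Poly_Mapping.mapp (\<lambda>t c. if t \<in> S then c else 0) p"

lemma lookup_restrict_keys: "lookup (restrict_keys S p) t = (if t \<in> S then lookup p t else 0)"
  by (auto simp: restrict_keys_def lookup_mapp when_def in_keys_iff)

lemma keys_restrict_keys: "keys (restrict_keys S p) = keys p \<inter> S"
  by (auto simp: in_keys_iff lookup_restrict_keys split: if_splits)

lemma restrict_keys_add: "restrict_keys S (p + q) = restrict_keys S p + restrict_keys S q"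
  for p q :: "'a \<Rightarrow>\<^sub>0 'b::monoid_add"
  by (rule poly_mapping_eqI) (simp add: lookup_restrict_keys lookup_add)

lemma restrict_keys_id: "keys p \<subseteq> S \<Longrightarrow> restrict_keys S p = p"
  by (rule poly_mapping_eqI) (auto simp: lookup_restrict_keys in_keys_iff)

lemma restrict_keys_0: "keys p \<inter> S = {} \<Longrightarrow> restrict_keys S p = 0"
  by (rule poly_mapping_eqI) (auto simp: lookup_restrict_keys in_keys_iff)

lemma restrict_keys_split: "p = restrict_keys S p + restrict_keys (- S) p"
  for p :: "'a \<Rightarrow>\<^sub>0 'b::monoid_add"
  by (rule poly_mapping_eqI) (auto simp: lookup_restrict_keys lookup_add)

lemma keys_add_nat: "keys (s + t) = keys s \<union> keys t" for s t :: "'v \<Rightarrow>\<^sub>0 nat"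
  by (auto simp: in_keys_iff lookup_add)

lemma keys_mult_obtain:
  assumes "u \<in> keys (p * q)"
  obtains s t where "s \<in> keys p" "t \<in> keys q" "u = s + t"
  using keys_mult[of p q] assms by blast

lemma monom_deg_eq: "finite A \<Longrightarrow> keys t \<subseteq> A \<Longrightarrow> monom_deg t = (\<Sum>v\<in>A. lookup t v)"
  unfolding monom_deg_def by (intro sum.mono_neutral_left) (auto simp: in_keys_iff)

lemma monom_deg_add: "monom_deg (s + t) = monom_deg s + monom_deg t"
proof -
  have fin: "finite (keys s \<union> keys t)" by simp
  show ?thesis
    using monom_deg_eq[OF fin, of s] monom_deg_eq[OF fin, of t] monom_deg_eq[OF fin, of "s + t"]
    by (simp add: keys_add_nat lookup_add sum.distrib)
qed

lemma monom_deg_single: "monom_deg (single v 1) = 1"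
  by (simp add: monom_deg_def)

lemma keys_mvar: "keys (mvar v :: ('v, 'k::field) mpoly) = {single v 1}"
  by (simp add: mvar_def)

lemma poly_eq_sum_single: "p = (\<Sum>t\<in>keys p. single t (lookup p t))"
  for p :: "'a \<Rightarrow>\<^sub>0 'b::comm_monoid_add"
proof (rule poly_mapping_eqI)
  fix u
  have "(\<Sum>t\<in>keys p. lookup (single t (lookup p t)) u) = (\<Sum>t\<in>keys p. if t = u then lookup p u else 0)"
    by (intro sum.cong) (auto simp: lookup_single when_def)
  also have "\<dots> = lookup p u" by (simp add: in_keys_iff)
  finally show "lookup p u = lookup (\<Sum>t\<in>keys p. single t (lookup p t)) u"
    by (simp add: lookup_sum)
qed

lemma poly_induct_single:
  fixes p :: "'a \<Rightarrow>\<^sub>0 'b::comm_monoid_add"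
  assumes "Q 0" "\<And>q r. Q q \<Longrightarrow> Q r \<Longrightarrow> Q (q + r)" "\<And>t. t \<in> keys p \<Longrightarrow> Q (single t (lookup p t))"
  shows "Q p"
proof -
  have "Q (\<Sum>t\<in>A. single t (lookup p t))" if "A \<subseteq> keys p" for A
    using finite_subset[OF that finite_keys] that
    by (induction A rule: finite_induct) (use assms in auto)
  from this[OF order_refl] show ?thesis unfolding poly_eq_sum_single[symmetric] .
qed

lemma vars_mvar: "vars (mvar v :: ('v, 'k::field) mpoly) = {v}"
  by (simp add: vars_def keys_mvar)

lemma vars_mult: "vars (p * q) \<subseteq> vars p \<union> vars q" for p q :: "('v, 'k::field) mpoly"
  unfolding vars_def by (auto elim!: keys_mult_obtain simp: keys_add_nat)

lemma vars_diff: "vars (p - q) \<subseteq> vars p \<union> vars q" for p q :: "('v, 'k::field) mpoly"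
  unfolding vars_def using keys_add[of p "- q"] by (auto simp: in_keys_iff lookup_minus)

lemma poly_ring_eq: "poly_ring V = set_ring {p. vars p \<subseteq> V}"
  by (simp add: poly_ring_def set_ring_def)

text \<open>The linear order on the variables makes the polynomials an integral domain; this is used
  for the primality of ideals generated by variables.\<close>

locale polynomials =
  fixes V :: "'v::linorder set" and R :: "('v, 'k::field) mpoly set"
  assumes finite_V: "finite V" and R_eq: "R = {p. vars p \<subseteq> V}"
begin

lemma mem_R: "p \<in> R \<longleftrightarrow> (\<forall>t\<in>keys p. keys t \<subseteq> V)"
  by (auto simp: R_eq vars_def)

sublocale truncated_subring R "\<lambda>N. restrict_keys {t. monom_deg t < N}" "mvar ` V"
proof
  show "1 \<in> R" by (simp add: R_eq vars_def)
  show "a - b \<in> R" if "a \<in> R" "b \<in> R" for a b using that vars_diff[of a b] by (auto simp: R_eq)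
  show "a * b \<in> R" if "a \<in> R" "b \<in> R" for a b using that vars_mult[of a b] by (auto simp: R_eq)
  show "mvar ` V \<subseteq> R" by (auto simp: R_eq vars_mvar)
  show "restrict_keys {t. monom_deg t < 0} a = 0" for a :: "('v, 'k) mpoly"
    by (rule restrict_keys_0) simp
  show "restrict_keys {t. monom_deg t < N} (a + b) =
      restrict_keys {t. monom_deg t < N} a + restrict_keys {t. monom_deg t < N} b"
    for N and a b :: "('v, 'k) mpoly"
    by (rule restrict_keys_add)
  show "\<exists>N. \<forall>n\<ge>N. restrict_keys {t. monom_deg t < n} a = a" for a :: "('v, 'k) mpoly"
  proof (intro exI allI impI)
    fix n assume n: "Suc (Max (insert 0 (monom_deg ` keys a))) \<le> n"
    have "monom_deg t \<le> Max (insert 0 (monom_deg ` keys a))" if "t \<in> keys a" for t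
      using that by (intro Max_ge) auto
    then show "restrict_keys {t. monom_deg t < n} a = a"
      using n by (intro restrict_keys_id subsetI CollectI) (meson Suc_le_eq le_less_trans)
  qed
  show "restrict_keys {t. monom_deg t < Suc N} (x * a) = x * restrict_keys {t. monom_deg t < N} a"
    if x: "x \<in> mvar ` V" for x N and a :: "('v, 'k) mpoly"
  proof -
    let ?S = "{t. monom_deg t < N}"
    let ?S' = "{t. monom_deg t < Suc N}"
    have deg: "\<exists>t\<in>keys q. monom_deg u = Suc (monom_deg t)" if "u \<in> keys (x * q)" for u q
    proof -
      obtain v where v: "x = mvar v" using x by blast
      obtain s t where "s \<in> keys x" "t \<in> keys q" "u = s + t"
        using \<open>u \<in> keys (x * q)\<close> by (elim keys_mult_obtain)
      then show ?thesis
        using monom_deg_add[of s t] monom_deg_single[of v] unfolding v keys_mvar by auto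
    qed
    have 1: "restrict_keys ?S' (x * restrict_keys ?S a) = x * restrict_keys ?S a"
      by (rule restrict_keys_id) (use deg in \<open>fastforce simp: keys_restrict_keys\<close>)
    have 2: "restrict_keys ?S' (x * restrict_keys (- ?S) a) = 0"
      by (rule restrict_keys_0) (use deg in \<open>fastforce simp: keys_restrict_keys\<close>)
    have "x * a = x * restrict_keys ?S a + x * restrict_keys (- ?S) a"
      unfolding distrib_left[symmetric] restrict_keys_split[symmetric] ..
    then show ?thesis using 1 2 by (simp add: restrict_keys_add)
  qed
qed

lemma mvar_mem: "v \<in> V \<Longrightarrow> mvar v \<in> R"
  by (simp add: R_eq vars_mvar)

lemma restrict_keys_mem: "p \<in> R \<Longrightarrow> restrict_keys S p \<in> R"
  by (simp add: mem_R keys_restrict_keys)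

text \<open>The intersection of the primes generated by the sets of variables in \<open>F\<close>.\<close>

definition monomial_ideal :: "'v set set \<Rightarrow> ('v, 'k) mpoly set" where
  "monomial_ideal F = {p \<in> R. \<forall>t\<in>keys p. \<forall>C\<in>F. keys t \<inter> C \<noteq> {}}"

abbreviation variable_ideal :: "'v set \<Rightarrow> ('v, 'k) mpoly set" where
  "variable_ideal W \<equiv> monomial_ideal {W}"

lemma monomial_ideal_mem_iff: "p \<in> R \<Longrightarrow> p \<in> monomial_ideal F \<longleftrightarrow> (\<forall>C\<in>F. p \<in> variable_ideal C)"
  by (auto simp: monomial_ideal_def)

lemma monomial_ideal_subset: "monomial_ideal F \<subseteq> R"
  by (auto simp: monomial_ideal_def)

lemma monomial_ideal_antimono: "F \<subseteq> G \<Longrightarrow> monomial_ideal G \<subseteq> monomial_ideal F"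
  by (auto simp: monomial_ideal_def)

lemma variable_ideal_mono: "W \<subseteq> W' \<Longrightarrow> variable_ideal W \<subseteq> variable_ideal W'"
  by (auto simp: monomial_ideal_def)

lemma monomial_ideal_empty: "monomial_ideal {} = R"
  by (auto simp: monomial_ideal_def)

lemma is_ideal_monomial_ideal: "is_ideal (monomial_ideal F)"
proof (rule is_idealI)
  show "0 \<in> monomial_ideal F" using zero_mem by (simp add: monomial_ideal_def)
  show "a + b \<in> monomial_ideal F" if "a \<in> monomial_ideal F" "b \<in> monomial_ideal F" for a b
    using that add_mem[of a b] keys_add[of a b] by (auto simp: monomial_ideal_def)
  show "r * a \<in> monomial_ideal F" if "r \<in> R" "a \<in> monomial_ideal F" for r a
    using that mult_mem[of r a]
    by (auto simp: monomial_ideal_def elim!: keys_mult_obtain) (auto simp: keys_add_nat)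
qed (rule monomial_ideal_subset)

lemma restrict_keys_monomial_ideal: "p \<in> monomial_ideal F \<Longrightarrow> restrict_keys S p \<in> monomial_ideal F"
  by (auto simp: monomial_ideal_def keys_restrict_keys restrict_keys_mem)

lemma mvar_mem_monomial_ideal: "v \<in> V \<Longrightarrow> mvar v \<in> monomial_ideal F \<longleftrightarrow> (\<forall>C\<in>F. v \<in> C)"
  by (auto simp: monomial_ideal_def keys_mvar mvar_mem)

text \<open>Modulo the ideal, p and q may be replaced by their terms without variables of W. All
  terms of the product of these parts avoid W, so if the product lies in the ideal it is 0, and one
  part is 0.\<close>

lemma is_prime_variable_ideal: "is_prime (variable_ideal W)"
  unfolding is_prime_def
proof (intro conjI ballI impI)
  show "is_ideal (variable_ideal W)" by (rule is_ideal_monomial_ideal)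
  show "1 \<notin> variable_ideal W" by (simp add: monomial_ideal_def)
  fix p q assume p: "p \<in> R" and q: "q \<in> R" and pq: "p * q \<in> variable_ideal W"
  let ?S = "{t. keys t \<inter> W = {}}"
  let ?p = "restrict_keys ?S p" and ?p' = "restrict_keys (- ?S) p"
  let ?q = "restrict_keys ?S q" and ?q' = "restrict_keys (- ?S) q"
  note I = is_ideal_monomial_ideal[of "{W}"]
  have R: "?p \<in> R" "?p' \<in> R" "?q \<in> R" "?q' \<in> R" using p q restrict_keys_mem by auto
  have rest: "?p' \<in> variable_ideal W" "?q' \<in> variable_ideal W"
    using R by (auto simp: monomial_ideal_def keys_restrict_keys)
  have split: "?p + ?p' = p" "?q + ?q' = q" by (simp_all only: restrict_keys_split[symmetric])
  have "p * q = (?p + ?p') * (?q + ?q')" unfolding split ..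
  then have "?p * ?q = p * q - (?p * ?q' + (?q + ?q') * ?p')" by (simp add: algebra_simps)
  moreover have "\<dots> \<in> variable_ideal W"
    using ideal_diff[OF I pq ideal_add[OF I ideal_mult[OF I R(1) rest(2)]
        ideal_mult[OF I add_mem[OF R(3,4)] rest(1)]]] .
  ultimately have *: "?p * ?q \<in> variable_ideal W" by simp
  have "keys (?p * ?q) = {}"
  proof (rule ccontr)
    assume "keys (?p * ?q) \<noteq> {}"
    then obtain u where u: "u \<in> keys (?p * ?q)" by blast
    then obtain s t where "s \<in> keys ?p" "t \<in> keys ?q" "u = s + t" by (elim keys_mult_obtain)
    then have "keys u \<inter> W = {}" by (auto simp: keys_add_nat keys_restrict_keys)
    moreover have "keys u \<inter> W \<noteq> {}" using * u unfolding monomial_ideal_def by blast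
    ultimately show False by contradiction
  qed
  then have "?p * ?q = 0" by (simp only: keys_eq_empty)
  then have "?p = 0 \<or> ?q = 0" by (simp only: mult_eq_0_iff)
  then have "p = ?p' \<or> q = ?q'" using split by auto
  then show "p \<in> variable_ideal W \<or> q \<in> variable_ideal W" using rest by metis
qed

lemma prime_mult_iff:
  assumes "is_prime P" "a \<in> R" "b \<in> R"
  shows "a * b \<in> P \<longleftrightarrow> a \<in> P \<or> b \<in> P"
proof -
  have P: "is_ideal P" using assms(1) by (simp add: is_prime_def)
  show ?thesis
    using assms ideal_mult[OF P, of a b] ideal_mult[OF P, of b a]
    by (auto simp: is_prime_def mult.commute)
qed

lemma prod_mem: "(\<And>i. i \<in> A \<Longrightarrow> f i \<in> R) \<Longrightarrow> (\<Prod>i\<in>A. f i) \<in> R"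
  by (induction A rule: infinite_finite_induct) (auto simp: one_mem intro: mult_mem)

lemma prime_prod_iff:
  assumes "is_prime P" "finite A" "\<And>i. i \<in> A \<Longrightarrow> f i \<in> R"
  shows "(\<Prod>i\<in>A. f i) \<in> P \<longleftrightarrow> (\<exists>i\<in>A. f i \<in> P)"
  using assms(2,3)
proof (induction A rule: finite_induct)
  case empty
  then show ?case using assms(1) by (simp add: is_prime_def)
next
  case (insert i A)
  then show ?case using prime_mult_iff[OF assms(1)] prod_mem[of A f] by simp
qed

text \<open>For Z = V - C this monomial lies in the prime of C' exactly when C' is not contained in
  C. Thus it separates C from the rest of an antichain.\<close>

definition squarefree_monomial :: "'v set \<Rightarrow> ('v, 'k) mpoly" where
  "squarefree_monomial Z = (\<Prod>v\<in>Z. mvar v)"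

lemma squarefree_monomial_mem: "Z \<subseteq> V \<Longrightarrow> squarefree_monomial Z \<in> R"
  unfolding squarefree_monomial_def using mvar_mem by (intro prod_mem) auto

lemma squarefree_monomial_mem_variable_ideal:
  assumes "Z \<subseteq> V"
  shows "squarefree_monomial Z \<in> variable_ideal W \<longleftrightarrow> Z \<inter> W \<noteq> {}"
proof -
  have "mvar v \<in> variable_ideal W \<longleftrightarrow> v \<in> W" if "v \<in> Z" for v
    using mvar_mem_monomial_ideal[of v "{W}"] that assms by auto
  then show ?thesis
    unfolding squarefree_monomial_def
    using prime_prod_iff[OF is_prime_variable_ideal, of Z mvar W] finite_subset[OF assms finite_V]
      mvar_mem assms by auto
qed

text \<open>Otherwise each prime of the family has an element outside P, and the product of these
  elements lies in the intersection but not in P.\<close>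

lemma prime_contains_monomial_ideal:
  assumes P: "is_prime P" and F: "finite F" "\<And>C. C \<in> F \<Longrightarrow> C \<subseteq> V" and sub: "monomial_ideal F \<subseteq> P"
  obtains C where "C \<in> F" "variable_ideal C \<subseteq> P"
proof (rule ccontr)
  assume "\<not> thesis"
  then have "\<forall>C\<in>F. \<exists>p. p \<in> variable_ideal C \<and> p \<notin> P" using that by blast
  then obtain g where g: "\<And>C. C \<in> F \<Longrightarrow> g C \<in> variable_ideal C \<and> g C \<notin> P" by metis
  have gR: "g C \<in> R" if "C \<in> F" for C using g[OF that] monomial_ideal_subset by blast
  let ?p = "\<Prod>C\<in>F. g C"
  have pR: "?p \<in> R" using gR by (rule prod_mem)
  have "?p \<in> variable_ideal C" if "C \<in> F" for C
  proof -
    have "\<exists>i\<in>F. g i \<in> variable_ideal C" using g that by (intro bexI[of _ C]) simp_all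
    then show ?thesis by (simp only: prime_prod_iff[where f = g, OF is_prime_variable_ideal F(1) gR])
  qed
  then have "\<forall>C\<in>F. ?p \<in> variable_ideal C" by (rule ballI)
  then have "?p \<in> monomial_ideal F" by (rule iffD2[OF monomial_ideal_mem_iff[OF pR]])
  then have "?p \<in> P" using sub by (rule subsetD[rotated])
  then have "\<exists>i\<in>F. g i \<in> P" by (simp only: prime_prod_iff[where f = g, OF P F(1) gR])
  then obtain C where "C \<in> F" "g C \<in> P" ..
  then show False using g by simp
qed

lemma divide_by_variable:
  assumes "p \<in> R" "\<And>t. t \<in> keys p \<Longrightarrow> x \<in> keys t"
  obtains r where "r \<in> R" "p = mvar x * r"
proof -
  define r where "r = (\<Sum>t\<in>keys p. single (t - single x 1) (lookup p t))"
  have "mvar x * r = (\<Sum>t\<in>keys p. single (single x 1 + (t - single x 1)) (lookup p t))"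
    by (simp add: r_def mvar_def sum_distrib_left mult_single)
  also have "\<dots> = (\<Sum>t\<in>keys p. single t (lookup p t))"
  proof (rule sum.cong[OF refl])
    fix t assume "t \<in> keys p"
    then have "lookup t x \<noteq> 0" using assms(2) by (simp add: in_keys_iff)
    then have "single x 1 + (t - single x 1) = t"
      by (intro poly_mapping_eqI) (auto simp: lookup_add lookup_minus lookup_single when_def)
    then show "single (single x 1 + (t - single x 1)) (lookup p t) = single t (lookup p t)" by simp
  qed
  also have "\<dots> = p" by (simp only: poly_eq_sum_single[symmetric])
  finally have "p = mvar x * r" by simp
  moreover have "r \<in> R"
    unfolding mem_R
  proof
    fix u assume "u \<in> keys r"
    then obtain t where t: "t \<in> keys p" "u = t - single x 1"
      using keys_sum[of "\<lambda>t. single (t - single x 1) (lookup p t)" "keys p"]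
      by (auto simp: r_def split: if_splits)
    then have "keys u \<subseteq> keys t" by (auto simp: in_keys_iff lookup_minus)
    then show "keys u \<subseteq> V" using t assms(1) by (auto simp: mem_R)
  qed
  ultimately show thesis using that by blast
qed

text \<open>The terms divisible by the first variable are split off; the others lie in the ideal of
  the remaining variables.\<close>

lemma variable_ideal_combination:
  assumes "p \<in> variable_ideal (set vs)"
  shows "combination (map mvar vs) p"
  using assms
proof (induction vs arbitrary: p)
  case Nil
  then have "keys p = {}" by (auto simp: monomial_ideal_def)
  then show ?case by (simp add: combination_def)
next
  case (Cons v vs)
  let ?S = "{t. v \<in> keys t}"
  have pR: "p \<in> R" using Cons.prems monomial_ideal_subset by blast
  obtain r where r: "r \<in> R" "restrict_keys ?S p = mvar v * r"
    using divide_by_variable[OF restrict_keys_mem[OF pR], of ?S v] by (auto simp: keys_restrict_keys)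
  have "restrict_keys (- ?S) p \<in> variable_ideal (set vs)"
    using Cons.prems restrict_keys_mem[OF pR] by (auto simp: monomial_ideal_def keys_restrict_keys)
  then obtain ps where ps: "map fst ps = map mvar vs" "snd ` set ps \<subseteq> R"
    "restrict_keys (- ?S) p = (\<Sum>p\<leftarrow>ps. fst p * snd p)"
    using Cons.IH unfolding combination_def by blast
  have "p = mvar v * r + (\<Sum>p\<leftarrow>ps. fst p * snd p)"
    unfolding r(2)[symmetric] ps(3)[symmetric] by (rule restrict_keys_split)
  then show ?case
    unfolding combination_def using ps r by (intro exI[of _ "(mvar v, r) # ps"]) simp
qed

section \<open>The irrelevant ideal, and chains of variable primes\<close>

abbreviation irrelevant :: "('v, 'k) mpoly set" where
  "irrelevant \<equiv> irrelevant_ideal (poly_ring V) (poly_grading V)"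

lemma irrelevant_ideal_subset: "irrelevant \<subseteq> variable_ideal V"
proof -
  interpret cring "set_ring R" by (rule cring_set_ring)
  have "(\<Union>d\<in>{1..}. poly_grading V d) \<subseteq> variable_ideal V"
  proof
    fix p :: "('v, 'k) mpoly" assume "p \<in> (\<Union>d\<in>{1..}. poly_grading V d)"
    then obtain d where d: "d \<ge> 1" "p \<in> R" "\<forall>t\<in>keys p. monom_deg t = d"
      by (auto simp: poly_grading_def poly_ring_eq R_eq)
    have "keys t \<inter> V \<noteq> {}" if "t \<in> keys p" for t
    proof -
      have "monom_deg t \<noteq> 0" using d that by auto
      then have "keys t \<noteq> {}" by (auto simp: monom_deg_def)
      moreover have "keys t \<subseteq> V" using d(2) that by (simp add: mem_R)
      ultimately show ?thesis by blast
    qed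
    then show "p \<in> variable_ideal V" using d(2) by (simp add: monomial_ideal_def)
  qed
  then show ?thesis
    unfolding irrelevant_ideal_def poly_ring_eq R_eq[symmetric]
    using genideal_minimal is_ideal_iff is_ideal_monomial_ideal by blast
qed

lemma linear_form_irrelevant:
  assumes "p \<in> R" "\<And>t. t \<in> keys p \<Longrightarrow> monom_deg t = 1"
  shows "p \<in> irrelevant"
proof -
  interpret cring "set_ring R" by (rule cring_set_ring)
  have "(\<Union>d\<in>{1..}. poly_grading V d) \<subseteq> R" by (auto simp: poly_grading_def poly_ring_eq R_eq)
  moreover have "p \<in> poly_grading V 1"
    using assms by (auto simp: poly_grading_def poly_ring_eq R_eq)
  ultimately show ?thesis
    unfolding irrelevant_ideal_def poly_ring_eq R_eq[symmetric]
    using genideal_self[of "\<Union>d\<in>{1..}. poly_grading V d"] by auto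
qed

text \<open>The chain adjoins the variables outside W one at a time.\<close>

lemma variable_ideal_chain:
  assumes "W \<subseteq> V" "is_ideal I" "I \<subseteq> variable_ideal W"
  shows "enat (card (V - W)) \<le> krull_dim (set_ring R Quot I)"
proof -
  obtain vs where vs: "set vs = V - W" "distinct vs"
    using finite_distinct_list[of "V - W"] finite_V by auto
  have len: "length vs = card (V - W)" using distinct_card[OF vs(2)] vs(1) by simp
  let ?P = "\<lambda>i. variable_ideal (W \<union> set (take i vs))"
  have "enat (length vs) \<le> krull_dim (set_ring R Quot I)"
  proof (rule krull_dim_quotient_ge[OF assms(2), of _ ?P])
    show "is_prime (?P i)" for i by (rule is_prime_variable_ideal)
    show "?P i \<subset> ?P (Suc i)" if i: "i < length vs" for i
    proof -
      have "?P i \<subseteq> ?P (Suc i)"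
        using i by (intro variable_ideal_mono) (auto simp: take_Suc_conv_app_nth)
      moreover have "vs ! i \<in> V - W" using vs(1) i nth_mem by blast
      moreover have "vs ! i \<notin> set (take i vs)"
        using vs(2) i by (auto simp: in_set_conv_nth nth_eq_iff_index_eq)
      ultimately have "mvar (vs ! i) \<in> ?P (Suc i)" "mvar (vs ! i) \<notin> ?P i"
        using i by (auto simp: mvar_mem_monomial_ideal take_Suc_conv_app_nth)
      then show ?thesis using \<open>?P i \<subseteq> ?P (Suc i)\<close> by blast
    qed
  qed (use assms in auto)
  then show ?thesis using len by simp
qed

end


section \<open>The Krull dimension of a quotient by a monomial ideal\<close>

text \<open>A homogeneous system with unknowns indexed by D and equations indexed by T; each
  induction step uses one equation to eliminate one unknown.\<close>

lemma linear_dependence: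
  fixes e :: "'u \<Rightarrow> 't \<Rightarrow> 'k::field"
  assumes "finite T" "finite D" "card T < card D"
  shows "\<exists>c. (\<exists>u\<in>D. c u \<noteq> 0) \<and> (\<forall>t\<in>T. (\<Sum>u\<in>D. c u * e u t) = 0)"
  using assms
proof (induction T arbitrary: D e rule: finite_induct)
  case empty
  then obtain u where "u \<in> D" by fastforce
  then show ?case by (intro exI[of _ "\<lambda>_. 1"]) auto
next
  case (insert t T)
  show ?case
  proof (cases "\<forall>u\<in>D. e u t = 0")
    case True
    obtain c where "\<exists>u\<in>D. c u \<noteq> 0" "\<forall>t\<in>T. (\<Sum>u\<in>D. c u * e u t) = 0"
      using insert.IH[of D e] insert.prems insert.hyps by auto
    moreover have "(\<Sum>u\<in>D. c u * e u t) = 0" using True by simp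
    ultimately show ?thesis by blast
  next
    case False
    then obtain v where v: "v \<in> D" "e v t \<noteq> 0" by blast
    let ?D = "D - {v}"
    \<comment> \<open>Elimination of the unknown \<open>v\<close> with pivot \<open>e v t\<close>;
      the column of t becomes 0.\<close>
    define e' where "e' = (\<lambda>u s. e u s - e u t / e v t * e v s)"
    have "card T < card ?D" using insert v by simp
    then obtain c where c: "\<exists>u\<in>?D. c u \<noteq> 0" "\<forall>s\<in>T. (\<Sum>u\<in>?D. c u * e' u s) = 0"
      using insert.IH[of ?D e'] insert.prems by auto
    define c' where "c' = c(v := - (\<Sum>u\<in>?D. c u * (e u t / e v t)))"
    have eq: "(\<Sum>u\<in>D. c' u * e u s) = (\<Sum>u\<in>?D. c u * e' u s)" for s
    proof -
      have "(\<Sum>u\<in>D. c' u * e u s) = c' v * e v s + (\<Sum>u\<in>?D. c' u * e u s)"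
        using insert.prems v by (simp add: sum.remove)
      also have "(\<Sum>u\<in>?D. c' u * e u s) = (\<Sum>u\<in>?D. c u * e u s)"
        by (intro sum.cong) (auto simp: c'_def)
      also have "c' v * e v s = - (\<Sum>u\<in>?D. c u * (e u t / e v t * e v s))"
        by (simp add: c'_def sum_distrib_right mult.assoc)
      finally show ?thesis by (simp add: e'_def right_diff_distrib sum_subtractf)
    qed
    have "e' u t = 0" for u using v by (simp add: e'_def)
    then have "\<forall>s\<in>insert t T. (\<Sum>u\<in>D. c' u * e u s) = 0" using eq c(2) by simp
    moreover have "\<exists>u\<in>D. c' u \<noteq> 0" using c(1) by (auto simp: c'_def)
    ultimately show ?thesis by blast
  qed
qed

section \<open>Power products and bounds on their exponents\<close>

fun power_product :: "'a::comm_ring_1 list \<Rightarrow> nat list \<Rightarrow> 'a" where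
  "power_product (f # fs) (a # u) = f ^ a * power_product fs u"
| "power_product _ _ = 1"

definition exponents :: "nat \<Rightarrow> nat \<Rightarrow> nat list set" where
  "exponents N k = {u. set u \<subseteq> {..<N} \<and> length u = k}"

lemma finite_exponents: "finite (exponents N k)"
  by (simp add: exponents_def finite_lists_length_eq)

lemma card_exponents: "card (exponents N k) = N ^ k"
  by (simp add: exponents_def card_lists_length_eq)

lemma sum_exponents_Suc:
  "(\<Sum>u\<in>exponents N (Suc k). g u) = (\<Sum>a<N. \<Sum>u\<in>exponents N k. g (a # u))"
proof -
  let ?h = "\<lambda>x. fst x # snd x"
  have "exponents N (Suc k) = ?h ` ({..<N} \<times> exponents N k)"
    by (auto simp: exponents_def image_iff length_Suc_conv)
  moreover have "inj_on ?h ({..<N} \<times> exponents N k)" by (auto simp: inj_on_def)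
  ultimately have "(\<Sum>u\<in>exponents N (Suc k). g u) = (\<Sum>x\<in>{..<N} \<times> exponents N k. g (?h x))"
    by (simp add: sum.reindex)
  then show ?thesis by (simp add: sum.cartesian_product case_prod_beta)
qed

definition exponent_bound :: "nat \<Rightarrow> ('v, 'k::zero) mpoly \<Rightarrow> bool" where
  "exponent_bound M p \<longleftrightarrow> (\<forall>t\<in>keys p. \<forall>v. lookup t v \<le> M)"

lemma exponent_bound_exists: "\<exists>M. exponent_bound M p"
proof -
  have "finite (\<Union>t\<in>keys p. Poly_Mapping.range t)" by simp
  then obtain M where M: "\<forall>x\<in>(\<Union>t\<in>keys p. Poly_Mapping.range t). x \<le> M"
    using finite_nat_set_iff_bounded_le by blast
  have "lookup t v \<le> M" if "t \<in> keys p" for t v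
    using M that by (cases "v \<in> keys t") (auto simp: in_keys_iff)
  then show ?thesis by (auto simp: exponent_bound_def)
qed

lemma exponent_bound_mono: "exponent_bound M p \<Longrightarrow> M \<le> M' \<Longrightarrow> exponent_bound M' p"
  unfolding exponent_bound_def by (meson order_trans)

lemma exponent_bound_mult:
  fixes p q :: "('v, 'k::field) mpoly"
  assumes "exponent_bound M p" "exponent_bound M' q"
  shows "exponent_bound (M + M') (p * q)"
  unfolding exponent_bound_def
proof (intro ballI allI)
  fix u v assume "u \<in> keys (p * q)"
  then obtain s t where "s \<in> keys p" "t \<in> keys q" "u = s + t" by (rule keys_mult_obtain)
  then show "lookup u v \<le> M + M'"
    using assms by (simp add: exponent_bound_def lookup_add add_mono)
qed

lemma exponent_bound_one: "exponent_bound M (1 :: ('v, 'k::field) mpoly)"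
  by (simp add: exponent_bound_def)

lemma exponent_bound_power:
  "exponent_bound M p \<Longrightarrow> exponent_bound (a * M) (p ^ a)" for p :: "('v, 'k::field) mpoly"
  by (induction a) (auto intro: exponent_bound_one exponent_bound_mult)

lemma exponent_bound_power_product:
  fixes fs :: "('v, 'k::field) mpoly list"
  assumes "\<And>f. f \<in> set fs \<Longrightarrow> exponent_bound M f" "set u \<subseteq> {..<N}"
  shows "exponent_bound (length u * (N * M)) (power_product fs u)"
  using assms
proof (induction fs u rule: power_product.induct)
  case (1 f fs a u)
  have "exponent_bound (N * M) (f ^ a)"
    using exponent_bound_mono[OF exponent_bound_power[of M f a]] 1 by simp
  then show ?case using exponent_bound_mult 1 by auto
qed (simp_all add: exponent_bound_one)

lemma card_bounded_monomials:
  fixes U :: "'v set"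
  assumes "finite U"
  shows "finite {t :: 'v \<Rightarrow>\<^sub>0 nat. keys t \<subseteq> U \<and> (\<forall>v. lookup t v \<le> B)}"
    and "card {t :: 'v \<Rightarrow>\<^sub>0 nat. keys t \<subseteq> U \<and> (\<forall>v. lookup t v \<le> B)} \<le> (B + 1) ^ card U"
proof -
  let ?T = "{t :: 'v \<Rightarrow>\<^sub>0 nat. keys t \<subseteq> U \<and> (\<forall>v. lookup t v \<le> B)}"
  let ?g = "\<lambda>t. restrict (lookup t) U"
  have inj: "inj_on ?g ?T"
  proof (rule inj_onI)
    fix s t assume s: "s \<in> ?T" and t: "t \<in> ?T" and eq: "?g s = ?g t"
    show "s = t"
    proof (rule poly_mapping_eqI)
      fix v
      show "lookup s v = lookup t v"
      proof (cases "v \<in> U")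
        case True
        then show ?thesis using fun_cong[OF eq, of v] by simp
      next
        case False
        then have "v \<notin> keys s" "v \<notin> keys t" using s t by auto
        then show ?thesis by (simp add: in_keys_iff)
      qed
    qed
  qed
  have into: "?g ` ?T \<subseteq> PiE U (\<lambda>_. {..B})" by auto
  have fin: "finite (PiE U (\<lambda>_. {..B}))" using assms by (simp add: finite_PiE)
  show "finite ?T" using inj_on_finite[OF inj into fin] .
  have "card ?T \<le> card (PiE U (\<lambda>_. {..B}))" using card_inj_on_le[OF inj into fin] .
  then show "card ?T \<le> (B + 1) ^ card U" using assms by (simp add: card_PiE)
qed

lemma lookup_scale: "lookup (single 0 c * p) t = c * lookup p t" for p :: "('v, 'k::field) mpoly"
  by (simp flip: mult_map_scale_conv_mult add: Poly_Mapping.map.rep_eq when_def)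

context polynomials
begin

lemma const_mem: "single 0 c \<in> R"
  by (auto simp: mem_R)

lemma sum_mem: "is_ideal A \<Longrightarrow> (\<And>i. i \<in> S \<Longrightarrow> f i \<in> A) \<Longrightarrow> (\<Sum>i\<in>S. f i) \<in> A"
  by (induction S rule: infinite_finite_induct) (simp_all add: ideal_0 ideal_add)

lemma power_mem: "f \<in> R \<Longrightarrow> f ^ a \<in> R"
  by (induction a) (simp_all add: one_mem mult_mem)

lemma power_product_mem: "set fs \<subseteq> R \<Longrightarrow> power_product fs u \<in> R"
  by (induction fs u rule: power_product.induct) (simp_all add: one_mem mult_mem power_mem)

lemma prime_power: "is_prime P \<Longrightarrow> f \<in> R \<Longrightarrow> f ^ a \<in> P \<Longrightarrow> f \<in> P"
proof (induction a)
  case 0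
  then show ?case by (simp add: is_prime_def)
next
  case (Suc a)
  then show ?case using prime_mult_iff[OF Suc.prems(1,2) power_mem[OF Suc.prems(2), of a]] by auto
qed

text \<open>
  Elements chosen along a chain of primes are algebraically independent modulo its first member:
  after division by the first element \<open>f\<close>, the constant term in \<open>f\<close> of a relation lies in the
  second prime.
\<close>

lemma chain_independent:
  assumes "\<And>i. i \<le> length fs \<Longrightarrow> is_prime (P i)" "\<And>i. i < length fs \<Longrightarrow> P i \<subseteq> P (Suc i)"
    and "\<And>i. i < length fs \<Longrightarrow> fs ! i \<in> P (Suc i) \<and> fs ! i \<notin> P i"
    and "(\<Sum>u\<in>exponents N (length fs). single 0 (c u) * power_product fs u) \<in> P 0"
    and "u \<in> exponents N (length fs)"
  shows "c u = 0"
  using assms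
proof (induction fs arbitrary: P c u)
  case Nil
  have e: "exponents N 0 = {[]}" by (auto simp: exponents_def)
  have P: "is_prime (P 0)" using Nil by simp
  then have I: "is_ideal (P 0)" by (simp add: is_prime_def)
  have c: "single 0 (c []) \<in> P 0" using Nil e by simp
  show ?case
  proof (rule ccontr)
    assume "c u \<noteq> 0"
    then have "c [] \<noteq> 0" using Nil(5) e by simp
    then have "single 0 (inverse (c [])) * single 0 (c []) = (1 :: ('v, 'k) mpoly)"
      by (simp add: mult_single)
    then have "1 \<in> P 0" using ideal_mult[OF I const_mem c] by metis
    then show False using P by (simp add: is_prime_def)
  qed
next
  case (Cons f fs)
  let ?D = "exponents N (length fs)"
  let ?e = "\<lambda>a. \<Sum>u\<in>?D. single 0 (c (a # u)) * power_product fs u"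
  have P0: "is_prime (P 0)" "is_ideal (P 0)" and P1: "is_ideal (P 1)"
    using Cons.prems(1)[of 0] Cons.prems(1)[of 1] by (auto simp: is_prime_def)
  have sub: "P 0 \<subseteq> P 1" using Cons.prems(2)[of 0] by simp
  have f: "f \<in> P 1" "f \<notin> P 0" "f \<in> R" using Cons.prems(3)[of 0] ideal_mem[OF P1] by auto
  have fs: "set fs \<subseteq> R"
  proof
    fix g assume "g \<in> set fs"
    then obtain i where i: "i < length fs" "g = fs ! i" by (auto simp: in_set_conv_nth)
    have "is_ideal (P (Suc (Suc i)))" using Cons.prems(1)[of "Suc (Suc i)"] i by (simp add: is_prime_def)
    then show "g \<in> R" using Cons.prems(3)[of "Suc i"] i ideal_mem by auto
  qed
  have eR: "?e a \<in> R" for a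
    using sum_mem[OF ideal_carrier, of ?D "\<lambda>u. single 0 (c (a # u)) * power_product fs u"]
      mult_mem[OF const_mem power_product_mem[OF fs]] by blast
  have total: "(\<Sum>a<N. f ^ a * ?e a) \<in> P 0"
  proof -
    have "(\<Sum>u\<in>exponents N (length (f # fs)). single 0 (c u) * power_product (f # fs) u) =
        (\<Sum>a<N. \<Sum>u\<in>?D. single 0 (c (a # u)) * power_product (f # fs) (a # u))"
      unfolding list.size(4) One_nat_def add_Suc_right add_0_right by (rule sum_exponents_Suc)
    also have "\<dots> = (\<Sum>a<N. f ^ a * ?e a)"
      by (simp add: sum_distrib_left mult.left_commute)
    finally show ?thesis using Cons.prems(4) by simp
  qed
  have IH: "\<forall>u\<in>?D. c (a # u) = 0" if a: "?e a \<in> P 1" for a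
  proof
    fix u assume u: "u \<in> ?D"
    show "c (a # u) = 0"
    proof (rule Cons.IH[of "\<lambda>i. P (Suc i)" "\<lambda>u. c (a # u)"])
      show "is_prime (P (Suc i))" if "i \<le> length fs" for i using Cons.prems(1) that by simp
      show "P (Suc i) \<subseteq> P (Suc (Suc i))" if "i < length fs" for i using Cons.prems(2) that by simp
      show "fs ! i \<in> P (Suc (Suc i)) \<and> fs ! i \<notin> P (Suc i)" if "i < length fs" for i
        using Cons.prems(3)[of "Suc i"] that by simp
    qed (use a u in simp_all)
  qed
  have main: "a < N \<longrightarrow> (\<forall>u\<in>?D. c (a # u) = 0)" for a
  proof (induction a rule: less_induct)
    case (less a)
    show ?case
    proof
      assume a: "a < N"
      have zero: "?e b = 0" if "b < a" for b using less that a by simp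
      have "{..<N} = {..<a} \<union> {a} \<union> {a<..<N}" using a by auto
      then have "(\<Sum>b<N. f ^ b * ?e b) = (\<Sum>b\<in>{..<a} \<union> {a} \<union> {a<..<N}. f ^ b * ?e b)" by simp
      also have "\<dots> = (\<Sum>b<a. f ^ b * ?e b) + f ^ a * ?e a + (\<Sum>b\<in>{a<..<N}. f ^ b * ?e b)"
        by (subst sum.union_disjoint; (subst sum.union_disjoint)?) auto
      also have "(\<Sum>b<a. f ^ b * ?e b) = 0" using zero by simp
      also have "(\<Sum>b\<in>{a<..<N}. f ^ b * ?e b) = (\<Sum>b\<in>{a<..<N}. f ^ a * (f * (f ^ (b - Suc a) * ?e b)))"
      proof (rule sum.cong[OF refl])
        fix b assume "b \<in> {a<..<N}"
        then have "b = a + Suc (b - Suc a)" by simp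
        then have "f ^ b = f ^ a * (f * f ^ (b - Suc a))" by (metis power_Suc power_add)
        then show "f ^ b * ?e b = f ^ a * (f * (f ^ (b - Suc a) * ?e b))" by (simp only: mult.assoc)
      qed
      finally have eq: "(\<Sum>b<N. f ^ b * ?e b) =
          f ^ a * (?e a + f * (\<Sum>b\<in>{a<..<N}. f ^ (b - Suc a) * ?e b))"
        by (simp only: distrib_left sum_distrib_left add_0)
      let ?r = "\<Sum>b\<in>{a<..<N}. f ^ (b - Suc a) * ?e b"
      have rR: "?r \<in> R"
        using sum_mem[OF ideal_carrier, of "{a<..<N}" "\<lambda>b. f ^ (b - Suc a) * ?e b"]
          mult_mem[OF power_mem[OF f(3)] eR] by blast
      have sR: "?e a + f * ?r \<in> R" using add_mem[OF eR mult_mem[OF f(3) rR]] .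
      have "f ^ a * (?e a + f * ?r) \<in> P 0" using total unfolding eq .
      then have "f ^ a \<in> P 0 \<or> ?e a + f * ?r \<in> P 0"
        using prime_mult_iff[OF P0(1) power_mem[OF f(3)] sR] by simp
      then have "?e a + f * ?r \<in> P 1" using prime_power[OF P0(1) f(3)] f(2) sub by blast
      moreover have "f * ?r \<in> P 1" using ideal_mult[OF P1 rR f(1)] by (simp only: mult.commute)
      ultimately have "(?e a + f * ?r) - f * ?r \<in> P 1" by (rule ideal_diff[OF P1])
      then have "?e a \<in> P 1" by (simp only: add_diff_cancel_right')
      then show "\<forall>u\<in>?D. c (a # u) = 0" by (rule IH)
    qed
  qed
  obtain a v where "u = a # v" "a < N" "v \<in> ?D"
    using Cons.prems(5) by (cases u) (auto simp: exponents_def)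
  then show ?case using main by blast
qed

text \<open>A count: the power products of k elements with exponents below N number N^k, while only
  on the order of N^d monomials in the d variables outside C can occur in them. For k > d some
  nontrivial combination has no term in these variables alone, so it lies in the prime of C, against
  \<open>chain_independent\<close>.\<close>

lemma prime_chain_length:
  assumes C: "C \<subseteq> V" "variable_ideal C \<subseteq> P 0"
    and prime: "\<And>i. i \<le> k \<Longrightarrow> is_prime (P i)" and chain: "\<And>i. i < k \<Longrightarrow> P i \<subset> P (Suc i)"
  shows "k \<le> card (V - C)"
proof (rule ccontr)
  let ?d = "card (V - C)"
  assume "\<not> k \<le> ?d"
  then have dk: "Suc ?d \<le> k" by simp
  have "\<forall>i. \<exists>f. i < k \<longrightarrow> f \<in> P (Suc i) \<and> f \<notin> P i" using chain by blast
  then obtain g where g: "\<And>i. i < k \<Longrightarrow> g i \<in> P (Suc i) \<and> g i \<notin> P i" by metis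
  define fs where "fs = map g [0..<k]"
  have len: "length fs = k" and nth: "\<And>i. i < k \<Longrightarrow> fs ! i = g i" by (simp_all add: fs_def)
  have fsR: "set fs \<subseteq> R"
  proof
    fix f assume "f \<in> set fs"
    then obtain i where i: "i < k" "f = g i" by (auto simp: fs_def)
    then have "is_ideal (P (Suc i))" using prime[of "Suc i"] by (simp add: is_prime_def)
    then show "f \<in> R" using g i ideal_mem by blast
  qed
  have "\<exists>M. \<forall>f\<in>set fs. exponent_bound M f"
  proof -
    obtain m where m: "\<And>f::('v, 'k) mpoly. exponent_bound (m f) f" using exponent_bound_exists by metis
    have "exponent_bound (Max (m ` set fs)) f" if "f \<in> set fs" for f
      using exponent_bound_mono[OF m] that by auto
    then show ?thesis by blast
  qed
  then obtain M where M: "\<And>f. f \<in> set fs \<Longrightarrow> exponent_bound M f" by blast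
  \<comment> \<open>\<open>N\<close> exceeds the constant in (B + 1)^d \<le> N^d (k M + 1)^d, so the
    right side is below N^(d+1) \<le> N^k. The bound \<open>B\<close> is k factors, each at most an
    N-th power of a polynomial with exponents at most M.\<close>
  define N where "N = Suc ((k * M + 1) ^ ?d)"
  define B where "B = k * (N * M)"
  let ?T = "{t :: 'v \<Rightarrow>\<^sub>0 nat. keys t \<subseteq> V - C \<and> (\<forall>v. lookup t v \<le> B)}"
  let ?D = "exponents N k"
  have fin: "finite (V - C)" using finite_V by simp
  have "B + 1 \<le> N * (k * M + 1)" by (simp add: B_def N_def algebra_simps)
  then have "(B + 1) ^ ?d \<le> (N * (k * M + 1)) ^ ?d" by (rule power_mono) simp
  also have "\<dots> = N ^ ?d * (k * M + 1) ^ ?d" by (simp only: power_mult_distrib)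
  also have "\<dots> < N ^ ?d * N" by (intro mult_strict_left_mono) (simp_all add: N_def)
  also have "\<dots> = N ^ Suc ?d" by simp
  also have "\<dots> \<le> N ^ k" using dk by (intro power_increasing) (simp_all add: N_def)
  finally have lt: "card ?T < card ?D" using card_bounded_monomials(2)[OF fin, of B] card_exponents by simp
  have "\<exists>c. (\<exists>u\<in>?D. c u \<noteq> 0) \<and> (\<forall>t\<in>?T. (\<Sum>u\<in>?D. c u * lookup (power_product fs u) t) = 0)"
    by (rule linear_dependence[OF card_bounded_monomials(1)[OF fin] finite_exponents lt])
  then obtain c where c: "\<exists>u\<in>?D. c u \<noteq> 0"
    "\<forall>t\<in>?T. (\<Sum>u\<in>?D. c u * lookup (power_product fs u) t) = 0"
    by (elim exE conjE)
  let ?s = "\<Sum>u\<in>?D. single 0 (c u) * power_product fs u"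
  have lk: "lookup ?s t = (\<Sum>u\<in>?D. c u * lookup (power_product fs u) t)" for t
    by (simp add: lookup_sum lookup_scale)
  have sR: "?s \<in> R"
    using sum_mem[OF ideal_carrier, of ?D "\<lambda>u. single 0 (c u) * power_product fs u"]
      mult_mem[OF const_mem power_product_mem[OF fsR]] by blast
  have "keys t \<inter> C \<noteq> {}" if t: "t \<in> keys ?s" for t
  proof
    assume disj: "keys t \<inter> C = {}"
    have ne: "lookup ?s t \<noteq> 0" using t by (simp only: in_keys_iff not_False_eq_True)
    then obtain u where u: "u \<in> ?D" "lookup (power_product fs u) t \<noteq> 0"
      unfolding lk by (metis (no_types, lifting) mult_zero_right sum.neutral)
    have "exponent_bound B (power_product fs u)"
      using exponent_bound_power_product[OF M, where u = u and N = N] u(1) by (simp add: exponents_def B_def)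
    then have "\<forall>v. lookup t v \<le> B" using u(2) by (simp add: exponent_bound_def in_keys_iff)
    moreover have "keys t \<subseteq> V" using sR t by (simp only: mem_R)
    ultimately have "t \<in> ?T" using disj by blast
    then show False using ne c(2) unfolding lk by blast
  qed
  then have "?s \<in> variable_ideal C" using sR by (simp add: monomial_ideal_def)
  then have s0: "?s \<in> P 0" using C(2) by blast
  have "c u = 0" if "u \<in> ?D" for u
  proof (rule chain_independent[where fs = fs and P = P and N = N and c = c])
    show "is_prime (P i)" if "i \<le> length fs" for i using prime that len by simp
    show "P i \<subseteq> P (Suc i)" if "i < length fs" for i using chain[of i] that len by blast
    show "fs ! i \<in> P (Suc i) \<and> fs ! i \<notin> P i" if "i < length fs" for i using g nth that len by simp
  qed (use s0 that len in simp_all)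
  then show False using c(1) by blast
qed

lemma krull_dim_monomial_le:
  assumes "is_ideal I" "monomial_ideal F \<subseteq> I" "finite F" "\<And>C. C \<in> F \<Longrightarrow> C \<subseteq> V \<and> card (V - C) \<le> d"
  shows "krull_dim (set_ring R Quot I) \<le> enat d"
proof (rule krull_dim_quotient_le[OF assms(1)])
  fix k P
  assume prime: "\<And>i. i \<le> k \<Longrightarrow> is_prime (P i)" and chain: "\<And>i. i < k \<Longrightarrow> P i \<subset> P (Suc i)"
    and I: "I \<subseteq> P 0"
  have "monomial_ideal F \<subseteq> P 0" using assms(2) I by (rule order_trans)
  then obtain C where C: "C \<in> F" "variable_ideal C \<subseteq> P 0"
    using prime_contains_monomial_ideal[OF prime[of 0] assms(3)] assms(4) by blast
  have "k \<le> card (V - C)"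
    using prime_chain_length[OF _ C(2) prime chain] assms(4)[OF C(1)] by blast
  then show "k \<le> d" using assms(4)[OF C(1)] by simp
qed

end


section \<open>Filtrations by ideals\<close>

text \<open>Positivity of k excludes the empty set, whose supremum is 0.\<close>

lemma enat_le_SupE:
  assumes "enat k \<le> Sup S" "k > 0"
  obtains x where "x \<in> S" "enat k \<le> x"
proof (rule ccontr)
  assume "\<not> thesis"
  then have "\<And>x. x \<in> S \<Longrightarrow> x < enat k" using that by force
  then have "Sup S \<le> enat (k - 1)"
  proof (intro Sup_least)
    fix x assume "x \<in> S" "\<And>x. x \<in> S \<Longrightarrow> x < enat k"
    then have "x < enat k" by blast
    then show "x \<le> enat (k - 1)" by (cases x) auto
  qed
  then have "enat k \<le> enat (k - 1)" using assms(1) by (rule order_trans[rotated])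
  then show False using assms(2) by simp
qed

context commutative_subring
begin

text \<open>For B \<subseteq> A this is the annihilator of A / B.\<close>

definition colon :: "'a set \<Rightarrow> 'a set \<Rightarrow> 'a set" where
  "colon B A = {r \<in> R. \<forall>a\<in>A. r * a \<in> B}"

lemma is_ideal_colon:
  assumes "is_ideal B" "A \<subseteq> R"
  shows "is_ideal (colon B A)"
  unfolding colon_def
  using assms ideal_0 ideal_add ideal_mult
  by (intro is_idealI) (auto simp: zero_mem add_mem mult_mem distrib_right mult.assoc)

lemma presents_module_dim:
  assumes "presents M A B \<sigma>"
  shows "module_dim (set_ring R) M = krull_dim (set_ring R Quot colon B A)"
  unfolding module_dim_def presents_annihilator[OF assms] colon_def ..

end

context polynomials
begin

text \<open>For ideals this is homogeneity, since homogeneous components are differences of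
  consecutive truncations; it is the form in which the Nakayama argument uses it.\<close>

definition truncation_closed :: "('v, 'k) mpoly set \<Rightarrow> bool" where
  "truncation_closed A \<longleftrightarrow> (\<forall>N. \<forall>p\<in>A. restrict_keys {t. monom_deg t < N} p \<in> A)"

lemma truncation_closed_monomial_ideal: "truncation_closed (monomial_ideal F)"
  unfolding truncation_closed_def using restrict_keys_monomial_ideal by blast

lemma restrict_keys_zero [simp]: "restrict_keys S 0 = 0"
  by (rule restrict_keys_0) simp

text \<open>A bound that truncates to 0 is still the right one: then no term of the product has
  degree below N.\<close>

lemma restrict_keys_single_mult:
  "restrict_keys {t. monom_deg t < N} (single s c * p) =
     single s c * restrict_keys {t. monom_deg t < N - monom_deg s} p"
  for p :: "('v, 'k) mpoly"
proof -
  let ?S = "{t. monom_deg t < N - monom_deg s}"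
  let ?S' = "{t. monom_deg t < N}"
  have deg: "\<exists>t\<in>keys q. monom_deg u = monom_deg s + monom_deg t"
    if u: "u \<in> keys (single s c * q)" for u and q :: "('v, 'k) mpoly"
  proof -
    obtain s' t where "s' \<in> keys (single s c)" "t \<in> keys q" "u = s' + t"
      using u by (rule keys_mult_obtain)
    then show ?thesis using monom_deg_add by (auto split: if_splits)
  qed
  have 1: "restrict_keys ?S' (single s c * restrict_keys ?S p) = single s c * restrict_keys ?S p"
  proof (rule restrict_keys_id, rule subsetI)
    fix u assume "u \<in> keys (single s c * restrict_keys ?S p)"
    from deg[OF this] show "u \<in> ?S'" by (auto simp: keys_restrict_keys)
  qed
  have 2: "restrict_keys ?S' (single s c * restrict_keys (- ?S) p) = 0"
  proof (rule restrict_keys_0, rule equals0I)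
    fix u assume "u \<in> keys (single s c * restrict_keys (- ?S) p) \<inter> ?S'"
    then show False using deg[of u "restrict_keys (- ?S) p"] by (auto simp: keys_restrict_keys)
  qed
  have "single s c * p = single s c * restrict_keys ?S p + single s c * restrict_keys (- ?S) p"
    unfolding distrib_left[symmetric] restrict_keys_split[symmetric] ..
  then show ?thesis using 1 2 by (simp only: restrict_keys_add add_0_right)
qed

text \<open>The elements all of whose truncations stay in the ideal form an ideal again. It contains
  J and the homogeneous elements, since each truncation of these is the element itself or 0; hence
  it contains everything they span.\<close>

lemma graded_submodule_truncation_closed:
  assumes J: "is_ideal J" "truncation_closed J"
    and P: "presents M R J \<sigma>"
    and gr: "graded_submodule N (set_ring R) M (\<lambda>d. \<sigma> ` poly_grading V d)"
  shows "truncation_closed {p \<in> R. \<sigma> p \<in> N}"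
proof -
  let ?A = "{p \<in> R. \<sigma> p \<in> N}"
  let ?T = "\<lambda>N. restrict_keys {t. monom_deg t < N} :: ('v, 'k) mpoly \<Rightarrow> _"
  define A' where "A' = {p \<in> ?A. \<forall>N. ?T N p \<in> ?A}"
  have sub: "submodule N (set_ring R) M" using gr by (simp add: graded_submodule_def)
  note A = presents_submodule_vimage[OF P sub]
  have A': "is_ideal A'"
  proof (rule is_idealI)
    show "A' \<subseteq> R" by (auto simp: A'_def)
    show "0 \<in> A'" using ideal_0[OF A(1)] by (simp add: A'_def)
    show "a + b \<in> A'" if "a \<in> A'" "b \<in> A'" for a b
      using that ideal_add[OF A(1), of a b] ideal_add[OF A(1), of "?T _ a" "?T _ b"]
      by (simp add: A'_def restrict_keys_add)
    show "r * a \<in> A'" if r: "r \<in> R" and a: "a \<in> A'" for r a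
    proof -
      have aA: "a \<in> ?A" "\<And>N. ?T N a \<in> ?A" using a by (simp_all add: A'_def)
      have "?T N (r * a) \<in> ?A" for N
      proof -
        \<comment> \<open>Induction over the terms of r: multiplication by a single term only shifts
          the degree at which \<open>a\<close> is truncated.\<close>
        define Q where "Q q = (?T N (q * a) \<in> ?A)" for q
        have "Q r"
        proof (rule poly_induct_single)
          show "Q 0" using ideal_0[OF A(1)] by (simp add: Q_def)
          show "Q (q + q')" if "Q q" "Q q'" for q q'
            using ideal_add[OF A(1)] that by (simp add: Q_def distrib_right restrict_keys_add)
          show "Q (single t (lookup r t))" if "t \<in> keys r" for t
          proof -
            have "single t (lookup r t) \<in> R" using r that by (simp add: mem_R)
            then show ?thesis
              unfolding Q_def restrict_keys_single_mult using ideal_mult[OF A(1) _ aA(2)] by blast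
          qed
        qed
        then show ?thesis by (simp only: Q_def)
      qed
      then show ?thesis using ideal_mult[OF A(1) r aA(1)] by (simp only: A'_def mem_Collect_eq) simp
    qed
  qed
  have JA': "J \<subseteq> A'" using J(2) A(2) by (auto simp: A'_def truncation_closed_def)
  have A'R: "A' \<subseteq> R" by (auto simp: A'_def)
  have gen: "N \<inter> (\<Union>d. \<sigma> ` poly_grading V d) \<subseteq> \<sigma> ` A'"
  proof
    fix x assume "x \<in> N \<inter> (\<Union>d. \<sigma> ` poly_grading V d)"
    then obtain d q where q: "q \<in> poly_grading V d" "x = \<sigma> q" "\<sigma> q \<in> N" by blast
    then have qR: "q \<in> R" and dq: "\<forall>t\<in>keys q. monom_deg t = d"
      by (auto simp: poly_grading_def poly_ring_eq R_eq)
    have "?T N q = q \<or> ?T N q = 0" for N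
    proof (cases "d < N")
      case True
      then show ?thesis using dq by (intro disjI1 restrict_keys_id) auto
    next
      case False
      then show ?thesis using dq by (intro disjI2 restrict_keys_0) auto
    qed
    moreover have "q \<in> ?A" "0 \<in> ?A" using qR q(3) ideal_0[OF A(1)] by simp_all
    ultimately have "?T N q \<in> ?A" for N by (metis (no_types))
    then have "q \<in> A'" using \<open>q \<in> ?A\<close> by (simp only: A'_def mem_Collect_eq) simp
    then show "x \<in> \<sigma> ` A'" using q(2) by blast
  qed
  have "N = span_submodule (set_ring R) M (N \<inter> (\<Union>d. \<sigma> ` poly_grading V d))"
    using gr by (simp add: graded_submodule_def)
  also have "\<dots> \<subseteq> \<sigma> ` A'"
    unfolding span_submodule_def
    using gen presents_submodule_image[OF P A' A'R] by (rule hull_minimal)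
  finally have N: "N \<subseteq> \<sigma> ` A'" .
  show ?thesis
    unfolding truncation_closed_def
  proof (intro allI ballI)
    fix n p assume p: "p \<in> ?A"
    then have "\<sigma> p \<in> \<sigma> ` A'" "p \<in> R" using N by auto
    then have "p \<in> A'" using presents_image_mem[OF P A' JA' A'R] by simp
    then show "?T n p \<in> ?A" by (simp only: A'_def mem_Collect_eq)
  qed
qed

text \<open>A regular sequence in the irrelevant ideal consists of combinations of all the
  variables, so the cohomology for V vanishes in degrees below k; each variable outside
  \<open>vs\<close> lowers this bound by one.\<close>

lemma koszul_vanish_depth:
  assumes P: "presents M A B \<sigma>" and tA: "truncation_closed A" and tB: "truncation_closed B"
    and depth: "enat k \<le> depth (set_ring R) (irrelevant) M"
    and vs: "distinct vs" "set vs \<subseteq> V" and i: "i + int (card (V - set vs)) < int k"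
  shows "koszul_vanish (map mvar vs) i A B"
proof (cases "i < 0")
  case True
  then show ?thesis using koszul_vanish_neg presentsD(1,2)[OF P] by blast
next
  case False
  note A = presentsD(1)[OF P] and B = presentsD(2,3)[OF P]
  have "k > 0" using False i by linarith
  then obtain x where x: "enat k \<le> x" "x \<in> {enat (length fs) | fs. set fs \<subseteq>
      irrelevant \<and> regular_sequence (set_ring R) M fs}"
    using depth unfolding depth_def by (elim enat_le_SupE) auto
  then obtain fs where "x = enat (length fs)" "regular_sequence (set_ring R) M fs"
    "set fs \<subseteq> irrelevant" by blast
  then have fs: "k \<le> length fs" "set fs \<subseteq> variable_ideal V" "weakly_regular fs A B"
    using x(1) order_trans[OF _ irrelevant_ideal_subset] presents_regular_sequence[OF P, of fs]
    by simp_all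
  obtain ws where ws: "set ws = V - set vs" "distinct ws"
    using finite_distinct_list[of "V - set vs"] finite_V by auto
  have len: "length ws = card (V - set vs)" using distinct_card[OF ws(2)] ws(1) by simp
  have V: "set (ws @ vs) = V" using ws vs by auto
  have comb: "\<forall>f\<in>set fs. combination (map mvar (ws @ vs)) f"
    using fs(2) variable_ideal_combination[of _ "ws @ vs"] unfolding V by blast
  have "set (map mvar (ws @ vs)) \<subseteq> R" using mvar_mem V by auto
  then have "koszul_vanish (map mvar (ws @ vs)) (i + int (length ws)) A B"
    by (rule koszul_vanish_weakly_regular[OF A _ B comb fs(3)]) (use i len fs(1) in simp)
  moreover have "mvar ` (V - set vs) \<subseteq> mvar ` V" "mvar ` set vs \<subseteq> mvar ` V" using vs by auto
  ultimately show ?thesis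
    using koszul_vanish_append[OF A B, of "map mvar ws" "map mvar vs" i] tA tB ws(1)
    by (simp add: truncation_closed_def)
qed

text \<open>The definition in terms of a chain of ideals. The Cohen-Macaulay property of the factors
  is retained as vanishing of Koszul cohomology for all sets of variables.\<close>

lemma seq_cohen_macaulay_ideal_filtration:
  assumes J: "is_ideal J" "truncation_closed J" and scm: "seq_cohen_macaulay_ideal V J"
  obtains r A where "\<And>i. i \<le> r \<Longrightarrow> is_ideal (A i)" "A 0 = J" "A r = R" "\<And>i. i < r \<Longrightarrow> A i \<subseteq> A (Suc i)"
    "\<And>i. Suc i < r \<Longrightarrow> krull_dim (set_ring R Quot colon (A i) (A (Suc i))) <
        krull_dim (set_ring R Quot colon (A (Suc i)) (A (Suc (Suc i))))"
    "\<And>i k vs j. i < r \<Longrightarrow> enat k \<le> krull_dim (set_ring R Quot colon (A i) (A (Suc i))) \<Longrightarrow>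
        distinct vs \<Longrightarrow> set vs \<subseteq> V \<Longrightarrow> j + int (card (V - set vs)) < int k \<Longrightarrow>
        koszul_vanish (map mvar vs) j (A (Suc i)) (A i)"
proof -
  let ?M = "quot_module (ring_module (set_ring R)) J" and ?\<sigma> = "\<lambda>p. J +>\<^bsub>set_ring R\<^esub> p"
  have P: "presents ?M R J ?\<sigma>" using presents_quotient_ring[OF J(1)] .
  have pr: "poly_ring V = set_ring R" by (simp add: poly_ring_eq R_eq)
  obtain r N where N: "N 0 = {\<zero>\<^bsub>?M\<^esub>}" "N r = carrier ?M"
    "\<forall>i\<le>r. graded_submodule (N i) (set_ring R) ?M (\<lambda>d. ?\<sigma> ` poly_grading V d)"
    "\<forall>i<r. N i \<subset> N (Suc i)"
    "\<forall>i<r. cohen_macaulay (set_ring R) (poly_grading V) (quot_module (?M\<lparr>carrier := N (Suc i)\<rparr>) (N i))"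
    "\<forall>i. Suc i < r \<longrightarrow> module_dim (set_ring R) (quot_module (?M\<lparr>carrier := N (Suc i)\<rparr>) (N i)) <
      module_dim (set_ring R) (quot_module (?M\<lparr>carrier := N (Suc (Suc i))\<rparr>) (N (Suc i)))"
    using scm unfolding seq_cohen_macaulay_ideal_def seq_cohen_macaulay_def Let_def pr by blast
  define A where "A i = {p \<in> R. ?\<sigma> p \<in> N i}" for i
  have sub: "submodule (N i) (set_ring R) ?M" if "i \<le> r" for i
    using N(3) that by (simp add: graded_submodule_def)
  have A: "is_ideal (A i)" "J \<subseteq> A i" "A i \<subseteq> R" "N i = ?\<sigma> ` A i" if "i \<le> r" for i
    using presents_submodule_vimage[OF P sub[OF that]] by (simp_all only: A_def)
  have tA: "truncation_closed (A i)" if "i \<le> r" for i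
    unfolding A_def using graded_submodule_truncation_closed[OF J P] N(3) that by blast
  have mono: "A i \<subseteq> A (Suc i)" if "i < r" for i
    using N(4) that unfolding A_def by blast
  let ?Q = "\<lambda>i. quot_module (?M\<lparr>carrier := N (Suc i)\<rparr>) (N i)"
  have Q: "\<exists>\<tau>. presents (?Q i) (A (Suc i)) (A i) \<tau>" if i: "i < r" for i
  proof -
    have "presents (?M\<lparr>carrier := ?\<sigma> ` A (Suc i)\<rparr>) (A (Suc i)) J ?\<sigma>"
      using A[of "Suc i"] i by (intro presents_carrier[OF P]) simp_all
    from presents_quot_module[OF this A(1)[of i] A(2)[of i] mono[OF i]] show ?thesis
      using A(4)[of i] A(4)[of "Suc i"] i by auto
  qed
  have dim: "module_dim (set_ring R) (?Q i) = krull_dim (set_ring R Quot colon (A i) (A (Suc i)))"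
    if "i < r" for i
    using Q[OF that] presents_module_dim by blast
  have "A 0 = J"
    using N(1) presents_eq_zero[OF P] ideal_mem[OF J(1)] by (auto simp: A_def)
  moreover have "A r = R"
    using N(2) presentsD(4)[OF P] by (auto simp: A_def)
  moreover have "koszul_vanish (map mvar vs) j (A (Suc i)) (A i)"
    if i: "i < r" and k: "enat k \<le> krull_dim (set_ring R Quot colon (A i) (A (Suc i)))"
      and vs: "distinct vs" "set vs \<subseteq> V" "j + int (card (V - set vs)) < int k" for i k vs j
  proof -
    obtain \<tau> where \<tau>: "presents (?Q i) (A (Suc i)) (A i) \<tau>" using Q[OF i] by blast
    have "depth (set_ring R) (irrelevant) (?Q i) =
        krull_dim (set_ring R Quot colon (A i) (A (Suc i)))"
      using N(5) i dim unfolding cohen_macaulay_def pr by simp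
    then show ?thesis
      using k i vs tA[of i] tA[of "Suc i"] by (intro koszul_vanish_depth[OF \<tau>]) simp_all
  qed
  ultimately show thesis
    using that[of r A] A(1) mono N(6) dim by simp
qed

end


section \<open>An obstruction to being sequentially Cohen-Macaulay\<close>

context polynomials
begin

text \<open>
  A filtration as in the definition has to be the one by the intersections of the primes of height
  below a bound. Let \<open>z\<close> be the product of the variables outside \<open>E \<union> G\<close>. Then \<open>v \<mapsto> z v\<close> on \<open>E\<close> and
  \<open>v \<mapsto> 0\<close> on \<open>G - E\<close> is a cocycle for \<open>E \<union> G\<close> with coefficients in the quotient by the primes of
  height at most that of \<open>G\<close>. It is not a coboundary, although depth would force it to be one.
\<close>

lemma not_seq_cohen_macaulay:
  assumes F: "finite F" "\<And>C. C \<in> F \<Longrightarrow> C \<subseteq> V"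
    and anti: "\<And>C C'. C \<in> F \<Longrightarrow> C' \<in> F \<Longrightarrow> C \<subseteq> C' \<Longrightarrow> C = C'"
    and EG: "E \<in> F" "G \<in> F" "card E \<le> card G" "card (E - G) \<ge> 2"
    and other: "\<And>C. C \<in> F \<Longrightarrow> card C \<le> card G \<Longrightarrow> C \<subseteq> E \<union> G \<Longrightarrow> C = E \<or> C = G"
  shows "\<not> seq_cohen_macaulay_ideal V (monomial_ideal F)"
proof
  let ?J = "monomial_ideal F"
  let ?P = "\<lambda>C. variable_ideal C"
  note PI = is_ideal_monomial_ideal
  assume scm: "seq_cohen_macaulay_ideal V ?J"
  obtain r A where A: "\<And>i. i \<le> r \<Longrightarrow> is_ideal (A i)" "A 0 = ?J" "A r = R"
    "\<And>i. i < r \<Longrightarrow> A i \<subseteq> A (Suc i)"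
    and D: "\<And>i. Suc i < r \<Longrightarrow> krull_dim (set_ring R Quot colon (A i) (A (Suc i))) <
        krull_dim (set_ring R Quot colon (A (Suc i)) (A (Suc (Suc i))))"
    and van: "\<And>i k vs j. i < r \<Longrightarrow> enat k \<le> krull_dim (set_ring R Quot colon (A i) (A (Suc i))) \<Longrightarrow>
        distinct vs \<Longrightarrow> set vs \<subseteq> V \<Longrightarrow> j + int (card (V - set vs)) < int k \<Longrightarrow>
        koszul_vanish (map mvar vs) j (A (Suc i)) (A i)"
    by (rule seq_cohen_macaulay_ideal_filtration[OF PI truncation_closed_monomial_ideal scm]) blast
  define d where "d i = krull_dim (set_ring R Quot colon (A i) (A (Suc i)))" for i
  have d_mono: "d i < d j" if "i < j" "j < r" for i j
    using that
  proof (induction j)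
    case (Suc j)
    then have "d j < d (Suc j)" using D unfolding d_def by blast
    then show ?case using Suc by (cases "i = j") auto
  qed simp
  have A_mono: "A i \<subseteq> A j" if "i \<le> j" "j \<le> r" for i j
    using that
  proof (induction j)
    case (Suc j)
    then show ?case using A(4)[of j] by (cases "i = Suc j") auto
  qed simp
  \<comment> \<open>Vanishing in degree 0: no nonzero element of a factor is killed by a prime of
    variables whose dimension is below that of the factor.\<close>
  have H0: "u \<in> A i" if i: "i < r" and W: "W \<subseteq> V" "enat (Suc (card (V - W))) \<le> d i"
    and u: "u \<in> A (Suc i)" "\<And>v. v \<in> W \<Longrightarrow> mvar v * u \<in> A i" for i W u
  proof -
    obtain vs where vs: "set vs = W" "distinct vs"
      using finite_distinct_list[of W] finite_subset[OF W(1) finite_V] by blast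
    have "koszul_vanish (map mvar vs) 0 (A (Suc i)) (A i)"
      using W vs by (intro van[OF i W(2)[unfolded d_def]]) simp_all
    then show ?thesis
      using koszul_vanish_0D[of "A (Suc i)" "A i" "map mvar vs" u] A(1) i u vs(1) by auto
  qed
  have "\<exists>i<r. A i \<subseteq> ?P C \<and> \<not> A (Suc i) \<subseteq> ?P C" if C: "C \<in> F" for C
  proof (rule ccontr)
    assume neg: "\<not> ?thesis"
    have "i \<le> r \<Longrightarrow> A i \<subseteq> ?P C" for i
    proof (induction i)
      case 0
      then show ?case using A(2) C monomial_ideal_antimono[of "{C}" F] by simp
    next
      case (Suc i)
      then show ?case using neg by simp
    qed
    then have "R \<subseteq> ?P C" using A(3) by blast
    then show False using is_prime_variable_ideal[of C] one_mem by (auto simp: is_prime_def)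
  qed
  \<comment> \<open>The chain starts inside the prime of C and ends at the whole ring;
    \<open>idx C\<close> is a step at which it leaves the prime.\<close>
  then obtain idx where idx: "\<And>C. C \<in> F \<Longrightarrow> idx C < r \<and> A (idx C) \<subseteq> ?P C \<and> \<not> A (Suc (idx C)) \<subseteq> ?P C"
    by metis
  \<comment> \<open>The annihilator of the factor lies in the prime of C, which bounds its dimension
    from below. Were the dimension larger, \<open>H0\<close> would apply to g times the monomial
    \<open>?w\<close>: this product lies in all other primes, so the variables of C move it into
    \<open>?J\<close>.\<close>
  have d_idx: "d (idx C) = enat (card (V - C))" if C: "C \<in> F" for C
  proof (rule antisym)
    have i: "idx C < r" "A (idx C) \<subseteq> ?P C" using idx[OF C] by auto
    obtain g where g: "g \<in> A (Suc (idx C))" "g \<notin> ?P C" using idx[OF C] by blast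
    have AR: "A (Suc (idx C)) \<subseteq> R" using A(1)[of "Suc (idx C)"] i(1) by (simp add: is_ideal_def)
    have gR: "g \<in> R" using g AR by blast
    note prime = prime_mult_iff[OF is_prime_variable_ideal]
    have "colon (A (idx C)) (A (Suc (idx C))) \<subseteq> ?P C"
    proof
      fix x assume "x \<in> colon (A (idx C)) (A (Suc (idx C)))"
      then have "x \<in> R" "x * g \<in> ?P C" using g(1) i(2) by (auto simp: colon_def)
      then show "x \<in> ?P C" using prime[of x g C] gR g(2) by blast
    qed
    then show "enat (card (V - C)) \<le> d (idx C)"
      unfolding d_def using F(2)[OF C] A(1) i(1)
      by (intro variable_ideal_chain is_ideal_colon[OF _ AR]) simp_all
    show "d (idx C) \<le> enat (card (V - C))"
    proof (rule ccontr)
      assume "\<not> d (idx C) \<le> enat (card (V - C))"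
      then have big: "enat (Suc (card (V - C))) \<le> d (idx C)" by (simp add: Suc_ile_eq not_le)
      let ?w = "squarefree_monomial (V - C)"
      have wR: "?w \<in> R" by (rule squarefree_monomial_mem) simp
      have w: "?w \<in> ?P C' \<longleftrightarrow> C' \<noteq> C" if "C' \<in> F" for C'
        using squarefree_monomial_mem_variable_ideal[of "V - C" C'] anti[OF that C] F(2)[OF that] by blast
      have gwR: "g * ?w \<in> R" using mult_mem[OF gR wR] .
      have "g * ?w \<in> A (Suc (idx C))"
        using ideal_mult[OF A(1) wR g(1)] i(1) by (simp add: mult.commute)
      moreover have "mvar v * (g * ?w) \<in> A (idx C)" if v: "v \<in> C" for v
      proof -
        have vV: "v \<in> V" using F(2)[OF C] v by blast
        have vR: "mvar v \<in> R" using mvar_mem[OF vV] .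
        have "mvar v * (g * ?w) \<in> ?P C'" if C': "C' \<in> F" for C'
        proof (cases "C' = C")
          case True
          then have "mvar v \<in> ?P C'" using mvar_mem_monomial_ideal[OF vV, of "{C'}"] v by simp
          then show ?thesis using prime[OF vR gwR] by blast
        next
          case False
          then have "?w \<in> ?P C'" using w[OF C'] by blast
          then show ?thesis using prime[OF vR gwR] prime[OF gR wR] by blast
        qed
        then have "\<forall>C'\<in>F. mvar v * (g * ?w) \<in> ?P C'" by (rule ballI)
        then have "mvar v * (g * ?w) \<in> ?J"
          by (rule iffD2[OF monomial_ideal_mem_iff[OF mult_mem[OF vR gwR]]])
        then show ?thesis using A(2) A_mono[of 0 "idx C"] i(1) by auto
      qed
      ultimately have "g * ?w \<in> A (idx C)" by (rule H0[OF i(1) F(2)[OF C] big])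
      then have "g * ?w \<in> ?P C" using i(2) by blast
      then show False using prime[OF gR wR, of C] g(2) w[OF C] by blast
    qed
  qed
  \<comment> \<open>The primes left before step l have dimension below that of the l-th factor, so
    \<open>H0\<close> cancels them one after another.\<close>
  have kill: "f \<in> A l"
    if l: "l < r" and S: "finite S" "S \<subseteq> F" "\<And>C. C \<in> S \<Longrightarrow> idx C < l"
      and f: "f \<in> A (Suc l)" "\<And>h. h \<in> monomial_ideal S \<Longrightarrow> f * h \<in> A l" for l S f
    using S f
  proof (induction S arbitrary: f rule: finite_induct)
    case empty
    then show ?case using one_mem by (force simp: monomial_ideal_empty)
  next
    case (insert C S)
    have C: "C \<in> F" "idx C < l" using insert.prems by auto
    have "enat (card (V - C)) < d l" using d_idx[OF C(1)] d_mono[OF C(2) l] by simp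
    then have big: "enat (Suc (card (V - C))) \<le> d l" by (simp add: Suc_ile_eq)
    show ?case
    proof (rule H0[OF l F(2)[OF C(1)] big insert.prems(3)])
      fix v assume v: "v \<in> C"
      have vV: "v \<in> V" using F(2)[OF C(1)] v by blast
      show "mvar v * f \<in> A l"
      proof (rule insert.IH)
        show "mvar v * f \<in> A (Suc l)"
          using ideal_mult[OF A(1) mvar_mem[OF vV] insert.prems(3)] l by simp
        fix h assume h: "h \<in> monomial_ideal S"
        have hR: "h \<in> R" using h monomial_ideal_subset by blast
        have R': "mvar v * h \<in> R" using mult_mem[OF mvar_mem[OF vV] hR] .
        have "mvar v \<in> ?P C" using mvar_mem_monomial_ideal[OF vV, of "{C}"] v by simp
        then have "mvar v * h \<in> ?P C"
          using prime_mult_iff[OF is_prime_variable_ideal mvar_mem[OF vV] hR] by blast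
        moreover have "mvar v * h \<in> monomial_ideal S"
          using ideal_mult[OF PI mvar_mem[OF vV] h] .
        ultimately have "mvar v * h \<in> monomial_ideal (insert C S)"
          by (auto simp: monomial_ideal_def)
        then have "f * (mvar v * h) \<in> A l" by (rule insert.prems(4))
        then show "mvar v * f * h \<in> A l" by (simp only: mult.assoc mult.left_commute)
      qed (use insert.prems in auto)
    qed
  qed
  \<comment> \<open>An element of the intersection outside \<open>A j\<close> would enter the chain
    at a later step l. Its product with anything in the intersection of the primes of index below j
    lies in \<open>?J\<close>, so \<open>kill\<close> puts the element into \<open>A l\<close>
    already.\<close>
  have shape: "monomial_ideal {C \<in> F. idx C \<ge> j} \<subseteq> A j" if j: "j \<le> r" for j
  proof
    fix f assume f: "f \<in> monomial_ideal {C \<in> F. idx C \<ge> j}"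
    show "f \<in> A j"
    proof (rule ccontr)
      assume not: "f \<notin> A j"
      have "f \<in> A r" using f monomial_ideal_subset A(3) by blast
      have "\<exists>l. j \<le> l \<and> l < r \<and> f \<notin> A l \<and> f \<in> A (Suc l)"
      proof (rule ccontr)
        assume neg: "\<nexists>l. j \<le> l \<and> l < r \<and> f \<notin> A l \<and> f \<in> A (Suc l)"
        have "j + n \<le> r \<Longrightarrow> f \<notin> A (j + n)" for n
        proof (induction n)
          case (Suc n)
          then show ?case using neg[simplified, rule_format, of "j + n"] by auto
        qed (use not in simp)
        from this[of "r - j"] show False using j \<open>f \<in> A r\<close> by simp
      qed
      then obtain l where l: "j \<le> l" "l < r" "f \<notin> A l" "f \<in> A (Suc l)" by blast
      let ?S = "{C \<in> F. idx C < j}"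
      have "f \<in> A l"
      proof (rule kill[OF l(2), of ?S])
        fix h assume h: "h \<in> monomial_ideal ?S"
        have fR: "f \<in> R" and hR: "h \<in> R" using f h monomial_ideal_subset by auto
        have "f * h \<in> monomial_ideal {C \<in> F. idx C \<ge> j}"
          using ideal_mult[OF PI hR f] by (simp only: mult.commute)
        moreover have "f * h \<in> monomial_ideal ?S" using ideal_mult[OF PI fR h] .
        ultimately have "f * h \<in> ?J" unfolding monomial_ideal_def by force
        then show "f * h \<in> A l" using A(2) A_mono[of 0 l] l(2) by auto
      qed (use F l in auto)
      then show False using l(3) by simp
    qed
  qed
  define j where "j = idx G"
  have j: "j < r" using idx[OF EG(2)] by (simp add: j_def)
  have cardC: "card (V - C) = card V - card C" if "C \<in> F" for C
    using F(2)[OF that] by (simp add: card_Diff_subset finite_subset finite_V)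
  have card_le: "card C \<le> card V" if "C \<in> F" for C using F(2)[OF that] by (rule card_mono[OF finite_V])
  have idx_ge: "idx C \<ge> j \<longleftrightarrow> card C \<le> card G" if C: "C \<in> F" for C
  proof -
    have "idx C < j \<longleftrightarrow> card (V - C) < card (V - G)"
    proof
      assume "idx C < j"
      then show "card (V - C) < card (V - G)"
        using d_mono[of "idx C" j] j d_idx[OF C] d_idx[OF EG(2)] by (simp add: j_def)
    next
      assume lt: "card (V - C) < card (V - G)"
      show "idx C < j"
      proof (rule ccontr)
        assume "\<not> idx C < j"
        then have "d j \<le> d (idx C)"
          using d_mono[of j "idx C"] idx[OF C] by (cases "idx C = j") auto
        then show False using lt d_idx[OF C] d_idx[OF EG(2)] by (simp add: j_def)
      qed
    qed
    then show ?thesis using cardC[OF C] cardC[OF EG(2)] card_le[OF C] card_le[OF EG(2)] by auto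
  qed
  have "E \<noteq> G" using EG(4) by auto
  have AE: "A j \<subseteq> ?P E"
    using idx[OF EG(1)] A_mono[of j "idx E"] idx_ge[OF EG(1)] EG(3) by auto
  have AG: "A j \<subseteq> ?P G" using idx[OF EG(2)] by (simp add: j_def)
  let ?W = "E \<union> G"
  have WV: "?W \<subseteq> V" using F(2) EG by blast
  obtain vs where vs: "set vs = ?W" "distinct vs"
    using finite_distinct_list[of ?W] finite_subset[OF WV finite_V] by blast
  have "V - G = (V - ?W) \<union> (E - G)" using WV by blast
  moreover have "finite (E - G)" using WV finite_V by (meson finite_Diff finite_Un finite_subset)
  ultimately have "card (V - G) = card (V - ?W) + card (E - G)"
    using finite_V card_Un_disjoint[of "V - ?W" "E - G"] by auto
  \<comment> \<open>Here the two variables of E - G are needed: they leave room for degree 1 when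
    the test set is E \<union> G and the depth is |V - G|.\<close>
  then have card_W: "1 + int (card (V - set vs)) < int (card (V - G))" using EG(4) vs(1) by simp
  \<comment> \<open>The dimensions increase along the chain, so all factors from \<open>j\<close> on
    have depth at least |V - G|; extensions then carry the vanishing to R / A j.\<close>
  have step: "koszul_vanish (map mvar vs) 1 (A (Suc l)) (A l)" if "j \<le> l" "l < r" for l
  proof -
    have "enat (card (V - G)) \<le> d l"
      using d_idx[OF EG(2)] d_mono[of j l] that by (cases "j = l") (auto simp: j_def)
    then show ?thesis using card_W vs WV by (intro van[OF that(2)]) (simp_all add: d_def)
  qed
  have vsR: "set (map mvar vs) \<subseteq> R" using vs(1) WV mvar_mem by auto
  have Aj: "is_ideal (A j)" using A(1) j by simp
  have "j + n \<le> r \<Longrightarrow> koszul_vanish (map mvar vs) 1 (A (j + n)) (A j)" for n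
  proof (induction n)
    case 0
    show ?case
      unfolding koszul_vanish_def
    proof (intro allI impI exI conjI)
      fix c s assume c: "cochain (map mvar vs) 1 (A (j + 0)) c"
      show "cochain (map mvar vs) (1 - 1) (A (j + 0)) (\<lambda>s. 0)" using cochain_zero[OF A(1)[of j]] j by simp
      show "c s - koszul_d (map mvar vs) (\<lambda>s. 0) s \<in> A j"
        using cochain_mem[OF c] by (simp add: koszul_d_zero)
    qed
  next
    case (Suc n)
    then have le: "Suc (j + n) \<le> r" by simp
    have ideals: "is_ideal (A (Suc (j + n)))" "is_ideal (A (j + n))" using A(1) le by simp_all
    have sub: "A j \<subseteq> A (j + n)" "A (j + n) \<subseteq> A (Suc (j + n))"
      using A_mono[of j "j + n"] A(4)[of "j + n"] le by simp_all
    have v: "koszul_vanish (map mvar vs) 1 (A (Suc (j + n))) (A (j + n))"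
      using le by (intro step) simp_all
    have "koszul_vanish (map mvar vs) 1 (A (j + n)) (A j)" using Suc.IH le by simp
    from koszul_vanish_extension[OF ideals Aj sub vsR v this] show ?case by simp
  qed
  from this[of "r - j"] have van1: "koszul_vanish (map mvar vs) 1 R (A j)" using A(3) j by simp
  let ?z = "squarefree_monomial (V - ?W)"
  have zR: "?z \<in> R" by (rule squarefree_monomial_mem) simp
  have z: "?z \<in> ?P C \<longleftrightarrow> \<not> C \<subseteq> ?W" if "C \<subseteq> V" for C
    using squarefree_monomial_mem_variable_ideal[of "V - ?W" C] that by blast
  \<comment> \<open>A prime of height at most |G| other than those of E and G has a variable outside
    E \<union> G, hence contains \<open>?z\<close>; the primes of E and G contain x and y
    respectively.\<close>
  have key: "y * (?z * x) \<in> A j"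
    if x: "x \<in> ?P E" "x \<in> R" and y: "y \<in> ?P G" "y \<in> R" for x y
  proof -
    have R': "y * (?z * x) \<in> R" using mult_mem zR x(2) y(2) by blast
    have "y * (?z * x) \<in> ?P C" if C: "C \<in> {C \<in> F. idx C \<ge> j}" for C
    proof -
      have "C \<in> F" "card C \<le> card G" using C idx_ge by auto
      then have "C = E \<or> C = G \<or> ?z \<in> ?P C" using other z F(2) by blast
      then show ?thesis
        using prime_mult_iff[OF is_prime_variable_ideal, of y "?z * x" C]
          prime_mult_iff[OF is_prime_variable_ideal, of ?z x C] mult_mem[OF zR x(2)] zR x y by blast
    qed
    then have "\<forall>C\<in>{C \<in> F. idx C \<ge> j}. y * (?z * x) \<in> ?P C" by (rule ballI)
    then have "y * (?z * x) \<in> monomial_ideal {C \<in> F. idx C \<ge> j}"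
      by (rule iffD2[OF monomial_ideal_mem_iff[OF R']])
    then show ?thesis using subsetD[OF shape[of j]] j by simp
  qed
  define m where "m x = (if x \<in> ?P E then ?z * x else 0)" for x
  have mem: "mvar v \<in> ?P C \<longleftrightarrow> v \<in> C" if "v \<in> ?W" for v C
    using mvar_mem_monomial_ideal[of v "{C}"] that WV by auto
  have "m x \<in> R" if "x \<in> set (map mvar vs)" for x
    using that vsR zR mult_mem zero_mem by (auto simp: m_def)
  moreover have "y * m x - x * m y \<in> A j"
    if x: "x \<in> set (map mvar vs)" and y: "y \<in> set (map mvar vs)" for x y
  proof -
    have R': "x \<in> R" "y \<in> R" using x y vsR by auto
    have G: "u \<in> ?P G" if "u \<in> set (map mvar vs)" "u \<notin> ?P E" for u
      using that mem vs(1) by auto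
    consider "x \<in> ?P E" "y \<in> ?P E" | "x \<in> ?P E" "y \<notin> ?P E" | "x \<notin> ?P E" "y \<in> ?P E"
      | "x \<notin> ?P E" "y \<notin> ?P E" by blast
    then show ?thesis
    proof cases
      case 1
      then show ?thesis using ideal_0[OF Aj] by (simp add: m_def mult.left_commute mult.commute)
    next
      case 2
      then show ?thesis using key[of x y] R' G[OF y] by (simp add: m_def)
    next
      case 3
      then show ?thesis using ideal_uminus[OF Aj key[of y x]] R' G[OF x] by (simp add: m_def)
    next
      case 4
      then show ?thesis using ideal_0[OF Aj] by (simp add: m_def)
    qed
  qed
  ultimately obtain a where a: "a \<in> R" "\<And>x. x \<in> set (map mvar vs) \<Longrightarrow> m x - x * a \<in> A j"
    using koszul_vanish_1D[OF ideal_carrier Aj van1, of m] by blast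
  \<comment> \<open>If the cocycle were the coboundary of a, cancelling v modulo the prime of G
    would put z - a into it, and cancelling w modulo the prime of E would put a into that one. Then
    z would lie in the prime of E \<union> G, although it has no variable there.\<close>
  obtain v where v: "v \<in> E" "v \<notin> G" using EG(4) by (metis card.empty DiffE ex_in_conv not_numeral_le_zero)
  obtain w where w: "w \<in> G" "w \<notin> E" using anti[OF EG(2,1)] \<open>E \<noteq> G\<close> by blast
  have vw: "mvar v \<in> R" "mvar w \<in> R" using v w WV mvar_mem by auto
  have zaR: "?z - a \<in> R" using diff_mem[OF zR a(1)] .
  have "m (mvar v) - mvar v * a \<in> A j" using a(2)[of "mvar v"] v vs(1) by auto
  then have "mvar v * (?z - a) \<in> A j"
    using mem[of v E] v by (simp add: m_def right_diff_distrib mult.commute)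
  then have "mvar v * (?z - a) \<in> ?P G" using AG by blast
  then have za: "?z - a \<in> ?P G"
    using prime_mult_iff[OF is_prime_variable_ideal vw(1) zaR, of G] mem[of v G] v by blast
  have "m (mvar w) - mvar w * a \<in> A j" using a(2)[of "mvar w"] w vs(1) by auto
  then have "- (mvar w * a) \<in> A j" using mem[of w E] w by (simp add: m_def)
  then have "mvar w * a \<in> A j" using ideal_uminus[OF Aj, of "- (mvar w * a)"] by simp
  then have "mvar w * a \<in> ?P E" using AE by blast
  then have "a \<in> ?P E"
    using prime_mult_iff[OF is_prime_variable_ideal vw(2) a(1), of E] mem[of w E] w by blast
  then have "a \<in> ?P ?W" "?z - a \<in> ?P ?W" using za variable_ideal_mono[of E ?W] variable_ideal_mono[of G ?W] by auto
  then have "(?z - a) + a \<in> ?P ?W" using ideal_add[OF PI] by blast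
  then show False using z[OF WV] by simp
qed

end


section \<open>A criterion for being sequentially Cohen-Macaulay\<close>

context polynomials
begin

lemma variable_ideal_insert:
  assumes "p \<in> variable_ideal (insert v W)"
  obtains r where "r \<in> R" "p - mvar v * r \<in> variable_ideal W"
proof -
  let ?S = "{t. v \<in> keys t}"
  have pR: "p \<in> R" using assms monomial_ideal_subset by blast
  obtain r where r: "r \<in> R" "restrict_keys ?S p = mvar v * r"
    by (rule divide_by_variable[OF restrict_keys_mem[OF pR], of ?S v]) (auto simp: keys_restrict_keys)
  have "restrict_keys (- ?S) p \<in> variable_ideal W"
    using assms restrict_keys_mem[OF pR] by (auto simp: monomial_ideal_def keys_restrict_keys)
  moreover have "p - restrict_keys ?S p = restrict_keys (- ?S) p"
    by (rule poly_mapping_eqI) (simp add: lookup_minus lookup_restrict_keys)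
  ultimately show thesis using that r by metis
qed

text \<open>Modulo the prime of W each form equals the variable paired with it, so it is a
  nonzerodivisor, and adjoining it gives the prime of W together with this variable.\<close>

lemma weakly_regular_variables:
  assumes "distinct (map fst ps)" "\<And>v f. (v, f) \<in> set ps \<Longrightarrow> v \<in> V - W"
    and "\<And>v f. (v, f) \<in> set ps \<Longrightarrow> f \<in> R \<and> f - mvar v \<in> variable_ideal W"
  shows "weakly_regular (map snd ps) R (variable_ideal W)"
  using assms
proof (induction ps arbitrary: W)
  case (Cons p ps)
  obtain v f where p: "p = (v, f)" by (cases p)
  let ?P = "variable_ideal W"
  note I = is_ideal_monomial_ideal[of "{W}"]
  have v: "v \<in> V" "v \<notin> W" using Cons.prems(2)[of v f] p by auto
  have f: "f \<in> R" "f - mvar v \<in> ?P" using Cons.prems(3)[of v f] p by auto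
  have vR: "mvar v \<in> R" using mvar_mem[OF v(1)] .
  have vW: "mvar v \<notin> ?P" using mvar_mem_monomial_ideal[OF v(1), of "{W}"] v(2) by simp
  have nz: "a \<in> ?P" if a: "a \<in> R" "f * a \<in> ?P" for a
  proof -
    have "f * a - a * (f - mvar v) \<in> ?P" using ideal_diff[OF I a(2) ideal_mult[OF I a(1) f(2)]] .
    then have "mvar v * a \<in> ?P" by (simp add: algebra_simps)
    then show ?thesis using prime_mult_iff[OF is_prime_variable_ideal vR a(1), of W] vW by blast
  qed
  let ?P' = "variable_ideal (insert v W)"
  note I' = is_ideal_monomial_ideal[of "{insert v W}"]
  have sub: "?P \<subseteq> ?P'" by (rule variable_ideal_mono) blast
  have "ideal_sum ?P f R = ?P'"
  proof (intro equalityI subsetI)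
    fix x assume "x \<in> ideal_sum ?P f R"
    then obtain b a where x: "b \<in> ?P" "a \<in> R" "x = b + f * a" by (auto elim: ideal_sumE)
    have "mvar v \<in> ?P'" using mvar_mem_monomial_ideal[OF v(1), of "{insert v W}"] by simp
    then have "(f - mvar v) + mvar v \<in> ?P'" using ideal_add[OF I'] f(2) sub by blast
    then have "f \<in> ?P'" by simp
    then have "a * f \<in> ?P'" using ideal_mult[OF I' x(2)] by blast
    then show "x \<in> ?P'" using ideal_add[OF I', of b "a * f"] x sub by (auto simp: mult.commute)
  next
    fix x assume "x \<in> ?P'"
    then obtain r where r: "r \<in> R" "x - mvar v * r \<in> ?P" by (rule variable_ideal_insert)
    have "(x - mvar v * r) - r * (f - mvar v) \<in> ?P"
      using ideal_diff[OF I r(2) ideal_mult[OF I r(1) f(2)]] .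
    moreover have "x = ((x - mvar v * r) - r * (f - mvar v)) + f * r" by (simp add: algebra_simps)
    ultimately show "x \<in> ideal_sum ?P f R" using ideal_sumI r(1) by metis
  qed
  moreover have "weakly_regular (map snd ps) R ?P'"
  proof (rule Cons.IH)
    show "distinct (map fst ps)" using Cons.prems(1) by simp
    show "u \<in> V - insert v W" if "(u, g) \<in> set ps" for u g
    proof -
      have "u \<in> fst ` set ps" using that by force
      then have "u \<noteq> v" using Cons.prems(1) p by auto
      then show ?thesis using Cons.prems(2)[of u g] that by simp
    qed
    show "g \<in> R \<and> g - mvar u \<in> ?P'" if "(u, g) \<in> set ps" for u g
      using Cons.prems(3)[of u g] that sub by auto
  qed
  ultimately show ?case using p nz by simp
qed simp

lemma sorted_takeWhile:
  assumes "\<And>i j. i \<le> j \<Longrightarrow> j < length Cs \<Longrightarrow> P (Cs ! j) \<Longrightarrow> P (Cs ! i)"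
  shows "set (takeWhile P Cs) = {C \<in> set Cs. P C}"
proof (intro equalityI subsetI)
  fix C assume "C \<in> {C \<in> set Cs. P C}"
  then obtain j where j: "j < length Cs" "C = Cs ! j" "P (Cs ! j)" by (auto simp: in_set_conv_nth)
  let ?n = "length (takeWhile P Cs)"
  have "j < ?n"
  proof (rule ccontr)
    assume "\<not> j < ?n"
    then show False using assms[of ?n j] j nth_length_takeWhile[of P Cs] by simp
  qed
  then show "C \<in> set (takeWhile P Cs)" using j takeWhile_nth nth_mem by metis
qed (auto dest: set_takeWhileD)

text \<open>Multiplication by w is an isomorphism from R modulo the prime of C onto the quotient of
  the two intersections.\<close>

lemma weakly_regular_linear_quotients:
  assumes w: "w \<in> R" "w \<in> monomial_ideal F" "w \<notin> variable_ideal C"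
    and onto: "\<And>p. p \<in> monomial_ideal F \<Longrightarrow> \<exists>r\<in>R. p - w * r \<in> variable_ideal C"
    and fs: "set fs \<subseteq> R" "weakly_regular fs R (variable_ideal C)"
  shows "weakly_regular fs (monomial_ideal F) (monomial_ideal (insert C F))"
proof (rule weakly_regular_transport[OF ideal_carrier is_ideal_monomial_ideal is_ideal_monomial_ideal
      is_ideal_monomial_ideal w(1) fs(1) _ _ _ fs(2)])
  note I = is_ideal_monomial_ideal
  show wa: "w * a \<in> monomial_ideal F" if "a \<in> R" for a
    using ideal_mult[OF I that w(2)] by (simp only: mult.commute)
  have ins: "p \<in> monomial_ideal (insert C F) \<longleftrightarrow> p \<in> variable_ideal C \<and> p \<in> monomial_ideal F" for p
    by (auto simp: monomial_ideal_def)
  show "\<exists>a\<in>R. p - w * a \<in> monomial_ideal (insert C F)" if p: "p \<in> monomial_ideal F" for p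
  proof -
    obtain r where r: "r \<in> R" "p - w * r \<in> variable_ideal C" using onto[OF p] by blast
    then show ?thesis using ins ideal_diff[OF I p wa[OF r(1)]] by blast
  qed
  show "w * a \<in> monomial_ideal (insert C F) \<longleftrightarrow> a \<in> variable_ideal C" if "a \<in> R" for a
    using ins wa[OF that] prime_mult_iff[OF is_prime_variable_ideal w(1) that] w(3) by blast
qed

text \<open>Nakayama for monomial ideals. A monomial \<open>t0\<close> of least degree that lies in
  the larger ideal but not in the smaller one cannot be reached: multiplying by an element without
  constant term gives terms of degree above that of \<open>t0\<close>, or terms already in the
  smaller ideal. The ideal \<open>C\<close> collects such elements.\<close>

lemma fold_sum_proper:
  assumes FG: "monomial_ideal F \<subseteq> monomial_ideal G" "monomial_ideal F \<noteq> monomial_ideal G"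
    and fs: "set fs \<subseteq> variable_ideal V"
  shows "fold_sum (monomial_ideal G) (monomial_ideal F) fs \<noteq> monomial_ideal G"
proof -
  define hits where "hits F t \<longleftrightarrow> keys t \<subseteq> V \<and> (\<forall>C\<in>F. keys t \<inter> C \<noteq> {})" for F and t :: "'v \<Rightarrow>\<^sub>0 nat"
  have mem: "p \<in> monomial_ideal F \<longleftrightarrow> (\<forall>t\<in>keys p. hits F t)" for p F
    by (auto simp: monomial_ideal_def mem_R hits_def)
  have hits_add: "hits F (s + t)" if "keys s \<subseteq> V" "hits F t" for F s t
    using that by (auto simp: hits_def keys_add_nat)
  obtain p where "p \<in> monomial_ideal G" "p \<notin> monomial_ideal F" using FG by blast
  then have "\<exists>t. hits G t \<and> \<not> hits F t" unfolding mem by blast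
  then obtain t0 where t0: "hits G t0" "\<not> hits F t0"
    "\<And>t. hits G t \<Longrightarrow> \<not> hits F t \<Longrightarrow> monom_deg t0 \<le> monom_deg t"
    using exists_least_iff[of "\<lambda>n. \<exists>t. monom_deg t = n \<and> hits G t \<and> \<not> hits F t"] by (metis not_le)
  define C where "C = {p \<in> monomial_ideal G. \<forall>t\<in>keys p. hits F t \<or> monom_deg t0 < monom_deg t}"
  have CI: "is_ideal C"
  proof (rule is_idealI)
    show "C \<subseteq> R" using monomial_ideal_subset by (auto simp: C_def)
    show "0 \<in> C" by (simp add: C_def ideal_0[OF is_ideal_monomial_ideal])
    show "a + b \<in> C" if "a \<in> C" "b \<in> C" for a b
      using that ideal_add[OF is_ideal_monomial_ideal[of G], of a b] keys_add[of a b]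
      unfolding C_def by blast
    show "r * a \<in> C" if r: "r \<in> R" and a: "a \<in> C" for r a
    proof -
      have "hits F u \<or> monom_deg t0 < monom_deg u" if "u \<in> keys (r * a)" for u
      proof -
        from that obtain s t where st: "s \<in> keys r" "t \<in> keys a" "u = s + t" by (rule keys_mult_obtain)
        have "keys s \<subseteq> V" using r st(1) by (simp add: mem_R)
        then show ?thesis
          using a st hits_add[of s F t] monom_deg_add[of s t] by (auto simp: C_def)
      qed
      moreover have "r * a \<in> monomial_ideal G"
        using a ideal_mult[OF is_ideal_monomial_ideal r] by (simp add: C_def)
      ultimately show ?thesis by (simp add: C_def)
    qed
  qed
  have FC: "monomial_ideal F \<subseteq> C"
  proof
    fix p assume p: "p \<in> monomial_ideal F"
    then have "\<forall>t\<in>keys p. hits F t" unfolding mem .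
    then show "p \<in> C" using subsetD[OF FG(1) p] by (simp add: C_def)
  qed
  have fC: "\<forall>f\<in>set fs. \<forall>a\<in>monomial_ideal G. f * a \<in> C"
  proof (intro ballI)
    fix f a assume f: "f \<in> set fs" and a: "a \<in> monomial_ideal G"
    have fV: "f \<in> variable_ideal V" using f fs by blast
    then have fR: "f \<in> R" using monomial_ideal_subset by blast
    have "hits F u \<or> monom_deg t0 < monom_deg u" if "u \<in> keys (f * a)" for u
    proof -
      from that obtain s t where st: "s \<in> keys f" "t \<in> keys a" "u = s + t" by (rule keys_mult_obtain)
      have s: "keys s \<subseteq> V" "keys s \<inter> V \<noteq> {}" using fV fR st(1) by (auto simp: mem_R monomial_ideal_def)
      then have "monom_deg s \<noteq> 0" by (auto simp: monom_deg_def in_keys_iff)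
      moreover have "hits G t" using a st(2) mem by blast
      ultimately show ?thesis
        using st(3) hits_add[OF s(1), of F t] t0(3)[of t] monom_deg_add[of s t] by fastforce
    qed
    moreover have "f * a \<in> monomial_ideal G" using ideal_mult[OF is_ideal_monomial_ideal fR a] .
    ultimately show "f * a \<in> C" by (simp add: C_def)
  qed
  have fsR: "set fs \<subseteq> R" using fs monomial_ideal_subset by (rule order_trans)
  have "fold_sum (monomial_ideal G) (monomial_ideal F) fs \<subseteq> C"
    using fold_sum_ideal[OF is_ideal_monomial_ideal is_ideal_monomial_ideal FG(1) fsR] CI FC fC by simp
  moreover have "single t0 1 \<in> monomial_ideal G" "single t0 1 \<notin> C"
    using t0(1,2) mem by (simp_all add: C_def)
  ultimately show ?thesis by blast
qed

text \<open>A monomial ideal contains the terms of its elements, and terms are homogeneous.\<close>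

lemma graded_submodule_monomial_ideal:
  assumes P: "presents M R J \<sigma>" and J: "J \<subseteq> monomial_ideal F"
  shows "graded_submodule (\<sigma> ` monomial_ideal F) (set_ring R) M (\<lambda>d. \<sigma> ` poly_grading V d)"
  unfolding graded_submodule_def
proof (intro conjI)
  let ?A = "monomial_ideal F"
  note A = is_ideal_monomial_ideal[of F] monomial_ideal_subset[of F]
  show "submodule (\<sigma> ` ?A) (set_ring R) M" using presents_submodule_image[OF P A] .
  show "\<sigma> ` ?A = span_submodule (set_ring R) M (\<sigma> ` ?A \<inter> (\<Union>d. \<sigma> ` poly_grading V d))"
  proof (rule presents_span[OF P A(1) J A(2), symmetric])
    fix C' assume C': "is_ideal C'" "J \<subseteq> C'" "C' \<subseteq> R"
      "\<sigma> ` ?A \<inter> (\<Union>d. \<sigma> ` poly_grading V d) \<subseteq> \<sigma> ` C'"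
    show "?A \<subseteq> C'"
    proof
      fix p assume p: "p \<in> ?A"
      show "p \<in> C'"
      proof (rule poly_induct_single)
        show "single t (lookup p t) \<in> C'" if t: "t \<in> keys p" for t
        proof -
          let ?q = "single t (lookup p t)"
          have q: "?q \<in> ?A" using p t by (simp add: monomial_ideal_def mem_R)
          then have qR: "?q \<in> R" using A(2) by blast
          then have "?q \<in> poly_grading V (monom_deg t)"
            by (simp add: poly_grading_def poly_ring_eq R_eq)
          then have "\<sigma> ?q \<in> \<sigma> ` C'" using q C'(4) by blast
          then show ?thesis using presents_image_mem[OF P C'(1-3) qR] by simp
        qed
      qed (use ideal_0[OF C'(1)] ideal_add[OF C'(1)] in auto)
    qed
  qed blast
qed

text \<open>
  The filtration is by the intersections of the primes of height below a bound. Its factors have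
  filtrations with factors \<open>R / P\<close>, as adding the next prime \<open>P\<close> of the list to the intersection
  of the previous ones has a factor generated, modulo \<open>P\<close>, by the single variable \<open>x\<close>.
\<close>

theorem seq_cohen_macaulay_idealI:
  fixes Cs :: "'v set list"
  assumes V: "\<And>C. C \<in> set Cs \<Longrightarrow> C \<subseteq> V"
    and anti: "\<And>C C'. C \<in> set Cs \<Longrightarrow> C' \<in> set Cs \<Longrightarrow> C \<subseteq> C' \<Longrightarrow> C = C'"
    and sorted: "\<And>i j. i \<le> j \<Longrightarrow> j < length Cs \<Longrightarrow> card (Cs ! i) \<le> card (Cs ! j)"
    and linear: "\<And>t. 0 < t \<Longrightarrow> t < length Cs \<Longrightarrow>
      \<exists>x\<in>V. x \<notin> Cs ! t \<and> (\<forall>s<t. x \<in> Cs ! s) \<and> (\<exists>s<t. Cs ! s \<subseteq> insert x (Cs ! t))"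
    and regular: "\<And>h. h \<in> card ` set Cs \<Longrightarrow> \<exists>fs. length fs = card V - h \<and>
      set fs \<subseteq> irrelevant \<and>
      (\<forall>C\<in>set Cs. card C = h \<longrightarrow> weakly_regular fs R (variable_ideal C))"
  shows "seq_cohen_macaulay_ideal V (monomial_ideal (set Cs))"
proof -
  let ?F = "set Cs"
  let ?J = "monomial_ideal ?F"
  let ?M = "quot_module (ring_module (set_ring R)) ?J" and ?\<sigma> = "\<lambda>p. ?J +>\<^bsub>set_ring R\<^esub> p"
  note I = is_ideal_monomial_ideal
  have P: "presents ?M R ?J ?\<sigma>" using presents_quotient_ring[OF I] .
  have pr: "poly_ring V = set_ring R" by (simp add: poly_ring_eq R_eq)
  \<comment> \<open>The heights are listed in decreasing order, as the dimensions of the factors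
    have to increase.\<close>
  obtain hs where hs: "set hs = card ` ?F" "sorted_wrt (>) hs"
  proof -
    have "sorted_wrt (<) (sorted_list_of_set (card ` ?F))" by simp
    then have "sorted_wrt (>) (rev (sorted_list_of_set (card ` ?F)))" by (simp add: sorted_wrt_rev)
    then show thesis using that[of "rev (sorted_list_of_set (card ` ?F))"] by simp
  qed
  define r where "r = length hs"
  have hs_less: "hs ! j < hs ! i" if "i < j" "j < r" for i j
    using sorted_wrt_nth_less[OF hs(2) that(1)] that(2) by (simp add: r_def)
  \<comment> \<open>The bound is a condition on all earlier heights, so that i = 0 gives the whole
    family and i = r the empty one.\<close>
  define G where "G i = {C \<in> ?F. \<forall>l<i. card C < hs ! l}" for i
  define A where "A i = monomial_ideal (G i)" for i
  define N where "N i = ?\<sigma> ` A i" for i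
  have G_Suc: "G (Suc i) = {C \<in> ?F. card C < hs ! i}" if "i < r" for i
    using hs_less[of _ i] that by (auto simp: G_def less_Suc_eq intro: less_trans)
  have G_le: "G i = {C \<in> ?F. card C \<le> hs ! i}" if i: "i < r" for i
  proof (intro equalityI subsetI)
    fix C assume C: "C \<in> G i"
    then obtain j where j: "j < r" "card C = hs ! j" using hs(1) by (auto simp: G_def r_def in_set_conv_nth image_iff) (metis imageI in_set_conv_nth)
    have "\<not> j < i" using C j by (auto simp: G_def)
    then have "hs ! j \<le> hs ! i" using hs_less[of i j] j(1) by (cases "i = j") auto
    then show "C \<in> {C \<in> ?F. card C \<le> hs ! i}" using C j by (simp add: G_def)
  next
    fix C assume "C \<in> {C \<in> ?F. card C \<le> hs ! i}"
    then show "C \<in> G i" using hs_less[of _ i] i by (auto simp: G_def intro: le_less_trans)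
  qed
  have G_mono: "G (Suc i) \<subseteq> G i" for i by (auto simp: G_def)
  have GF: "G i \<subseteq> ?F" for i by (auto simp: G_def)
  have AI: "is_ideal (A i)" for i unfolding A_def by (rule I)
  have AR: "A i \<subseteq> R" for i unfolding A_def by (rule monomial_ideal_subset)
  have JA: "?J \<subseteq> A i" for i unfolding A_def by (rule monomial_ideal_antimono[OF GF])
  have A_mono: "A i \<subseteq> A (Suc i)" for i unfolding A_def by (rule monomial_ideal_antimono[OF G_mono])
  have A_0: "A 0 = ?J" by (simp add: A_def G_def)
  have A_r: "A r = R"
  proof -
    have "C \<notin> G r" for C
    proof
      assume C: "C \<in> G r"
      then have "card C \<in> set hs" using hs(1) by (auto simp: G_def)
      then show False using C by (auto simp: G_def r_def in_set_conv_nth)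
    qed
    then have "G r = {}" by blast
    then show ?thesis by (simp add: A_def monomial_ideal_empty)
  qed
  let ?Q = "\<lambda>i. quot_module (?M\<lparr>carrier := N (Suc i)\<rparr>) (N i)"
  have main: "N i \<subset> N (Suc i) \<and> module_dim (set_ring R) (?Q i) = enat (card V - hs ! i) \<and>
      depth (set_ring R) (irrelevant) (?Q i) = enat (card V - hs ! i)"
    if i: "i < r" for i
  proof -
    let ?h = "hs ! i"
    let ?d = "card V - ?h"
    have hF: "?h \<in> card ` ?F" using hs(1) i nth_mem by (auto simp: r_def)
    then obtain C where C: "C \<in> ?F" "card C = ?h" by auto
    have CG: "C \<in> G i" using G_le[OF i] C by simp
    have cardVC: "card (V - C') = ?d" if "C' \<in> ?F" "card C' = ?h" for C'
      using V[OF that(1)] that(2) by (simp add: card_Diff_subset finite_subset finite_V)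
    have AP: "A i \<subseteq> variable_ideal C" using monomial_ideal_antimono[of "{C}" "G i"] CG by (simp add: A_def)
    let ?z = "squarefree_monomial (V - C)"
    have zR: "?z \<in> R" by (rule squarefree_monomial_mem) simp
    have z: "?z \<in> variable_ideal C' \<longleftrightarrow> C' \<noteq> C" if "C' \<in> ?F" for C'
      using squarefree_monomial_mem_variable_ideal[of "V - C" C'] anti[OF that C(1)] V[OF that] by blast
    have zA: "?z \<in> A (Suc i)"
    proof -
      have "\<forall>C'\<in>G (Suc i). ?z \<in> variable_ideal C'"
        using G_Suc[OF i] z C(2) by auto
      then show ?thesis unfolding A_def by (rule iffD2[OF monomial_ideal_mem_iff[OF zR]])
    qed
    have zC: "?z \<notin> variable_ideal C" using z[OF C(1)] by simp
    then have zA': "?z \<notin> A i" using AP by blast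
    have ne: "A i \<noteq> A (Suc i)" using zA zA' by blast
    have 1: "N i \<subset> N (Suc i)"
      using A_mono[of i] zA zA' presents_image_mem[OF P AI JA AR zR, of i] unfolding N_def by blast
    have "presents (?M\<lparr>carrier := ?\<sigma> ` A (Suc i)\<rparr>) (A (Suc i)) ?J ?\<sigma>"
      by (rule presents_carrier[OF P AI JA AR])
    from presents_quot_module[OF this AI JA A_mono] obtain \<tau> where
      Q: "presents (?Q i) (A (Suc i)) (A i) \<tau>" unfolding N_def by blast
    \<comment> \<open>The annihilator of the factor contains the intersection of the primes of
      height h and is contained in one of them, the prime of \<open>C\<close>.\<close>
    have 2: "module_dim (set_ring R) (?Q i) = enat ?d"
    proof (rule antisym)
      have CI: "is_ideal (colon (A i) (A (Suc i)))" using is_ideal_colon[OF AI AR] .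
      let ?F' = "{C \<in> ?F. card C = ?h}"
      have "monomial_ideal ?F' \<subseteq> colon (A i) (A (Suc i))"
      proof
        fix p assume p: "p \<in> monomial_ideal ?F'"
        then have pR: "p \<in> R" using monomial_ideal_subset by blast
        have "p * a \<in> A i" if a: "a \<in> A (Suc i)" for a
        proof -
          have aR: "a \<in> R" using a AR by blast
          have "p * a \<in> monomial_ideal (G (Suc i))" using ideal_mult[OF I pR] a by (simp add: A_def)
          moreover have "p * a \<in> monomial_ideal ?F'" using ideal_mult[OF I aR p] by (simp only: mult.commute)
          moreover have "G i = G (Suc i) \<union> ?F'" using G_Suc[OF i] G_le[OF i] by auto
          ultimately show ?thesis by (auto simp: A_def monomial_ideal_def)
        qed
        then show "p \<in> colon (A i) (A (Suc i))" using pR by (simp add: colon_def)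
      qed
      then show "module_dim (set_ring R) (?Q i) \<le> enat ?d"
        unfolding presents_module_dim[OF Q]
        by (rule krull_dim_monomial_le[OF CI]) (use V cardVC in auto)
      have "colon (A i) (A (Suc i)) \<subseteq> variable_ideal C"
      proof
        fix x assume x: "x \<in> colon (A i) (A (Suc i))"
        then have "x \<in> R" "x * ?z \<in> variable_ideal C" using zA AP by (auto simp: colon_def)
        then show "x \<in> variable_ideal C"
          using prime_mult_iff[OF is_prime_variable_ideal _ zR, of x C] zC by blast
      qed
      then show "enat ?d \<le> module_dim (set_ring R) (?Q i)"
        unfolding presents_module_dim[OF Q]
        using variable_ideal_chain[OF V[OF C(1)] CI] cardVC[OF C] by simp
    qed
    \<comment> \<open>The variables of \<open>C\<close> kill \<open>?z\<close> modulo
      \<open>A i\<close>, although \<open>?z\<close> is not in \<open>A i\<close>. This nonzero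
      class in degree 0 bounds the depth.\<close>
    have 3: "depth (set_ring R) (irrelevant) (?Q i) \<le> enat ?d"
    proof (rule ccontr)
      assume "\<not> ?thesis"
      then have big: "enat (Suc ?d) \<le> depth (set_ring R) (irrelevant) (?Q i)"
        by (simp add: Suc_ile_eq not_le)
      obtain vs where vs: "set vs = C" "distinct vs"
        using finite_distinct_list[of C] finite_subset[OF V[OF C(1)] finite_V] by blast
      have "koszul_vanish (map mvar vs) 0 (A (Suc i)) (A i)"
        using V[OF C(1)] cardVC[OF C] vs
        by (intro koszul_vanish_depth[OF Q _ _ big]) (simp_all add: A_def truncation_closed_monomial_ideal)
      moreover have "x * ?z \<in> A i" if x: "x \<in> set (map mvar vs)" for x
      proof -
        obtain v where v: "v \<in> C" "x = mvar v" using x vs(1) by auto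
        have vV: "v \<in> V" using v V[OF C(1)] by blast
        have xC: "x \<in> variable_ideal C" using mvar_mem_monomial_ideal[OF vV, of "{C}"] v by simp
        have xR: "x \<in> R" using mvar_mem[OF vV] v by simp
        have "\<forall>C'\<in>G i. x * ?z \<in> variable_ideal C'"
          using prime_mult_iff[OF is_prime_variable_ideal xR zR] xC z GF by blast
        then show ?thesis unfolding A_def by (rule iffD2[OF monomial_ideal_mem_iff[OF mult_mem[OF xR zR]]])
      qed
      ultimately have "?z \<in> A i" using koszul_vanish_0D[OF AI AI _ zA] by blast
      then show False using zA' by simp
    qed
    have 4: "enat ?d \<le> depth (set_ring R) (irrelevant) (?Q i)"
    proof -
      obtain fs where fs: "length fs = ?d" "set fs \<subseteq> irrelevant"
        "\<And>C. C \<in> ?F \<Longrightarrow> card C = ?h \<Longrightarrow> weakly_regular fs R (variable_ideal C)"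
        using regular[OF hF] by blast
      have fsV: "set fs \<subseteq> variable_ideal V" using fs(2) irrelevant_ideal_subset by (rule order_trans)
      then have fsR: "set fs \<subseteq> R" using monomial_ideal_subset by (rule order_trans)
      \<comment> \<open>As the list is sorted by height, the primes of height h are those at
        positions from \<open>?a\<close> to \<open>?b\<close> - 1; they are added one at a
        time.\<close>
      let ?a = "length (takeWhile (\<lambda>C. card C < ?h) Cs)"
      let ?b = "length (takeWhile (\<lambda>C. card C \<le> ?h) Cs)"
      let ?K = "\<lambda>t. monomial_ideal (set (take t Cs))"
      have "set (takeWhile (\<lambda>C. card C < ?h) Cs) = G (Suc i)"
        unfolding G_Suc[OF i] by (rule sorted_takeWhile) (meson sorted le_less_trans)
      then have Ka: "?K ?a = A (Suc i)" by (simp add: A_def takeWhile_eq_take[symmetric])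
      have "set (takeWhile (\<lambda>C. card C \<le> ?h) Cs) = G i"
        unfolding G_le[OF i] by (rule sorted_takeWhile) (meson sorted order_trans)
      then have Kb: "?K ?b = A i" by (simp add: A_def takeWhile_eq_take[symmetric])
      have mid: "Cs ! t \<in> ?F \<and> card (Cs ! t) = ?h" if "?a \<le> t" "t < ?b" for t
      proof -
        have t: "t < length Cs" using that(2) length_takeWhile_le[of "\<lambda>C. card C \<le> ?h" Cs] by simp
        have "\<not> card (Cs ! ?a) < ?h"
          using nth_length_takeWhile[of "\<lambda>C. card C < ?h" Cs] that(1) t by simp
        then have "?h \<le> card (Cs ! t)" using sorted[OF that(1) t] by simp
        moreover have "card (Cs ! t) \<le> ?h"
          using that(2) takeWhile_nth[OF that(2)] nth_mem[OF that(2)] set_takeWhileD by metis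
        ultimately show ?thesis using t by simp
      qed
      have ab: "?a \<le> ?b"
      proof (rule ccontr)
        assume "\<not> ?a \<le> ?b"
        then have lt: "?b < ?a" by simp
        then have "card (Cs ! ?b) < ?h"
          using takeWhile_nth[OF lt] nth_mem[OF lt] set_takeWhileD by metis
        moreover have "?b < length Cs" using lt length_takeWhile_le[of "\<lambda>C. card C < ?h" Cs] by simp
        ultimately show False using nth_length_takeWhile[of "\<lambda>C. card C \<le> ?h" Cs] by simp
      qed
      have "?a + n \<le> ?b \<Longrightarrow> weakly_regular fs (?K ?a) (?K (?a + n))" for n
      proof (induction n)
        case 0
        have "weakly_regular gs B B" if "is_ideal B" "set gs \<subseteq> R" for gs B
          using that
        proof (induction gs)
          case (Cons g gs)
          have "ideal_sum B g B = B"
            using ideal_sum_superset[OF Cons.prems(1), of _ B g] ideal_add[OF Cons.prems(1)]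
              ideal_mult[OF Cons.prems(1), of g] Cons.prems(2) by (fastforce simp: ideal_sum_def)
          then show ?case using Cons by simp
        qed simp
        then show ?case using I fsR by simp
      next
        case (Suc n)
        let ?t = "?a + n"
        let ?C = "Cs ! ?t"
        have t: "?t < ?b" "?t < length Cs"
          using Suc.prems length_takeWhile_le[of "\<lambda>C. card C \<le> ?h" Cs] by simp_all
        have C': "?C \<in> ?F" "card ?C = ?h" using mid[of ?t] t by auto
        have ins: "set (take (Suc ?t) Cs) = insert ?C (set (take ?t Cs))"
          using t by (simp add: take_Suc_conv_app_nth)
        have "\<exists>w\<in>R. w \<in> ?K ?t \<and> w \<notin> variable_ideal ?C \<and>
            (\<forall>p\<in>?K ?t. \<exists>r\<in>R. p - w * r \<in> variable_ideal ?C)"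
        \<comment> \<open>At the head of the list the preceding intersection is empty, hence the
          whole ring, and 1 takes the role of the variable.\<close>
        proof (cases "?t = 0")
          case True
          have one: "1 \<notin> variable_ideal ?C" using is_prime_variable_ideal[of ?C] by (simp add: is_prime_def)
          have K: "?K ?t = R" unfolding True by (simp add: monomial_ideal_empty)
          have "\<exists>r\<in>R. p - 1 * r \<in> variable_ideal ?C" if "p \<in> R" for p
            using that ideal_0[OF I] by (intro bexI[of _ p]) simp_all
          then show ?thesis unfolding K using one one_mem by blast
        next
          case False
          then obtain x s where x: "x \<in> V" "x \<notin> ?C" "\<forall>s<?t. x \<in> Cs ! s"
            "s < ?t" "Cs ! s \<subseteq> insert x ?C"
            using linear[of ?t] t by auto
          have "x \<in> C''" if "C'' \<in> set (take ?t Cs)" for C''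
            using that x(3) by (auto simp: in_set_conv_nth)
          then have xK: "mvar x \<in> ?K ?t" using mvar_mem_monomial_ideal[OF x(1)] by blast
          have xC: "mvar x \<notin> variable_ideal ?C" using mvar_mem_monomial_ideal[OF x(1), of "{?C}"] x(2) by simp
          have "\<exists>r\<in>R. p - mvar x * r \<in> variable_ideal ?C" if p: "p \<in> ?K ?t" for p
          proof -
            have "Cs ! s \<in> set (take ?t Cs)" using x(4) t by (auto simp: in_set_conv_nth)
            then have "p \<in> variable_ideal (Cs ! s)" using p by (auto simp: monomial_ideal_def)
            then have "p \<in> variable_ideal (insert x ?C)" using variable_ideal_mono[OF x(5)] by blast
            then show ?thesis using variable_ideal_insert by blast
          qed
          then show ?thesis using mvar_mem[OF x(1)] xK xC by blast
        qed
        then obtain w where w: "w \<in> R" "w \<in> ?K ?t" "w \<notin> variable_ideal ?C"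
          "\<And>p. p \<in> ?K ?t \<Longrightarrow> \<exists>r\<in>R. p - w * r \<in> variable_ideal ?C" by blast
        have "weakly_regular fs (?K ?t) (?K (Suc ?t))"
          unfolding ins using weakly_regular_linear_quotients[OF w fsR fs(3)[OF C']] .
        moreover have "weakly_regular fs (?K ?a) (?K ?t)" using Suc by simp
        moreover have "?K (Suc ?t) \<subseteq> ?K ?t" "?K ?t \<subseteq> ?K ?a"
          by (rule monomial_ideal_antimono, rule set_take_subset_set_take, simp)+
        ultimately have "weakly_regular fs (?K ?a) (?K (Suc ?t))"
          using weakly_regular_extension[OF I I I _ _ fsR] by blast
        then show ?case by simp
      qed
      from this[of "?b - ?a"] have wr: "weakly_regular fs (A (Suc i)) (A i)" using ab Ka Kb by simp
      have "fold_sum (A (Suc i)) (A i) fs \<noteq> A (Suc i)"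
        unfolding A_def by (rule fold_sum_proper[OF _ _ fsV]) (use A_mono ne in \<open>simp_all add: A_def\<close>)
      then have "regular_sequence (set_ring R) (?Q i) fs"
        using presents_regular_sequence[OF Q] wr fsR by simp
      then have "enat (length fs) \<le> depth (set_ring R) (irrelevant) (?Q i)"
        unfolding depth_def using fs(2) by (intro Sup_upper) blast
      then show ?thesis using fs(1) by simp
    qed
    show ?thesis using 1 2 antisym[OF 3 4] by blast
  qed
  have dims: "module_dim (set_ring R) (?Q i) < module_dim (set_ring R) (?Q (Suc i))" if i: "Suc i < r" for i
  proof -
    have "hs ! i \<in> card ` ?F" using hs(1) i nth_mem by (auto simp: r_def)
    then have "hs ! i \<le> card V" using V card_mono[OF finite_V] by auto
    then show ?thesis using main[of i] main[of "Suc i"] hs_less[of i "Suc i"] i by simp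
  qed
  have "N 0 = {\<zero>\<^bsub>?M\<^esub>}"
    using presents_eq_zero[OF P] ideal_0[OF I[of ?F]] monomial_ideal_subset[of ?F]
    unfolding N_def A_0 by (auto simp: image_iff)
  moreover have "N r = carrier ?M" using presentsD(4)[OF P] by (simp add: N_def A_r)
  moreover have "\<forall>i\<le>r. graded_submodule (N i) (set_ring R) ?M (\<lambda>d. ?\<sigma> ` poly_grading V d)"
    using graded_submodule_monomial_ideal[OF P] JA unfolding N_def A_def by blast
  ultimately show ?thesis
    unfolding seq_cohen_macaulay_ideal_def seq_cohen_macaulay_def Let_def cohen_macaulay_def pr
    using main dims by (intro exI[of _ r] exI[of _ N]) (simp add: pr)
qed

end


section \<open>Vertex covers of Ferrers graphs\<close>

text \<open>
  The library makes polynomial rings integral domains only for linearly ordered variables; the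
  choice of the order is irrelevant.
\<close>

fun ferrers_var_code :: "ferrers_var \<Rightarrow> nat" where
  "ferrers_var_code (XVar i) = 2 * i"
| "ferrers_var_code (YVar j) = 2 * j + 1"

lemma ferrers_var_code_inject: "ferrers_var_code a = ferrers_var_code b \<longleftrightarrow> a = b"
  by (cases a; cases b) (simp_all, presburger+)

instantiation ferrers_var :: linorder
begin

definition "a \<le> b \<longleftrightarrow> ferrers_var_code a \<le> ferrers_var_code b"
definition "a < b \<longleftrightarrow> ferrers_var_code a < ferrers_var_code b"

instance
  by standard (auto simp: less_eq_ferrers_var_def less_ferrers_var_def ferrers_var_code_inject[symmetric])

end

locale ferrers_shape =
  fixes lam :: "nat list"
  assumes partition: "is_partition lam"
begin

abbreviation "n \<equiv> length lam"
abbreviation "m \<equiv> part lam 1"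
abbreviation "V \<equiv> ferrers_vars lam"

text \<open>The level 0 belongs to the cover by all x_i, the largest level to the cover by all
  y_j.\<close>

definition levels :: "nat set" where
  "levels = insert 0 (set lam)"

definition rows :: "nat \<Rightarrow> nat set" where
  "rows v = {i \<in> {1..n}. v < part lam i}"

definition mult :: "nat \<Rightarrow> nat" where
  "mult v = card {i \<in> {1..n}. part lam i = v}"

text \<open>For \<open>v\<close> in \<^term>\<open>levels\<close> these are the minimal vertex covers of the Ferrers graph.\<close>

definition cover :: "nat \<Rightarrow> ferrers_var set" where
  "cover v = XVar ` rows v \<union> YVar ` {1..v}"

definition height :: "nat \<Rightarrow> nat" where
  "height v = card (rows v) + v"

lemma part_antimono: "1 \<le> i \<Longrightarrow> i \<le> j \<Longrightarrow> j \<le> n \<Longrightarrow> part lam j \<le> part lam i"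
proof (cases "i = j")
  case False
  moreover assume "1 \<le> i" "i \<le> j" "j \<le> n"
  moreover have "sorted_wrt (\<ge>) lam" using partition by (simp add: is_partition_def)
  ultimately show ?thesis
    using sorted_wrt_nth_less[of "(\<ge>)" lam "i - 1" "j - 1"] by (simp add: part_def)
qed simp

lemma part_mem: "i \<in> {1..n} \<Longrightarrow> part lam i \<in> set lam"
  by (auto simp: part_def)

lemma set_lam: "v \<in> set lam \<longleftrightarrow> (\<exists>i\<in>{1..n}. part lam i = v)"
proof
  assume "v \<in> set lam"
  then obtain k where "k < n" "lam ! k = v" by (auto simp: in_set_conv_nth)
  then show "\<exists>i\<in>{1..n}. part lam i = v" by (intro bexI[of _ "Suc k"]) (auto simp: part_def)
qed (use part_mem in auto)

lemma level_le: "v \<in> levels \<Longrightarrow> v \<le> m"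
  using set_lam part_antimono[of 1] by (auto simp: levels_def)

lemma finite_levels: "finite levels"
  by (simp add: levels_def)

lemma finite_rows: "finite (rows v)"
  by (simp add: rows_def)

lemma finite_V: "finite V"
  by (simp add: ferrers_vars_def)

lemma card_V: "card V = n + m"
proof -
  have "XVar ` {1..n} \<inter> YVar ` {1..m} = {}" by auto
  then show ?thesis
    unfolding ferrers_vars_def by (simp add: card_Un_disjoint card_image inj_on_def)
qed

lemma cover_simps [simp]:
  "XVar i \<in> cover v \<longleftrightarrow> i \<in> rows v" "YVar j \<in> cover v \<longleftrightarrow> 1 \<le> j \<and> j \<le> v"
  by (auto simp: cover_def)

lemma V_simps [simp]:
  "XVar i \<in> V \<longleftrightarrow> 1 \<le> i \<and> i \<le> n" "YVar j \<in> V \<longleftrightarrow> 1 \<le> j \<and> j \<le> m"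
  by (auto simp: ferrers_vars_def)

lemma card_cover: "card (cover v) = height v"
proof -
  have "XVar ` rows v \<inter> YVar ` {1..v} = {}" by auto
  then show ?thesis
    unfolding cover_def height_def
    using finite_rows by (simp add: card_Un_disjoint card_image inj_on_def)
qed

lemma cover_subset: "v \<in> levels \<Longrightarrow> cover v \<subseteq> V"
  using level_le[of v] by (auto simp: cover_def rows_def ferrers_vars_def)

lemma rows_mono: "v \<le> w \<Longrightarrow> rows w \<subseteq> rows v"
  by (auto simp: rows_def)

lemma rows_subset_imp:
  assumes "w \<in> levels" "rows v \<subseteq> rows w"
  shows "w \<le> v"
proof (rule ccontr)
  assume "\<not> w \<le> v"
  then obtain i where "i \<in> {1..n}" "part lam i = w" "v < w"
    using assms(1) set_lam by (auto simp: levels_def)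
  then have "i \<in> rows v" "i \<notin> rows w" by (auto simp: rows_def)
  then show False using assms(2) by blast
qed

text \<open>The y-part of a cover grows with the level while its x-part shrinks.\<close>

lemma cover_antichain:
  assumes "w \<in> levels" "cover v \<subseteq> cover w"
  shows "v = w"
proof (rule antisym)
  have "i \<in> rows w" if "i \<in> rows v" for i
    using assms(2) that cover_simps(1) by (metis subsetD)
  then show "w \<le> v" using rows_subset_imp[OF assms(1)] by blast
  show "v \<le> w"
  proof (cases "v = 0")
    case False
    then have "YVar v \<in> cover v" by simp
    then have "YVar v \<in> cover w" using assms(2) by blast
    then show ?thesis by simp
  qed simp
qed

lemma mult_pos: "0 < v \<Longrightarrow> mult v \<noteq> 0 \<longleftrightarrow> v \<in> levels"
  using set_lam[of v] by (auto simp: mult_def levels_def)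

lemma mult_pos': "0 < v \<Longrightarrow> v \<in> levels \<Longrightarrow> 1 \<le> mult v"
  using mult_pos[of v] by simp

lemma card_rows_diff:
  assumes "v \<le> w"
  shows "card (rows v - rows w) = (\<Sum>y\<in>{v<..w}. mult y)"
proof -
  have "rows v - rows w = (\<Union>y\<in>{v<..w}. {i \<in> {1..n}. part lam i = y})"
    by (auto simp: rows_def)
  moreover have "card (\<Union>y\<in>{v<..w}. {i \<in> {1..n}. part lam i = y}) = (\<Sum>y\<in>{v<..w}. mult y)"
    unfolding mult_def by (rule card_UN_disjoint) auto
  ultimately show ?thesis by simp
qed

lemma card_rows:
  assumes "v \<le> w"
  shows "card (rows v) = card (rows w) + (\<Sum>y\<in>{v<..w}. mult y)"
  using card_Diff_subset[OF finite_rows rows_mono[OF assms]] card_mono[OF finite_rows rows_mono[OF assms]]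
    card_rows_diff[OF assms] by simp

lemma rows_eq: "rows v = {1..card (rows v)}"
proof -
  have down: "j \<in> rows v" if "i \<in> rows v" "1 \<le> j" "j \<le> i" for i j
    using part_antimono[of j i] that by (auto simp: rows_def)
  have sub: "rows v \<subseteq> {1..card (rows v)}"
  proof
    fix i assume i: "i \<in> rows v"
    have "{1..i} \<subseteq> rows v" using down[OF i] by auto
    then have "card {1..i} \<le> card (rows v)" using card_mono[OF finite_rows] by blast
    then show "i \<in> {1..card (rows v)}" using i by (auto simp: rows_def)
  qed
  then show ?thesis using card_subset_eq[OF _ sub] by simp
qed

text \<open>Let v be the largest part of a row with x_i in S, or 0. No x_i in S belongs to the cover
  of level v, so S contains some y_j with j \<le> v, and a row with part v completes the
  edge.\<close>

lemma covers_hit: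
  assumes "\<And>v. v \<in> levels \<Longrightarrow> S \<inter> cover v \<noteq> {}"
  obtains i j where "i \<in> {1..n}" "j \<in> {1..part lam i}" "XVar i \<in> S" "YVar j \<in> S"
proof -
  define I where "I = {i \<in> {1..n}. XVar i \<in> S}"
  define v where "v = Max (insert 0 (part lam ` I))"
  have fin: "finite (insert 0 (part lam ` I))" by (simp add: I_def)
  have v: "v \<in> insert 0 (part lam ` I)" unfolding v_def using Max_in[OF fin] by blast
  have max: "part lam i \<le> v" if "i \<in> I" for i unfolding v_def using that by (intro Max_ge fin) simp
  have "v \<in> levels" using v part_mem by (auto simp: levels_def I_def)
  then obtain x where x: "x \<in> S" "x \<in> cover v" using assms by blast
  show thesis
  proof (cases x)
    case (XVar i)
    then have "i \<in> I" "v < part lam i" using x by (auto simp: I_def rows_def)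
    then show ?thesis using max by fastforce
  next
    case (YVar j)
    then have j: "1 \<le> j" "j \<le> v" using x by auto
    then obtain i where "i \<in> I" "v = part lam i" using v by auto
    then show ?thesis using that[of i j] x j YVar by (auto simp: I_def)
  qed
qed

text \<open>The value s is the largest repeated part, which is the one at the least index of
  repetition, or 0 if all parts are distinct.\<close>

lemma saturated_level:
  assumes "saturated lam"
  obtains s where "{0..s} \<subseteq> levels" "\<And>y. s < y \<Longrightarrow> mult y \<le> 1"
proof -
  have strict: "mult y \<le> 1" if "\<And>i j. 1 \<le> i \<Longrightarrow> i < j \<Longrightarrow> j \<le> n \<Longrightarrow> part lam i = y \<Longrightarrow> part lam j \<noteq> y" for y
  proof -
    have "a = b" if "a \<in> {i \<in> {1..n}. part lam i = y}" "b \<in> {i \<in> {1..n}. part lam i = y}" for a b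
      using that \<open>\<And>i j. 1 \<le> i \<Longrightarrow> i < j \<Longrightarrow> j \<le> n \<Longrightarrow> part lam i = y \<Longrightarrow> part lam j \<noteq> y\<close>
      by (metis (mono_tags, lifting) atLeastAtMost_iff linorder_neqE_nat mem_Collect_eq)
    then show ?thesis
      unfolding mult_def using card_le_Suc0_iff_eq[of "{i \<in> {1..n}. part lam i = y}"] by simp
  qed
  let ?Q = "\<lambda>i. 1 \<le> i \<and> i < n \<and> part lam i = part lam (i + 1)"
  show thesis
  proof (cases "sorted_wrt (>) lam")
    case True
    have "mult y \<le> 1" for y
    proof (rule strict)
      fix i j assume ij: "1 \<le> i" "i < j" "j \<le> n" "part lam i = y"
      then have "i - 1 < j - 1" "j - 1 < n" by linarith+
      then have "lam ! (j - 1) < lam ! (i - 1)" using sorted_wrt_nth_less[OF True] by blast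
      then show "part lam j \<noteq> y" using ij by (simp add: part_def)
    qed
    then show ?thesis using that[of 0] by (simp add: levels_def)
  next
    case False
    define i where "i = (LEAST i. ?Q i)"
    have sub: "{1..part lam i} \<subseteq> set lam" using assms False by (simp add: saturated_def Let_def i_def)
    have "mult y \<le> 1" if y: "part lam i < y" for y
    proof (rule strict)
      fix a b assume ab: "1 \<le> a" "a < b" "b \<le> n" "part lam a = y"
      show "part lam b \<noteq> y"
      proof
        assume "part lam b = y"
        then have "part lam (a + 1) = y"
          using part_antimono[of "a + 1" b] part_antimono[of a "a + 1"] ab by simp
        then have Q: "?Q a" using ab by simp
        then have "i \<le> a" unfolding i_def by (rule Least_le)
        moreover have "?Q i" unfolding i_def using Q by (rule LeastI)
        ultimately have "part lam a \<le> part lam i" using part_antimono[of i a] ab by simp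
        then show False using ab(4) y by simp
      qed
    qed
    moreover have "{0..part lam i} \<subseteq> levels"
    proof
      fix x assume "x \<in> {0..part lam i}"
      then show "x \<in> levels" using sub by (cases "x = 0") (auto simp: levels_def)
    qed
    ultimately show ?thesis using that by blast
  qed
qed

text \<open>
  With \<open>u\<close> the largest value missing below the first repeated part, \<open>v\<close> is the next smaller level
  and \<open>w\<close> the next larger part that is repeated.
\<close>

lemma not_saturated_pair:
  assumes "\<not> saturated lam"
  obtains v w where "v \<in> levels" "w \<in> levels" "v + 2 \<le> w" "2 \<le> card (rows v - rows w)"
    "\<And>x. x \<in> levels \<Longrightarrow> v < x \<Longrightarrow> x < w \<Longrightarrow> height v < height x \<and> height w < height x"
proof -
  let ?Q = "\<lambda>i. 1 \<le> i \<and> i < n \<and> part lam i = part lam (i + 1)"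
  have "\<exists>i. ?Q i"
  proof (rule ccontr)
    assume neg: "\<nexists>i. ?Q i"
    have "sorted_wrt (>) lam"
      unfolding sorted_wrt_iff_nth_Suc_transp[OF transp_on_greater]
    proof (intro allI impI)
      fix i assume i: "Suc i < length lam"
      then have "part lam (Suc i) \<noteq> part lam (Suc i + 1)" using neg by auto
      moreover have "part lam (Suc i + 1) \<le> part lam (Suc i)" using i by (intro part_antimono) auto
      ultimately show "lam ! i > lam ! Suc i" using i by (simp add: part_def)
    qed
    then show False using assms by (simp add: saturated_def)
  qed
  define i where "i = (LEAST i. ?Q i)"
  have i: "?Q i" unfolding i_def using \<open>\<exists>i. ?Q i\<close> by (rule LeastI_ex)
  define p where "p = part lam i"
  have notsub: "\<not> {1..p} \<subseteq> set lam" using assms by (simp add: saturated_def Let_def i_def p_def)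
  have p_lev: "p \<in> levels" using part_mem[of i] i by (simp add: p_def levels_def)
  have p2: "2 \<le> mult p"
  proof -
    have "{i, i + 1} \<subseteq> {j \<in> {1..n}. part lam j = p}" using i by (auto simp: p_def)
    then have "card {i, i + 1} \<le> mult p" unfolding mult_def by (intro card_mono) auto
    then show ?thesis by simp
  qed
  define U where "U = {u \<in> {1..p}. u \<notin> levels}"
  have "U \<noteq> {}" "finite U" using notsub by (auto simp: U_def levels_def)
  define u where "u = Max U"
  have u: "1 \<le> u" "u < p" "u \<notin> levels"
  proof -
    have "u \<in> U" unfolding u_def by (rule Max_in) fact+
    then have "u \<in> {1..p}" "u \<notin> levels" by (auto simp: U_def)
    then show "1 \<le> u" "u < p" "u \<notin> levels" using p_lev by (auto simp: order_le_less)
  qed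
  have above: "x \<in> levels" if "u < x" "x \<le> p" for x
  proof (rule ccontr)
    assume "x \<notin> levels"
    then have "x \<in> U" using that by (simp add: U_def)
    then have "x \<le> u" unfolding u_def by (rule Max_ge[OF \<open>finite U\<close>])
    then show False using that by simp
  qed
  define v where "v = Max {x \<in> levels. x < u}"
  have finv: "finite {x \<in> levels. x < u}" using finite_levels by simp
  have "0 \<in> {x \<in> levels. x < u}" using u(1) by (simp add: levels_def)
  then have "v \<in> {x \<in> levels. x < u}" unfolding v_def using finv by (intro Max_in) auto
  then have v: "v \<in> levels" "v < u" by auto
  have v_max: "x \<le> v" if "x \<in> levels" "x < u" for x
    unfolding v_def using that by (intro Max_ge finv) simp
  define w where "w = (LEAST x. u < x \<and> x \<le> p \<and> 2 \<le> mult x)"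
  have w: "u < w" "w \<le> p" "2 \<le> mult w"
    using LeastI[of "\<lambda>x. u < x \<and> x \<le> p \<and> 2 \<le> mult x" p] u(2) p2 unfolding w_def by auto
  have w_min: "mult x \<le> 1" if "u < x" "x < w" for x
    using not_less_Least[of x "\<lambda>x. u < x \<and> x \<le> p \<and> 2 \<le> mult x"] that w(2) unfolding w_def[symmetric] by auto
  have one: "mult x = 1" if "u < x" "x < w" for x
    using w_min[OF that] mult_pos'[of x] above[of x] that w(2) by simp
  have zero: "mult x = 0" if "v < x" "x \<le> u" for x
  proof -
    have "x \<notin> levels" using v_max[of x] that u(3) by (cases "x = u") auto
    then show ?thesis using mult_pos[of x] that by simp
  qed
  show thesis
  proof (rule that[OF v(1) above[OF w(1,2)]])
    show "v + 2 \<le> w" using v(2) w(1) by simp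
    have "mult w \<le> (\<Sum>y\<in>{v<..w}. mult y)" using v w(1) by (intro member_le_sum) auto
    then show "2 \<le> card (rows v - rows w)" using card_rows_diff[of v w] v w by simp
    fix x assume x: "x \<in> levels" "v < x" "x < w"
    have ux: "u < x" using v_max[of x] x u(3) by (metis leD linorder_neqE_nat)
    have "{v<..x} = {v<..u} \<union> {u<..x}" using v(2) ux by auto
    then have "(\<Sum>y\<in>{v<..x}. mult y) = (\<Sum>y\<in>{v<..u}. mult y) + (\<Sum>y\<in>{u<..x}. mult y)"
      by (simp add: sum.union_disjoint disjoint_iff)
    also have "(\<Sum>y\<in>{v<..u}. mult y) = 0" using zero by simp
    also have "(\<Sum>y\<in>{u<..x}. mult y) = (\<Sum>y\<in>{u<..x}. 1)" using one x(3) by (intro sum.cong) auto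
    finally have "card (rows v) = card (rows x) + (x - u)" using card_rows[of v x] x(2) by simp
    \<comment> \<open>The two heights differ by u - v: there is one row for each value from u + 1 to
      x and none for the values from v + 1 to u.\<close>
    then have 1: "height v < height x" using v(2) ux by (simp add: height_def)
    have "{x<..w} = insert w {x<..<w}" using x(3) by auto
    then have "(\<Sum>y\<in>{x<..w}. mult y) = mult w + (\<Sum>y\<in>{x<..<w}. mult y)" by simp
    also have "(\<Sum>y\<in>{x<..<w}. mult y) = (\<Sum>y\<in>{x<..<w}. 1)" using one ux by (intro sum.cong) auto
    finally have "card (rows x) = card (rows w) + mult w + (w - Suc x)"
      using card_rows[of x w] x(3) by simp
    \<comment> \<open>The two heights differ by \<open>mult w\<close> - 1, as the values strictly
      between x and w have one row each.\<close>
    then have "height w < height x" using w(3) x(3) by (simp add: height_def)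
    then show "height v < height x \<and> height w < height x" using 1 by simp
  qed
qed

text \<open>
  For a saturated partition the heights of the covers decrease up to the level \<open>s\<close> and increase
  from there on; covers of equal height are ordered such that those from \<open>s\<close> on come first.
\<close>

lemma saturated_ordering:
  assumes s: "{0..s} \<subseteq> levels" "\<And>y. s < y \<Longrightarrow> mult y \<le> 1"
  obtains xs where "set xs = levels"
    "\<And>i j. i \<le> j \<Longrightarrow> j < length xs \<Longrightarrow> height (xs ! i) \<le> height (xs ! j)"
    "\<And>t. 0 < t \<Longrightarrow> t < length xs \<Longrightarrow> \<exists>x. x \<notin> cover (xs ! t) \<and>
       (\<forall>s<t. x \<in> cover (xs ! s)) \<and> (\<exists>s<t. cover (xs ! s) \<subseteq> insert x (cover (xs ! t)))"
proof -
  have inc: "height a \<le> height b" if "s \<le> a" "a \<le> b" for a b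
  proof -
    have "(\<Sum>y\<in>{a<..b}. mult y) \<le> (\<Sum>y\<in>{a<..b}. 1)" using s(2) that by (intro sum_mono) simp
    then show ?thesis using card_rows[OF that(2)] that by (simp add: height_def)
  qed
  have dec: "height b \<le> height a" if "a \<le> b" "b \<le> s" for a b
  proof -
    have "1 \<le> mult y" if "y \<in> {a<..b}" for y
    proof -
      have "y \<in> levels" using s(1) that \<open>b \<le> s\<close> by auto
      then show ?thesis using mult_pos'[of y] that by auto
    qed
    then have "(\<Sum>y\<in>{a<..b}. 1) \<le> (\<Sum>y\<in>{a<..b}. mult y)" by (intro sum_mono)
    then show ?thesis using card_rows[OF that(1)] that by (simp add: height_def)
  qed
  \<comment> \<open>Among covers of equal height, the levels from s on come first in increasing
    order, then those below s in decreasing order; the offset m + 1 exceeds every rank of the first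
    kind.\<close>
  define rank where "rank v = (if s \<le> v then v - s else m + 1 + (s - v))" for v
  \<comment> \<open>A number above all ranks of levels, which makes \<open>key\<close> lexicographic
    in height and rank.\<close>
  define K where "K = 2 * m + s + 2"
  define key where "key v = height v * K + rank v" for v
  have rank: "rank v < K" if "v \<in> levels" for v
    using level_le[OF that] by (auto simp: rank_def K_def)
  have key_less: "key a < key b" if "a \<in> levels" "height a < height b \<or> height a = height b \<and> rank a < rank b" for a b
    using that(2)
  proof
    assume "height a < height b"
    then have "height a * K + K \<le> height b * K" by (metis Suc_leI add.commute mult_Suc mult_le_mono1)
    then show ?thesis using rank[OF that(1)] by (simp add: key_def)
  qed (simp add: key_def)
  have key_le: "height a \<le> height b" if "key a \<le> key b" "b \<in> levels" for a b
    using key_less[OF that(2), of a] that(1) by (meson leD not_le_imp_less)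
  have s_lev: "s \<in> levels" using s(1) by auto
  have inj: "a = b" if "a \<in> levels" "b \<in> levels" "key a = key b" for a b
  proof -
    have "height a = height b" using key_le[of a b] key_le[of b a] that by simp
    then have "rank a = rank b" using that(3) by (simp add: key_def)
    then show ?thesis
      using level_le[OF that(1)] level_le[OF that(2)] by (auto simp: rank_def split: if_splits)
  qed
  define xs where "xs = sort_key key (sorted_list_of_set levels)"
  have set_xs: "set xs = levels" using finite_levels by (simp add: xs_def)
  have dist: "distinct xs" by (simp add: xs_def)
  have sorted: "sorted (map key xs)" by (simp add: xs_def)
  have key_nth: "key (xs ! i) \<le> key (xs ! j)" if "i \<le> j" "j < length xs" for i j
    using sorted_nth_mono[OF sorted that(1)] that by simp
  have nth_lev: "xs ! i \<in> levels" if "i < length xs" for i using set_xs that nth_mem by blast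
  have key_nth_less: "key (xs ! i) < key (xs ! j)" if "i < j" "j < length xs" for i j
  proof -
    have "xs ! i \<noteq> xs ! j" using dist that by (simp add: nth_eq_iff_index_eq)
    then have "key (xs ! i) \<noteq> key (xs ! j)" using inj nth_lev that by (meson less_trans)
    then show ?thesis using key_nth[of i j] that by simp
  qed
  have index: "\<exists>i<t. xs ! i = u" if "u \<in> levels" "t < length xs" "key u < key (xs ! t)" for u t
  proof -
    have "u \<in> set xs" using that(1) set_xs by simp
    then obtain i where i: "i < length xs" "xs ! i = u" unfolding in_set_conv_nth by blast
    have "i < t"
    proof (rule ccontr)
      assume "\<not> i < t"
      then have "key (xs ! t) \<le> key (xs ! i)" using key_nth[of t i] i(1) by simp
      then show False using that(3) i(2) by simp
    qed
    then show ?thesis using i(2) by blast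
  qed
  show thesis
  proof (rule that[of xs])
    show "set xs = levels" by fact
    show "height (xs ! i) \<le> height (xs ! j)" if "i \<le> j" "j < length xs" for i j
      using key_le[OF key_nth[OF that] nth_lev[OF that(2)]] .
    fix t assume t: "0 < t" "t < length xs"
    define v where "v = xs ! t"
    have v: "v \<in> levels" unfolding v_def using nth_lev t(2) .
    have earlier: "key (xs ! i) < key v \<and> xs ! i \<in> levels" if "i < t" for i
      using key_nth_less[OF that t(2)] nth_lev[of i] that t(2) by (simp add: v_def)
    consider "v = s" | "s < v" | "v < s" by linarith
    then have "\<exists>x. x \<notin> cover v \<and> (\<forall>s<t. x \<in> cover (xs ! s)) \<and>
        (\<exists>s<t. cover (xs ! s) \<subseteq> insert x (cover v))"
    proof cases
      \<comment> \<open>The level s has least height and rank 0, so it heads the list, against t >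
        0.\<close>
      case 1
      let ?u = "xs ! 0"
      have "height s \<le> height ?u" using inc[of s ?u] dec[of ?u s] by (cases "s \<le> ?u") auto
      then have "height s * K \<le> height ?u * K" by (rule mult_le_mono1)
      moreover have "rank s = 0" by (simp add: rank_def)
      ultimately have "key s \<le> key ?u" unfolding key_def by linarith
      then show ?thesis using earlier[OF t(1)] 1 by simp
    next
      case 2
      \<comment> \<open>Heights increase from s on, so every earlier level is smaller than v. Its
        cover therefore contains the variable of the only row of length v, and the next smaller
        level, which comes earlier, needs only this variable besides those of v.\<close>
      have below: "u < v" if u: "u \<in> levels" "key u < key v" for u
      proof (rule ccontr)
        assume "\<not> u < v"
        then have uv: "v < u" using u(2) by (cases "u = v") auto
        then have "height v \<le> height u" using inc[of v u] 2 by simp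
        moreover have "rank v < rank u" using uv 2 by (simp add: rank_def)
        ultimately have "key v < key u" using key_less[OF v, of u] by linarith
        then show False using u(2) by simp
      qed
      define v' where "v' = Max {x \<in> levels. x < v}"
      have fin: "finite {x \<in> levels. x < v}" using finite_levels by simp
      have "v' \<in> {x \<in> levels. x < v}" unfolding v'_def using fin s_lev 2 by (intro Max_in) auto
      then have v': "v' \<in> levels" "v' < v" by auto
      have v'_max: "x \<le> v'" if "x \<in> levels" "x < v" for x
        unfolding v'_def using that by (intro Max_ge fin) simp
      have sv': "s \<le> v'" using v'_max[OF s_lev 2] .
      have "height v' \<le> height v" using inc[OF sv'] v'(2) by simp
      moreover have "rank v' < rank v" using v'(2) sv' by (simp add: rank_def)
      ultimately have "key v' < key v" using key_less[OF v'(1), of v] by linarith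
      then obtain k where k: "k < t" "xs ! k = v'" using index[OF v'(1) t(2)] by (auto simp: v_def)
      have "v \<in> set lam" using v 2 by (auto simp: levels_def)
      then obtain i where i: "i \<in> {1..n}" "part lam i = v" using set_lam by blast
      have uniq: "j = i" if "j \<in> {1..n}" "part lam j = v" for j
      proof -
        have "card {i \<in> {1..n}. part lam i = v} \<le> 1" using s(2)[OF 2] by (simp add: mult_def)
        then show ?thesis using card_le_Suc0_iff_eq[of "{i \<in> {1..n}. part lam i = v}"] i that by auto
      qed
      have "rows v' \<subseteq> insert i (rows v)"
      proof
        fix j assume "j \<in> rows v'"
        then have j: "j \<in> {1..n}" "v' < part lam j" by (auto simp: rows_def)
        have "v \<le> part lam j"
          using v'_max[of "part lam j"] part_mem[OF j(1)] j(2) by (force simp: levels_def)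
        then show "j \<in> insert i (rows v)" using uniq[OF j(1)] j(1) by (cases "part lam j = v") (auto simp: rows_def)
      qed
      then have "cover v' \<subseteq> insert (XVar i) (cover v)" using v'(2) by (fastforce simp: cover_def)
      moreover have "XVar i \<notin> cover v" using i by (simp add: rows_def)
      moreover have "XVar i \<in> cover (xs ! k)" if "k < t" for k
        using below[of "xs ! k"] earlier[OF that] i by (simp add: rows_def)
      ultimately show ?thesis using k by blast
    next
      case 3
      \<comment> \<open>Heights decrease up to s, so every earlier level is larger than v and its
        cover contains y_(v+1); the cover of the level v + 1, which comes earlier, needs only this
        variable besides those of v.\<close>
      have above: "v < u" if u: "u \<in> levels" "key u < key v" for u
      proof (rule ccontr)
        assume "\<not> v < u"
        then have uv: "u < v" using u(2) by (cases "u = v") auto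
        then have "height v \<le> height u" using dec[of u v] 3 by simp
        moreover have "rank v < rank u" using uv 3 by (simp add: rank_def)
        ultimately have "key v < key u" using key_less[OF v, of u] by linarith
        then show False using u(2) by simp
      qed
      have lev: "Suc v \<in> levels" using s(1) 3 by auto
      have "height (Suc v) \<le> height v" using dec[of v "Suc v"] 3 by simp
      moreover have "rank (Suc v) < rank v" using 3 by (auto simp: rank_def)
      ultimately have "key (Suc v) < key v" using key_less[OF lev, of v] by linarith
      then obtain k where k: "k < t" "xs ! k = Suc v" using index[OF lev t(2)] by (auto simp: v_def)
      have "cover (Suc v) \<subseteq> insert (YVar (Suc v)) (cover v)"
        using rows_mono[of v "Suc v"] by (auto simp: cover_def)
      moreover have "YVar (Suc v) \<notin> cover v" by simp
      moreover have "YVar (Suc v) \<in> cover (xs ! k)" if "k < t" for k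
        using above[of "xs ! k"] earlier[OF that] by simp
      ultimately show ?thesis using k by metis
    qed
    then show "\<exists>x. x \<notin> cover (xs ! t) \<and> (\<forall>s<t. x \<in> cover (xs ! s)) \<and>
        (\<exists>s<t. cover (xs ! s) \<subseteq> insert x (cover (xs ! t)))"
      unfolding v_def .
  qed
qed

end


section \<open>Ferrers ideals\<close>

context ferrers_shape
begin

text \<open>The decomposition into minimal primes. An edge meets every cover, so the generators lie
  in each prime; conversely a term whose support meets every cover is divisible by a generator, by
  \<open>covers_hit\<close>.\<close>

lemma ferrers_ideal_eq:
  fixes R :: "(ferrers_var, 'k::field) mpoly set"
  assumes "polynomials V R"
  shows "ferrers_ideal lam = polynomials.monomial_ideal R (cover ` levels)"
proof -
  interpret polynomials V R by fact
  interpret cring "set_ring R" by (rule cring_set_ring)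
  let ?G = "{mvar (XVar i) * mvar (YVar j) | i j. i \<in> {1..n} \<and> j \<in> {1..part lam i}}
    :: (ferrers_var, 'k) mpoly set"
  let ?I = "Idl\<^bsub>set_ring R\<^esub> ?G"
  have part_le: "j \<le> m" if "i \<in> {1..n}" "j \<le> part lam i" for i j
    using level_le[of "part lam i"] part_mem[OF that(1)] that(2) by (simp add: levels_def)
  have GR: "?G \<subseteq> R"
  proof
    fix p assume "p \<in> ?G"
    then obtain i j where "p = mvar (XVar i) * mvar (YVar j)" "i \<in> {1..n}" "j \<in> {1..part lam i}" by blast
    then show "p \<in> R" using part_le[of i j] by (auto intro!: mult_mem mvar_mem)
  qed
  have "?G \<subseteq> monomial_ideal (cover ` levels)"
  proof
    fix p assume p: "p \<in> ?G"
    then obtain i j where ij: "p = mvar (XVar i) * mvar (YVar j)" "i \<in> {1..n}" "j \<in> {1..part lam i}" by blast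
    have V': "XVar i \<in> V" "YVar j \<in> V" using ij part_le[of i j] by auto
    have "p \<in> variable_ideal C" if C: "C \<in> cover ` levels" for C
    proof -
      obtain v where v: "C = cover v" using C by blast
      have "XVar i \<in> C \<or> YVar j \<in> C" using ij(2,3) v by (auto simp: rows_def)
      then show ?thesis
        unfolding ij(1) prime_mult_iff[OF is_prime_variable_ideal mvar_mem[OF V'(1)] mvar_mem[OF V'(2)]]
        using mvar_mem_monomial_ideal[OF V'(1), of "{C}"] mvar_mem_monomial_ideal[OF V'(2), of "{C}"]
        by simp
    qed
    then have "\<forall>C\<in>cover ` levels. p \<in> variable_ideal C" by (rule ballI)
    moreover have "p \<in> R" using p GR by blast
    ultimately show "p \<in> monomial_ideal (cover ` levels)" using iffD2[OF monomial_ideal_mem_iff] by blast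
  qed
  then have 1: "?I \<subseteq> monomial_ideal (cover ` levels)"
    using genideal_minimal is_ideal_iff is_ideal_monomial_ideal by blast
  have I: "is_ideal ?I" using genideal_ideal[of ?G] GR is_ideal_iff by simp
  have "p \<in> ?I" if p: "p \<in> monomial_ideal (cover ` levels)" for p
  proof (rule poly_induct_single)
    fix t assume t: "t \<in> keys p"
    have "p \<in> R" using p monomial_ideal_subset by blast
    then have tV: "keys t \<subseteq> V" using t by (simp add: mem_R)
    have hit: "keys t \<inter> cover v \<noteq> {}" if "v \<in> levels" for v
      using p t that by (simp add: monomial_ideal_def)
    obtain i j where ij: "i \<in> {1..n}" "j \<in> {1..part lam i}" "XVar i \<in> keys t" "YVar j \<in> keys t"
      using covers_hit[of "keys t", OF hit] by blast
    let ?u = "single (XVar i) 1 + single (YVar j) 1 :: ferrers_var \<Rightarrow>\<^sub>0 nat"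
    let ?t = "t - ?u"
    have u: "?u + ?t = t"
    proof (rule poly_mapping_eqI)
      fix x
      have "1 \<le> lookup t (XVar i)" "1 \<le> lookup t (YVar j)" using ij(3,4) by (auto simp: in_keys_iff)
      then show "lookup (?u + ?t) x = lookup t x"
        by (auto simp: lookup_add lookup_minus lookup_single when_def)
    qed
    have "keys t = keys ?u \<union> keys ?t" using keys_add_nat[of ?u ?t] u by simp
    then have tR: "single ?t (lookup p t) \<in> R" using tV by (auto simp: mem_R)
    have "mvar (XVar i) * mvar (YVar j) \<in> ?G" using ij(1,2) by blast
    then have "mvar (XVar i) * mvar (YVar j) \<in> ?I" using genideal_self[of ?G] GR by auto
    then have "single ?t (lookup p t) * (mvar (XVar i) * mvar (YVar j)) \<in> ?I"
      using ideal_mult[OF I tR] by blast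
    moreover have "single ?t (lookup p t) * (mvar (XVar i) * mvar (YVar j)) = single t (lookup p t)"
      using u by (simp add: mvar_def mult_single add.commute)
    ultimately show "single t (lookup p t) \<in> ?I" by simp
  qed (use ideal_0[OF I] ideal_add[OF I] in auto)
  then have "?I = monomial_ideal (cover ` levels)" using 1 by blast
  then show ?thesis unfolding ferrers_ideal_def poly_ring_eq R_eq[symmetric] by simp
qed

lemma not_seq_cohen_macaulay_ferrers:
  fixes R :: "(ferrers_var, 'k::field) mpoly set"
  assumes "polynomials V R" "\<not> saturated lam"
  shows "\<not> seq_cohen_macaulay_ideal V (polynomials.monomial_ideal R (cover ` levels))"
proof -
  interpret polynomials V R by fact
  obtain v w where vw: "v \<in> levels" "w \<in> levels" "v + 2 \<le> w" "2 \<le> card (rows v - rows w)"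
    "\<And>x. x \<in> levels \<Longrightarrow> v < x \<Longrightarrow> x < w \<Longrightarrow> height v < height x \<and> height w < height x"
    using not_saturated_pair[OF assms(2)] by blast
  have fin: "finite (cover ` levels)" using finite_levels by simp
  have sub: "C \<subseteq> V" if "C \<in> cover ` levels" for C using that cover_subset by blast
  have anti: "C = C'" if "C \<in> cover ` levels" "C' \<in> cover ` levels" "C \<subseteq> C'" for C C'
    using that cover_antichain by blast
  have finC: "finite (cover x)" for x by (simp add: cover_def finite_rows)
  have d1: "2 \<le> card (cover v - cover w)"
  proof -
    have "XVar ` (rows v - rows w) \<subseteq> cover v - cover w" by auto
    then have "card (XVar ` (rows v - rows w)) \<le> card (cover v - cover w)"
      using finC by (intro card_mono) auto
    then show ?thesis using vw(4) by (simp add: card_image inj_on_def)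
  qed
  have d2: "2 \<le> card (cover w - cover v)"
  proof -
    have "YVar ` {v<..w} \<subseteq> cover w - cover v" by auto
    then have "card (YVar ` {v<..w}) \<le> card (cover w - cover v)"
      using finC by (intro card_mono) auto
    then show ?thesis using vw(3) by (simp add: card_image inj_on_def)
  qed
  \<comment> \<open>A cover inside the union of the two has its level between v and w, and strictly
    in between the height is too large.\<close>
  have other: "C = cover v \<or> C = cover w"
    if C: "C \<in> cover ` levels" "card C \<le> max (height v) (height w)" "C \<subseteq> cover v \<union> cover w" for C
  proof -
    obtain x where x: "x \<in> levels" "C = cover x" using C(1) by blast
    have "x \<le> w"
    proof (cases "x = 0")
      case False
      then have "YVar x \<in> cover x" by simp
      then have "YVar x \<in> cover v \<union> cover w" using C(3) x(2) by blast
      then show ?thesis using vw(3) by auto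
    qed simp
    moreover have "v \<le> x"
    proof (rule rows_subset_imp[OF vw(1)], rule subsetI)
      fix i assume "i \<in> rows x"
      then have "XVar i \<in> cover x" by simp
      then have "XVar i \<in> cover v \<union> cover w" using C(3) x(2) by blast
      then show "i \<in> rows v" using rows_mono[of v w] vw(3) by auto
    qed
    ultimately show ?thesis
      using vw(5)[OF x(1)] C(2) x(2) card_cover[of x] by (cases "x = v"; cases "x = w") auto
  qed
  \<comment> \<open>The cover of smaller height takes the role of E; the x-variables or the
    y-variables provide its two elements outside G.\<close>
  show ?thesis
  proof (cases "height v \<le> height w")
    case True
    show ?thesis
      using True vw d1 other
      by (intro not_seq_cohen_macaulay[OF fin sub anti, of "cover v" "cover w"]) (auto simp: card_cover)
  next
    case False
    show ?thesis
      using False vw d2 other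
      by (intro not_seq_cohen_macaulay[OF fin sub anti, of "cover w" "cover v"]) (auto simp: card_cover)
  qed
qed

text \<open>
  The forms are \<open>x\<^sub>a + y\<^sub>b\<close> for \<open>a + b = h + 1\<close>, and the variables of index above \<open>h\<close>. A cover of
  height \<open>h\<close> contains exactly one of \<open>x\<^sub>a\<close> and \<open>y\<^sub>b\<close>, so modulo its prime each form becomes one of the
  remaining variables.
\<close>

lemma regular_linear_forms:
  fixes R :: "(ferrers_var, 'k::field) mpoly set"
  assumes "polynomials V R" and h: "h \<in> height ` levels"
  shows "\<exists>fs. length fs = card V - h \<and>
    set fs \<subseteq> irrelevant_ideal (poly_ring V) (poly_grading V) \<and>
    (\<forall>v\<in>levels. height v = h \<longrightarrow> weakly_regular fs R (polynomials.monomial_ideal R {cover v}))"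
proof -
  interpret polynomials V R by fact
  \<comment> \<open>The indices a for which x_a and y_(h+1-a) are both variables of the
    ring.\<close>
  define js where "js = [max 1 (Suc h - m)..<Suc (min h n)]"
  define ks where "ks = [Suc h..<Suc n]"
  define ls where "ls = [Suc h..<Suc m]"
  have js: "a \<in> set js \<longleftrightarrow> 1 \<le> a \<and> a \<le> h \<and> a \<le> n \<and> Suc h - a \<le> m" for a by (auto simp: js_def)
  have ks: "a \<in> set ks \<longleftrightarrow> h < a \<and> a \<le> n" for a by (auto simp: ks_def)
  have ls: "a \<in> set ls \<longleftrightarrow> h < a \<and> a \<le> m" for a by (auto simp: ls_def)
  define f :: "nat \<Rightarrow> (ferrers_var, 'k) mpoly" where
    "f a = mvar (XVar a) + mvar (YVar (Suc h - a))" for a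
  define fs :: "(ferrers_var, 'k) mpoly list" where
    "fs = map f js @ map (\<lambda>a. mvar (XVar a)) ks @ map (\<lambda>b. mvar (YVar b)) ls"
  have lev: "card (rows v) \<le> n" "v \<le> m" if "v \<in> levels" for v
  proof -
    have "rows v \<subseteq> {1..n}" by (auto simp: rows_def)
    then show "card (rows v) \<le> n" using card_mono[of "{1..n}" "rows v"] by simp
  qed (rule level_le[OF that])
  obtain v0 where "v0 \<in> levels" "height v0 = h" using h by blast
  then have "h \<le> n + m" using lev[of v0] by (auto simp: height_def)
  then have len: "length fs = card V - h"
    unfolding fs_def js_def ks_def ls_def card_V by (auto simp: max_def min_def)
  have fR: "f a \<in> R" if "a \<in> set js" for a
    unfolding f_def using that by (intro add_mem mvar_mem) (auto simp: js)
  have fsR: "g \<in> R" if "g \<in> set fs" for g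
    using that fR by (auto simp: fs_def ks ls intro!: mvar_mem)
  have deg: "monom_deg t = 1" if gt: "g \<in> set fs" "t \<in> keys g" for g t
  proof -
    have "keys (f a) \<subseteq> {single (XVar a) 1, single (YVar (Suc h - a)) 1}" for a
      using keys_add[of "mvar (XVar a)" "mvar (YVar (Suc h - a)) :: (ferrers_var, 'k) mpoly"]
      unfolding f_def keys_mvar by auto
    then obtain x where "t = single x 1" using gt by (fastforce simp: fs_def keys_mvar)
    then show ?thesis by (simp only: monom_deg_single)
  qed
  have irr: "set fs \<subseteq> irrelevant_ideal (poly_ring V) (poly_grading V)"
    using linear_form_irrelevant fsR deg by blast
  have "weakly_regular fs R (variable_ideal (cover v))" if v: "v \<in> levels" "height v = h" for v
  proof -
    define b where "b = card (rows v)"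
    have bh: "b + v = h" "b \<le> n" "v \<le> m" using v lev[OF v(1)] by (simp_all add: height_def b_def)
    have "rows v = {1..b}" unfolding b_def by (rule rows_eq)
    then have rows: "i \<in> rows v \<longleftrightarrow> 1 \<le> i \<and> i \<le> b" for i by simp
    \<comment> \<open>The variable that survives in the a-th form: the cover contains x_a for a
      \<le> b, and for a > b it contains y_(h+1-a) because h + 1 - a \<le> h - b = v.\<close>
    define x where "x a = (if a \<le> b then YVar (Suc h - a) else XVar a)" for a
    define ps where "ps = map (\<lambda>a. (x a, f a)) js @ map (\<lambda>a. (XVar a, mvar (XVar a))) ks @
      map (\<lambda>b. (YVar b, mvar (YVar b))) ls"
    have snd_ps: "map snd ps = fs" by (simp add: ps_def fs_def comp_def)
    have fst_ps: "map fst ps = map x js @ map XVar ks @ map YVar ls" by (simp add: ps_def comp_def)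
    have "inj_on x (set js)"
    proof (rule inj_onI)
      fix a c assume "a \<in> set js" "c \<in> set js" "x a = x c"
      then show "a = c" by (auto simp: x_def js split: if_splits)
    qed
    moreover have "distinct js" "distinct ks" "distinct ls" by (simp_all add: js_def ks_def ls_def)
    moreover have "x a \<noteq> XVar c" if "a \<in> set js" "c \<in> set ks" for a c
      using that by (auto simp: x_def js ks)
    moreover have "x a \<noteq> YVar c" if "a \<in> set js" "c \<in> set ls" for a c
      using that by (auto simp: x_def js ls)
    ultimately have "distinct (map fst ps)"
      unfolding fst_ps by (auto simp: distinct_map inj_on_def)
    moreover have "y \<in> V - cover v" if yg: "(y, g) \<in> set ps" for y g
    proof -
      consider a where "a \<in> set js" "y = x a" | a where "a \<in> set ks" "y = XVar a"
        | a where "a \<in> set ls" "y = YVar a" using yg by (auto simp: ps_def)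
      then show ?thesis
        using bh by cases (auto simp: x_def js ks ls rows)
    qed
    moreover have "g \<in> R \<and> g - mvar y \<in> variable_ideal (cover v)" if yg: "(y, g) \<in> set ps" for y g
    proof -
      have gR: "g \<in> R" using yg snd_ps fsR by (metis in_set_conv_nth length_map nth_map snd_conv)
      have zero: "0 \<in> variable_ideal (cover v)" using ideal_0[OF is_ideal_monomial_ideal] .
      consider a where "a \<in> set js" "y = x a" "g = f a" | "g = mvar y" using yg by (auto simp: ps_def)
      then show ?thesis
      proof cases
        case 1
        show ?thesis
        proof (cases "a \<le> b")
          case True
          have a: "XVar a \<in> V" using 1(1) by (simp add: js)
          have "g - mvar y = mvar (XVar a)" using 1 True by (simp add: f_def x_def)
          moreover have "mvar (XVar a) \<in> variable_ideal (cover v)"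
            using mvar_mem_monomial_ideal[OF a, of "{cover v}"] True 1(1) by (simp add: rows js)
          ultimately show ?thesis using gR by simp
        next
          case False
          have a: "YVar (Suc h - a) \<in> V" using 1(1) by (auto simp: js)
          have "g - mvar y = mvar (YVar (Suc h - a))" using 1 False by (simp add: f_def x_def)
          moreover have "mvar (YVar (Suc h - a)) \<in> variable_ideal (cover v)"
            using mvar_mem_monomial_ideal[OF a, of "{cover v}"] False 1(1) bh by (auto simp: js)
          ultimately show ?thesis using gR by simp
        qed
      next
        case 2
        then show ?thesis using gR zero by simp
      qed
    qed
    ultimately show ?thesis using weakly_regular_variables[of ps "cover v"] snd_ps by simp
  qed
  then show ?thesis using len irr by blast
qed

lemma seq_cohen_macaulay_ferrers:
  fixes R :: "(ferrers_var, 'k::field) mpoly set"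
  assumes "polynomials V R" "saturated lam"
  shows "seq_cohen_macaulay_ideal V (polynomials.monomial_ideal R (cover ` levels))"
proof -
  interpret polynomials V R by fact
  obtain s where s: "{0..s} \<subseteq> levels" "\<And>y. s < y \<Longrightarrow> mult y \<le> 1"
    using saturated_level[OF assms(2)] by blast
  obtain xs where xs: "set xs = levels"
    "\<And>i j. i \<le> j \<Longrightarrow> j < length xs \<Longrightarrow> height (xs ! i) \<le> height (xs ! j)"
    "\<And>t. 0 < t \<Longrightarrow> t < length xs \<Longrightarrow> \<exists>x. x \<notin> cover (xs ! t) \<and>
       (\<forall>s<t. x \<in> cover (xs ! s)) \<and> (\<exists>s<t. cover (xs ! s) \<subseteq> insert x (cover (xs ! t)))"
    using saturated_ordering[OF s] by blast
  have set_Cs: "set (map cover xs) = cover ` levels" by (simp add: xs(1))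
  have "seq_cohen_macaulay_ideal V (monomial_ideal (set (map cover xs)))"
  proof (rule seq_cohen_macaulay_idealI)
    show "C \<subseteq> V" if "C \<in> set (map cover xs)" for C using that cover_subset set_Cs by auto
    show "C = C'" if "C \<in> set (map cover xs)" "C' \<in> set (map cover xs)" "C \<subseteq> C'" for C C'
      using that cover_antichain unfolding set_Cs by blast
    show "card (map cover xs ! i) \<le> card (map cover xs ! j)" if "i \<le> j" "j < length (map cover xs)" for i j
      using xs(2)[of i j] that by (simp add: card_cover)
    show "\<exists>x\<in>V. x \<notin> map cover xs ! t \<and> (\<forall>s<t. x \<in> map cover xs ! s) \<and>
        (\<exists>s<t. map cover xs ! s \<subseteq> insert x (map cover xs ! t))"
      if t: "0 < t" "t < length (map cover xs)" for t
    proof -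
      have t': "t < length xs" using t(2) by simp
      have nth: "map cover xs ! s = cover (xs ! s)" if "s \<le> t" for s using that t' by simp
      obtain x s where x: "x \<notin> cover (xs ! t)" "\<forall>s<t. x \<in> cover (xs ! s)"
        and s: "s < t" "cover (xs ! s) \<subseteq> insert x (cover (xs ! t))" using xs(3)[OF t(1) t'] by blast
      have "xs ! 0 \<in> levels" using xs(1) t(1) t' by (metis less_trans nth_mem)
      then have "x \<in> V" using x(2) t(1) cover_subset by blast
      then show ?thesis
        using x s nth[of t] nth[of s] nth[OF less_imp_le] by (intro bexI[of _ x] conjI exI[of _ s]) simp_all
    qed
    show "\<exists>fs. length fs = card V - h \<and> set fs \<subseteq> irrelevant_ideal (poly_ring V) (poly_grading V) \<and>
        (\<forall>C\<in>set (map cover xs). card C = h \<longrightarrow> weakly_regular fs R (variable_ideal C))"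
      if h: "h \<in> card ` set (map cover xs)" for h
    proof -
      have "h \<in> height ` levels" using h unfolding set_Cs by (auto simp: card_cover)
      from regular_linear_forms[OF assms(1) this] show ?thesis
        unfolding set_Cs by (auto simp: card_cover)
    qed
  qed
  then show ?thesis unfolding set_Cs .
qed

end

theorem theorem1p3:
  fixes lam :: "nat list"
  assumes "is_partition lam"
  shows "seq_cohen_macaulay_ideal (ferrers_vars lam)
           (ferrers_ideal lam :: (ferrers_var, 'k::field) mpoly set)
         \<longleftrightarrow> saturated lam"
proof -
  interpret ferrers_shape lam by standard fact
  let ?R = "{p. vars p \<subseteq> ferrers_vars lam} :: (ferrers_var, 'k) mpoly set"
  have R: "polynomials (ferrers_vars lam) ?R" by standard (simp_all add: finite_V)
  show ?thesis
    unfolding ferrers_ideal_eq[OF R]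
    using not_seq_cohen_macaulay_ferrers[OF R] seq_cohen_macaulay_ferrers[OF R] by blast
qed

end
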